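(* For every integer $k \ge 3$ there exists a constant $c_k > 0$ such that for all integers $\Delta \ge 1/c_k$ and $n \ge 2^{\Delta}$, there exists a $k$-uniform hypergraph $H$ on $n$ vertices with maximum degree at most $\Delta$ such that $$r(H) \ge \mathrm{tw}_{k-1}(c_k \Delta)\cdot n.$$
   Context: For a $k$-uniform hypergraph ($k$-graph) $H$, the Ramsey number $r(H)$ is the smallest integer $N$ such that every red/blue coloring of the edges of the complete $k$-uniform hypergraph $K_N^{(k)}$ contains a monochromatic copy of $H$. The degree of a vertex in a $k$-graph is the number of edges containing it; the maximum degree is the maximum of this over all vertices. The tower function is defined by $\mathrm{tw}_1(x) = x$ and $\mathrm{tw}_{i+1}(x) = 2^{\mathrm{tw}_i(x)}$ for $i \ge 1$. *)

theory Defs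
  imports Complex_Main "HOL-Library.Ramsey"
begin

definition uniform_hypergraph :: "nat \<Rightarrow> 'a set \<Rightarrow> 'a set set \<Rightarrow> bool" where
  "uniform_hypergraph k V E \<longleftrightarrow> finite V \<and> E \<subseteq> [V]\<^bsup>k\<^esup>"

definition hdegree :: "'a set set \<Rightarrow> 'a \<Rightarrow> nat" where
  "hdegree E v = card {e \<in> E. v \<in> e}"

definition max_hdegree :: "'a set \<Rightarrow> 'a set set \<Rightarrow> nat" where
  "max_hdegree V E = Max (hdegree E ` V)"

definition mono_copy ::
  "'a set \<Rightarrow> 'a set set \<Rightarrow> nat \<Rightarrow> (nat set \<Rightarrow> nat) \<Rightarrow> bool" where
  "mono_copy V E N \<chi> \<longleftrightarrow>
     (\<exists>f i. inj_on f V \<and> f \<in> V \<rightarrow> {..<N} \<and> (\<forall>e\<in>E. \<chi> (f ` e) = i))"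

definition hypergraph_arrows :: "nat \<Rightarrow> nat \<Rightarrow> 'a set \<Rightarrow> 'a set set \<Rightarrow> bool" where
  "hypergraph_arrows k N V E \<longleftrightarrow>
     (\<forall>\<chi> \<in> [{..<N}]\<^bsup>k\<^esup> \<rightarrow> {..<2}. mono_copy V E N \<chi>)"

definition ramsey_number :: "nat \<Rightarrow> 'a set \<Rightarrow> 'a set set \<Rightarrow> nat" where
  "ramsey_number k V E = (LEAST N. hypergraph_arrows k N V E)"

text \<open>The set of admissible \<open>N\<close> is nonempty, so the minimum above is attained.\<close>

lemma hypergraph_arrows_exists:
  assumes "uniform_hypergraph k V E"
  shows "\<exists>N. hypergraph_arrows k N V E"
proof -
  have fin: "finite V" and E: "E \<subseteq> [V]\<^bsup>k\<^esup>"
    using assms by (auto simp: uniform_hypergraph_def)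
  obtain N :: nat where N: "partn_lst {..<N} [card V, card V] k"
    using ramsey_full by blast
  have "mono_copy V E N \<chi>" if chi: "\<chi> \<in> [{..<N}]\<^bsup>k\<^esup> \<rightarrow> {..<2}" for \<chi>
  proof -
    have "\<exists>i < 2. monochromatic {..<N} ([card V, card V] ! i) k \<chi> i"
      using N chi by (auto simp: partn_lst_def numeral_2_eq_2)
    then obtain i H where i: "i < 2" and H: "H \<in> [{..<N}]\<^bsup>([card V, card V] ! i)\<^esup>"
      and img: "\<chi> ` ([H]\<^bsup>k\<^esup>) \<subseteq> {i}"
      unfolding monochromatic_def by blast
    have "[card V, card V] ! i = card V"
      using i by (auto simp: less_2_cases_iff)
    with H have HN: "H \<subseteq> {..<N}" and "finite H" and "card H = card V"
      by (auto simp: nsets_def)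
    with fin obtain f where f: "bij_betw f V H"
      by (metis finite_same_card_bij)
    have "\<chi> (f ` e) = i" if "e \<in> E" for e
    proof -
      have "e \<subseteq> V" "finite e" "card e = k" using that E by (auto simp: nsets_def)
      moreover have "inj_on f e"
        using f \<open>e \<subseteq> V\<close> by (meson bij_betw_def inj_on_subset)
      ultimately have "f ` e \<in> [H]\<^bsup>k\<^esup>"
        using f by (auto simp: nsets_def card_image bij_betw_def)
      then show ?thesis using img by blast
    qed
    moreover have "inj_on f V" "f \<in> V \<rightarrow> {..<N}"
      using f HN by (auto simp: bij_betw_def)
    ultimately show ?thesis unfolding mono_copy_def by blast
  qed
  then show ?thesis unfolding hypergraph_arrows_def by blast
qed

text \<open>The index starts at 1; \<open>tw 0\<close> is left unspecified.\<close>

fun tw :: "nat \<Rightarrow> real \<Rightarrow> real" where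
  "tw (Suc 0) x = x"
| "tw (Suc (Suc i)) x = 2 powr tw (Suc i) x"

end

theory Submission
  imports Defs "HOL-Real_Asymp.Real_Asymp"
begin

text \<open>
  Edges are coloured through blocks: split the vertices of the complete hypergraph into \<open>M\<close> blocks
  of size \<open>\<beta> n\<close> and colour a \<open>k\<close>-set by the set of blocks it meets. A copy of \<open>H\<close> then becomes a
  map \<open>\<phi>\<close> from its vertices to \<open>M\<close> points with fibres of size at most \<open>\<beta> n\<close>, and \<open>H\<close> must
  have edges of both colours under each such map.

  For triples take \<open>M\<close> exponential in \<open>\<Delta>\<close> and a colouring balanced on all sets of size
  \<open>s \<approx> \<Delta> powr (2 / 3)\<close>, with \<open>\<beta>\<close> of order \<open>1 / s\<close>: each map has a constant density of tuples of
  either colour, so about \<open>\<Delta> n\<close> well-chosen edges hit all \<open>(M + 1) ^ n\<close> cases. Each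
  Erdos-Hajnal step-up replaces \<open>M\<close> by \<open>2 ^ M\<close>, and points become leaves of a binary tree. Look at
  the subtrees hanging between two root-to-leaf paths. If most vertices lie in light ones, a set of
  vertices forms a one-sided comb, on which the colouring is that of the previous step applied
  to the levels. Otherwise there are few, heavy subtrees, and tuples having two vertices in the same
  heavy subtree realise both a local maximum and a local minimum of the bit sequence, hence both
  colours. Their density is only of order \<open>\<beta>\<close>, but such a situation is described by a labelling of the
  vertices with \<open>O(1 / \<beta>)\<close> labels, so \<open>\<Delta> n\<close> edges again suffice, as \<open>\<beta> \<Delta>\<close> exceeds the logarithm
  of the number of labels.
\<close>

text \<open>A step-up raises the arity of the colouring, while the edges must keep one size. So
  edges are k-sets from the start, and the colouring of arity j is read on a window of j consecutive
  vertices of an edge, ordered by block. Combs shift or reverse windows; hence the inductive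
  statement covers every offset, and one edge set serves all k - 3 steps.

  The obstacle is the cost of enumeration. A union bound over all maps into M points costs n log M,
  affordable when M is exponential in \<Delta> but hopeless after one step-up. Maps into more points
  are therefore never enumerated: they enter only through their level maps, to which the previous
  step applies, and through labellings that forget the points.

  The exponent 2 / 3 can be replaced by any number strictly between 1 / 2 and 1. A balanced
  colouring of exponentially many points needs s ^ 2 to exceed a multiple of \<Delta>, whereas pairs
  inside bundles have density of order 1 / s, so that \<Delta> / s has to exceed a multiple of log
  s.\<close>

section \<open>Highest differing bits and the step-up colouring\<close>

text \<open>For x = y the value is 0, as for two points that differ in the last bit only. Thus
  monotonicity and the ultrametric inequality hold without exception, while statements that separate
  points assume them distinct.\<close>

definition diff_bit :: "nat \<Rightarrow> nat \<Rightarrow> nat" where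
  "diff_bit x y = (LEAST i. x div 2 ^ Suc i = y div 2 ^ Suc i)"

lemma div_power_eq_mono:
  fixes x y :: nat
  assumes "x div 2 ^ i = y div 2 ^ i" "i \<le> j"
  shows "x div 2 ^ j = y div 2 ^ j"
proof -
  have "2 ^ j = 2 ^ i * (2::nat) ^ (j - i)"
    using assms(2) by (simp flip: power_add)
  then show ?thesis
    using assms(1) by (metis div_mult2_eq)
qed

lemma diff_bit_le_iff: "diff_bit x y \<le> i \<longleftrightarrow> x div 2 ^ Suc i = y div 2 ^ Suc i"
proof
  have "x < 2 ^ Suc (x + y)" "y < 2 ^ Suc (x + y)"
    using less_exp[of "Suc (x + y)"] by linarith+
  then have "x div 2 ^ Suc (x + y) = y div 2 ^ Suc (x + y)"
    by simp
  then have "x div 2 ^ Suc (diff_bit x y) = y div 2 ^ Suc (diff_bit x y)"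
    unfolding diff_bit_def by (rule LeastI)
  then show "x div 2 ^ Suc i = y div 2 ^ Suc i" if "diff_bit x y \<le> i"
    using div_power_eq_mono that by blast
next
  show "diff_bit x y \<le> i" if "x div 2 ^ Suc i = y div 2 ^ Suc i"
    unfolding diff_bit_def using that by (rule Least_le)
qed

lemma diff_bit_less:
  assumes "x < 2 ^ m" "y < 2 ^ m" "x \<noteq> y"
  shows "diff_bit x y < m"
proof (cases m)
  case 0
  then show ?thesis using assms by simp
next
  case (Suc i)
  then have "diff_bit x y \<le> i"
    using assms by (simp add: diff_bit_le_iff del: power_Suc)
  then show ?thesis using Suc by simp
qed

lemma diff_bit_ultrametric: "diff_bit x z \<le> max (diff_bit x y) (diff_bit y z)"
proof -
  let ?i = "max (diff_bit x y) (diff_bit y z)"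
  have "x div 2 ^ Suc ?i = y div 2 ^ Suc ?i" "y div 2 ^ Suc ?i = z div 2 ^ Suc ?i"
    using diff_bit_le_iff max.cobounded1 max.cobounded2 by blast+
  then show ?thesis by (simp add: diff_bit_le_iff del: power_Suc)
qed

text \<open>Division by a power of two is monotone, so whatever lies between two points with a
  common ancestor has the same ancestor.\<close>

lemma diff_bit_subinterval:
  assumes "x \<le> x'" "x' \<le> y'" "y' \<le> y"
  shows "diff_bit x' y' \<le> diff_bit x y"
proof -
  let ?p = "2 ^ Suc (diff_bit x y) :: nat"
  have "x div ?p = y div ?p" using diff_bit_le_iff by blast
  moreover have "x div ?p \<le> x' div ?p" "x' div ?p \<le> y' div ?p" "y' div ?p \<le> y div ?p"
    using assms by (auto intro: div_le_mono)
  ultimately have "x' div ?p = y' div ?p" by linarith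
  then show ?thesis using diff_bit_le_iff by blast
qed

lemma diff_bit_div_neq:
  assumes "x \<noteq> y"
  shows "x div 2 ^ diff_bit x y \<noteq> y div 2 ^ diff_bit x y"
proof (cases "diff_bit x y")
  case 0
  then show ?thesis using assms by simp
next
  case (Suc i)
  then have "\<not> diff_bit x y \<le> i" by simp
  then show ?thesis using Suc diff_bit_le_iff by metis
qed

text \<open>With a common level i, the three points would have three distinct ancestors at level i
  below one parent, but a node has only two children.\<close>

lemma diff_bit_adjacent_neq:
  assumes "x < y" "y < z"
  shows "diff_bit x y \<noteq> diff_bit y z"
proof
  assume eq: "diff_bit x y = diff_bit y z"
  define i where "i = diff_bit x y"
  have "x div 2 ^ i < y div 2 ^ i"
    using diff_bit_div_neq[of x y] assms div_le_mono[of x y "2 ^ i"] by (simp add: i_def)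
  moreover have "y div 2 ^ i < z div 2 ^ i"
    using diff_bit_div_neq[of y z] assms div_le_mono[of y z "2 ^ i"] eq by (simp add: i_def)
  moreover have "x div 2 ^ Suc i = z div 2 ^ Suc i"
    using diff_bit_le_iff[of x y i] diff_bit_le_iff[of y z i] eq by (simp add: i_def)
  then have "x div 2 ^ i div 2 = z div 2 ^ i div 2"
    by (simp only: power_Suc2 div_mult2_eq)
  ultimately show False by linarith
qed

lemma diff_bit_eq_max:
  assumes "x < y" "y < z"
  shows "diff_bit x z = max (diff_bit x y) (diff_bit y z)"
  using diff_bit_ultrametric[of x z y] diff_bit_subinterval[of x x y z]
    diff_bit_subinterval[of x y z z] assms by (simp add: le_antisym)

text \<open>Seen from z, a point that leaves the path to z at a higher level lies further left, and
  that level is also its difference from every point that leaves lower. This is what makes a comb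
  out of rising levels.\<close>

lemma left_of_ordered:
  assumes "x < z" "y < z" "diff_bit y z < diff_bit x z"
  shows "x < y" "diff_bit x y = diff_bit x z"
proof -
  show "x < y"
  proof (rule ccontr)
    assume "\<not> x < y"
    then have "diff_bit x z \<le> diff_bit y z"
      using diff_bit_subinterval[of y x z z] assms by simp
    then show False using assms by simp
  qed
  then show "diff_bit x y = diff_bit x z"
    using diff_bit_eq_max[of x y z] assms by (simp add: max_def split: if_splits)
qed

lemma right_of_ordered:
  assumes "z < x" "z < y" "diff_bit z x < diff_bit z y"
  shows "x < y" "diff_bit x y = diff_bit z y"
proof -
  show "x < y"
  proof (rule ccontr)
    assume "\<not> x < y"
    then have "diff_bit z y \<le> diff_bit z x"
      using diff_bit_subinterval[of z z y x] assms by simp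
    then show False using assms by simp
  qed
  then show "diff_bit x y = diff_bit z y"
    using diff_bit_eq_max[of z x y] assms by (simp add: max_def split: if_splits)
qed

text \<open>The Erdos-Hajnal rule. Decreasing differences are reversed because \<open>C\<close> is
  evaluated on increasing lists. In the last branch, if the second difference is a local maximum the
  value is \<open>True\<close>, if it is a local minimum the value is \<open>False\<close>; this is
  all that is used of it.\<close>

definition step_up :: "(nat list \<Rightarrow> bool) \<Rightarrow> nat list \<Rightarrow> bool" where
  "step_up C xs =
     (let ds = map2 diff_bit xs (tl xs) in
      if sorted_wrt (<) ds then C ds
      else if sorted_wrt (>) ds then C (rev ds)
      else ds ! 0 < ds ! 1)"

fun stepped_up :: "(nat list \<Rightarrow> bool) \<Rightarrow> nat \<Rightarrow> nat list \<Rightarrow> bool" where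
  "stepped_up C 0 = C"
| "stepped_up C (Suc i) = step_up (stepped_up C i)"

lemma step_up_local_extremum:
  assumes "length xs \<ge> 4"
    and "diff_bit (xs ! 0) (xs ! 1) < diff_bit (xs ! 1) (xs ! 2) \<and>
           diff_bit (xs ! 2) (xs ! 3) < diff_bit (xs ! 1) (xs ! 2) \<and> b \<or>
         diff_bit (xs ! 0) (xs ! 1) > diff_bit (xs ! 1) (xs ! 2) \<and>
           diff_bit (xs ! 2) (xs ! 3) > diff_bit (xs ! 1) (xs ! 2) \<and> \<not> b"
  shows "step_up C xs = b"
proof -
  let ?ds = "map2 diff_bit xs (tl xs)"
  have len: "length ?ds \<ge> 3" using assms(1) by simp
  have nth: "?ds ! i = diff_bit (xs ! i) (xs ! Suc i)" if "i < 3" for i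
    using that assms(1) by (simp add: nth_tl)
  have ds: "?ds ! 0 = diff_bit (xs ! 0) (xs ! 1)" "?ds ! 1 = diff_bit (xs ! 1) (xs ! 2)"
    "?ds ! 2 = diff_bit (xs ! 2) (xs ! 3)"
    using nth[of 0] nth[of 1] nth[of 2] by (simp_all add: numeral_eq_Suc)
  have inc: "\<not> sorted_wrt (<) ?ds"
  proof
    assume "sorted_wrt (<) ?ds"
    then have "?ds ! 0 < ?ds ! 1" "?ds ! 1 < ?ds ! 2"
      using len sorted_wrt_nth_less[of "(<)" ?ds 0 1] sorted_wrt_nth_less[of "(<)" ?ds 1 2] by simp_all
    then show False using assms(2) unfolding ds by linarith
  qed
  have dec: "\<not> sorted_wrt (>) ?ds"
  proof
    assume "sorted_wrt (>) ?ds"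
    then have "?ds ! 0 > ?ds ! 1" "?ds ! 1 > ?ds ! 2"
      using len sorted_wrt_nth_less[of "(>)" ?ds 0 1] sorted_wrt_nth_less[of "(>)" ?ds 1 2] by simp_all
    then show False using assms(2) unfolding ds by linarith
  qed
  have "step_up C xs = (?ds ! 0 < ?ds ! 1)"
    unfolding step_up_def Let_def using inc dec by simp
  then show ?thesis unfolding ds using assms(2) by auto
qed

lemma map2_window:
  assumes "length xs = K" "a + Suc j \<le> K"
  shows "map2 f (take (Suc j) (drop a xs)) (tl (take (Suc j) (drop a xs))) =
    map (\<lambda>i. f (xs ! (a + i)) (xs ! (a + Suc i))) [0..<j]"
  using assms by (intro nth_equalityI) (auto simp: nth_tl)

text \<open>Relative to a point z to the left, the difference of two comb points is the level of the
  later one. The first point of a window thus contributes no level, and Suc j points from offset a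
  turn into j levels from offset Suc a.\<close>

lemma step_up_right_comb:
  assumes len: "length vs = K" and aj: "a + Suc j \<le> K"
    and z: "\<And>v. v \<in> set vs \<Longrightarrow> z < \<phi> v"
    and srt: "sorted_wrt (<) (map (\<lambda>v. diff_bit z (\<phi> v)) vs)"
  shows "sorted_wrt (<) (map \<phi> vs)"
    and "step_up C (take (Suc j) (drop a (map \<phi> vs))) =
         C (take j (drop (Suc a) (map (\<lambda>v. diff_bit z (\<phi> v)) vs)))"
proof -
  let ?l = "\<lambda>v. diff_bit z (\<phi> v)"
  have less: "\<phi> (vs ! i) < \<phi> (vs ! i')" "diff_bit (\<phi> (vs ! i)) (\<phi> (vs ! i')) = ?l (vs ! i')"
    if "i < i'" "i' < K" for i i'
  proof -
    have "?l (vs ! i) < ?l (vs ! i')"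
      using sorted_wrt_nth_less[OF srt, of i i'] that len by simp
    moreover have "z < \<phi> (vs ! i)" "z < \<phi> (vs ! i')" using z that len by simp_all
    ultimately show "\<phi> (vs ! i) < \<phi> (vs ! i')"
      "diff_bit (\<phi> (vs ! i)) (\<phi> (vs ! i')) = ?l (vs ! i')"
      using right_of_ordered by blast+
  qed
  show "sorted_wrt (<) (map \<phi> vs)"
    using less(1) len by (simp add: sorted_wrt_iff_nth_less)
  let ?xs = "take (Suc j) (drop a (map \<phi> vs))"
  let ?w = "take j (drop (Suc a) (map ?l vs))"
  have ds: "map2 diff_bit ?xs (tl ?xs) = ?w"
    using len aj less(2) by (subst map2_window[of _ K]) (auto intro!: nth_equalityI)
  have "sorted_wrt (<) ?w" using srt sorted_wrt_take sorted_wrt_drop by blast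
  then show "step_up C ?xs = C ?w" unfolding step_up_def Let_def ds by simp
qed

text \<open>Relative to a point on the right, rising levels mean falling points: the tuple has to be
  reversed, and a difference is the level of the earlier point. The decreasing branch of
  \<open>step_up\<close> undoes the reversal, which moves the window to offset K - a - j. Two levels
  are needed to tell the two monotone branches apart.\<close>

lemma step_up_left_comb:
  assumes len: "length vs = K" and aj: "a + Suc j \<le> K" and j: "j \<ge> 2"
    and z: "\<And>v. v \<in> set vs \<Longrightarrow> \<phi> v < z"
    and srt: "sorted_wrt (<) (map (\<lambda>v. diff_bit (\<phi> v) z) vs)"
  shows "sorted_wrt (<) (map \<phi> (rev vs))"
    and "step_up C (take (Suc j) (drop a (map \<phi> (rev vs)))) =
         C (take j (drop (K - a - j) (map (\<lambda>v. diff_bit (\<phi> v) z) vs)))"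
proof -
  let ?l = "\<lambda>v. diff_bit (\<phi> v) z"
  let ?ws = "rev vs"
  have srt': "sorted_wrt (>) (map ?l ?ws)"
    using srt by (simp add: sorted_wrt_rev flip: rev_map)
  have less: "\<phi> (?ws ! i) < \<phi> (?ws ! i')" "diff_bit (\<phi> (?ws ! i)) (\<phi> (?ws ! i')) = ?l (?ws ! i)"
    if "i < i'" "i' < K" for i i'
  proof -
    have "?l (?ws ! i) > ?l (?ws ! i')"
      using sorted_wrt_nth_less[OF srt', of i i'] that len by simp
    moreover have "?ws ! i \<in> set vs" "?ws ! i' \<in> set vs"
      using that len by (metis length_rev less_trans nth_mem set_rev)+
    then have "\<phi> (?ws ! i) < z" "\<phi> (?ws ! i') < z" using z by blast+
    ultimately show "\<phi> (?ws ! i) < \<phi> (?ws ! i')"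
      "diff_bit (\<phi> (?ws ! i)) (\<phi> (?ws ! i')) = ?l (?ws ! i)"
      using left_of_ordered by blast+
  qed
  show "sorted_wrt (<) (map \<phi> ?ws)"
    using less(1) len by (simp add: sorted_wrt_iff_nth_less)
  let ?xs = "take (Suc j) (drop a (map \<phi> ?ws))"
  let ?w = "take j (drop a (map ?l ?ws))"
  have ds: "map2 diff_bit ?xs (tl ?xs) = ?w"
    using len aj less(2) by (subst map2_window[of _ K]) (auto intro!: nth_equalityI)
  have dec: "sorted_wrt (>) ?w" using srt' sorted_wrt_take sorted_wrt_drop by blast
  have lw: "length ?w = j" using len aj by simp
  then have "?w ! 0 > ?w ! 1" using sorted_wrt_nth_less[OF dec, of 0 1] j by simp
  then have "\<not> sorted_wrt (<) ?w"
    using lw j sorted_wrt_nth_less[of "(<)" ?w 0 1] by auto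
  then have "step_up C ?xs = C (rev ?w)" unfolding step_up_def Let_def ds using dec by simp
  also have "rev ?w = take j (drop (K - a - j) (map ?l vs))"
    using len aj by (intro nth_equalityI) (auto simp: rev_nth intro!: arg_cong[of _ _ "\<lambda>i. ?l (vs ! i)"])
  finally show "step_up C ?xs = C (take j (drop (K - a - j) (map ?l vs)))" .
qed

section \<open>Greedy hypergraphs of bounded degree\<close>

definition vertex_lists :: "nat \<Rightarrow> 'a set \<Rightarrow> 'a list set" where
  "vertex_lists K V = {vs. length vs = K \<and> set vs \<subseteq> V}"

lemma finite_vertex_lists: "finite V \<Longrightarrow> finite (vertex_lists K V)"
  unfolding vertex_lists_def using finite_lists_length_eq[of V K] by (simp add: conj_commute)

lemma card_vertex_lists: "finite V \<Longrightarrow> card (vertex_lists K V) = card V ^ K"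
  unfolding vertex_lists_def using card_lists_length_eq[of V K] by (simp add: conj_commute)

lemma sum_hdegree:
  assumes "finite V" "finite E" "E \<subseteq> [V]\<^bsup>K\<^esup>"
  shows "(\<Sum>v\<in>V. hdegree E v) = K * card E"
proof -
  have "(\<Sum>v\<in>V. hdegree E v) = (\<Sum>v\<in>V. \<Sum>e\<in>E. if v \<in> e then 1 else 0)"
    unfolding hdegree_def using assms(2)
    by (intro sum.cong refl) (simp flip: sum.inter_filter)
  also have "\<dots> = (\<Sum>e\<in>E. \<Sum>v\<in>V. if v \<in> e then 1 else 0)"
    by (rule sum.swap)
  also have "\<dots> = (\<Sum>e\<in>E. K)"
  proof (intro sum.cong refl)
    fix e assume "e \<in> E"
    then have "e \<subseteq> V" "card e = K" using assms(3) by (auto simp: nsets_def)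
    then have "{v \<in> V. v \<in> e} = e" by blast
    then show "(\<Sum>v\<in>V. if v \<in> e then 1 else 0) = K"
      using assms(1) \<open>card e = K\<close> by (simp flip: sum.inter_filter)
  qed
  finally show ?thesis by (simp add: mult.commute)
qed

text \<open>Double counting. Densities are measured against N and not against the size of \<Omega>,
  because in the application \<Omega> loses the tuples through saturated vertices while the density
  bound stays relative to all tuples.\<close>

lemma popular_element:
  fixes p :: real
  assumes "finite I" "finite \<Omega>" "I \<noteq> {}" "p > 0"
    and F: "\<And>i. i \<in> I \<Longrightarrow> real (card {x \<in> \<Omega>. x \<in> F i}) \<ge> p * real N"
    and N: "card \<Omega> \<le> N"
    and N0: "N > 0"
  shows "\<exists>x\<in>\<Omega>. real (card {i \<in> I. x \<in> F i}) \<ge> p * real (card I)"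
proof (rule ccontr)
  assume "\<not> ?thesis"
  then have less: "real (card {i \<in> I. x \<in> F i}) < p * real (card I)" if "x \<in> \<Omega>" for x
    using that by force
  have I0: "card I > 0" using assms(1,3) by (simp add: card_gt_0_iff)
  obtain i where "i \<in> I" using assms(3) by blast
  then have "real (card {x \<in> \<Omega>. x \<in> F i}) > 0" using F[of i] N0 \<open>p > 0\<close>
    by (smt (verit) mult_pos_pos of_nat_0_less_iff)
  then have ne: "\<Omega> \<noteq> {}" by auto
  have "p * real N * real (card I) \<le> (\<Sum>i\<in>I. real (card {x \<in> \<Omega>. x \<in> F i}))"
    using sum_mono[of I "\<lambda>_. p * real N", OF F] by (simp add: mult.commute)
  also have "\<dots> = (\<Sum>i\<in>I. \<Sum>x\<in>\<Omega>. if x \<in> F i then 1 else 0)"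
    using assms(2) by (intro sum.cong refl) (simp flip: sum.inter_filter)
  also have "\<dots> = (\<Sum>x\<in>\<Omega>. \<Sum>i\<in>I. if x \<in> F i then 1 else 0)"
    by (rule sum.swap)
  also have "\<dots> = (\<Sum>x\<in>\<Omega>. real (card {i \<in> I. x \<in> F i}))"
    using assms(1) by (intro sum.cong refl) (simp flip: sum.inter_filter)
  also have "\<dots> < (\<Sum>x\<in>\<Omega>. p * real (card I))"
    using less ne assms(2) by (intro sum_strict_mono) auto
  also have "\<dots> \<le> p * real N * real (card I)"
    using N \<open>p > 0\<close> I0 by simp
  finally show False by simp
qed

text \<open>Instead of taking random edges, each step adds a tuple that hits the most families
  among those not hit yet and that avoids the vertices of full degree.\<close>

lemma greedy_hitting_hypergraph:
  fixes F :: "'i \<Rightarrow> 'a list set" and p t :: real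
  assumes V: "finite V" "V \<noteq> {}" and I: "finite I" and D: "D > 0" and p: "0 < p" "p < 1"
    and F: "\<And>i. i \<in> I \<Longrightarrow> F i \<subseteq> {vs \<in> vertex_lists K V. distinct vs}"
    and dense: "\<And>i W. i \<in> I \<Longrightarrow> W \<subseteq> V \<Longrightarrow> real (card W) \<le> t * real (card V) \<Longrightarrow>
       real (card {vs \<in> F i. set vs \<inter> W = {}}) \<ge> p * real (card V) ^ K"
    and m: "real K * real m \<le> t * real (card V) * real D"
    and small: "real (card I) * (1 - p) ^ m < 1"
  shows "\<exists>E. E \<subseteq> [V]\<^bsup>K\<^esup> \<and> (\<forall>v. hdegree E v \<le> D) \<and> (\<forall>i\<in>I. \<exists>vs\<in>F i. set vs \<in> E)"
proof -
  have "\<exists>E. finite E \<and> E \<subseteq> [V]\<^bsup>K\<^esup> \<and> (\<forall>v. hdegree E v \<le> D) \<and> card E \<le> m' \<and>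
     real (card {i \<in> I. \<forall>vs\<in>F i. set vs \<notin> E}) \<le> real (card I) * (1 - p) ^ m'"
    if "m' \<le> m" for m'
    using that
  proof (induction m')
    case 0
    show ?case by (intro exI[of _ "{}"]) (auto simp: hdegree_def I intro!: card_mono)
  next
    case (Suc m')
    then obtain E where E: "finite E" "E \<subseteq> [V]\<^bsup>K\<^esup>" "\<forall>v. hdegree E v \<le> D" "card E \<le> m'"
      and unhit: "real (card {i \<in> I. \<forall>vs\<in>F i. set vs \<notin> E}) \<le> real (card I) * (1 - p) ^ m'"
      by auto
    define J where "J = {i \<in> I. \<forall>vs\<in>F i. set vs \<notin> E}"
    have "finite J" using I unfolding J_def by simp
    show ?case
    proof (cases "J = {}")
      case True
      then show ?thesis
        using E p by (intro exI[of _ E]) (simp flip: J_def)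
    next
      case False
      define W where "W = {v \<in> V. hdegree E v = D}"
      \<comment> \<open>Each saturated vertex accounts for D of the at most K m incidences. The
        bound on m thus keeps W within the fraction t that the density hypothesis tolerates.\<close>
      have "D * card W = (\<Sum>v\<in>W. hdegree E v)" unfolding W_def by simp
      also have "\<dots> \<le> (\<Sum>v\<in>V. hdegree E v)"
        using V unfolding W_def by (intro sum_mono2) auto
      also have "\<dots> \<le> K * m"
        using sum_hdegree[OF V(1) E(1,2)] E(4) Suc.prems by simp
      finally have "real D * real (card W) \<le> real K * real m"
        by (metis of_nat_le_iff of_nat_mult)
      then have "real D * real (card W) \<le> real D * (t * real (card V))"
        using m by (simp add: algebra_simps)
      then have W: "real (card W) \<le> t * real (card V)" using D by simp
      define \<Omega> where "\<Omega> = {vs \<in> vertex_lists K V. distinct vs \<and> set vs \<inter> W = {}}"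
      have "\<Omega> \<subseteq> vertex_lists K V" unfolding \<Omega>_def by blast
      then have \<Omega>: "finite \<Omega>" "card \<Omega> \<le> card V ^ K"
        using finite_vertex_lists[OF V(1)] card_vertex_lists[OF V(1)]
        by (metis finite_subset, metis card_mono)
      have "\<exists>vs\<in>\<Omega>. real (card {i \<in> J. vs \<in> F i}) \<ge> p * real (card J)"
      proof (rule popular_element)
        show "finite J" by fact
        show "p * real (card V ^ K) \<le> real (card {vs \<in> \<Omega>. vs \<in> F i})" if "i \<in> J" for i
        proof -
          have i: "i \<in> I" using that unfolding J_def by blast
          have "{vs \<in> \<Omega>. vs \<in> F i} = {vs \<in> F i. set vs \<inter> W = {}}"
            using F[OF i] unfolding \<Omega>_def by blast
          then show ?thesis using dense[OF i _ W] unfolding W_def by simp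
        qed
        show "card V ^ K > 0" using V by (simp add: card_gt_0_iff)
      qed (use False \<Omega> p in auto)
      then obtain vs where vs: "vs \<in> \<Omega>" and hit: "real (card {i \<in> J. vs \<in> F i}) \<ge> p * real (card J)"
        by blast
      define E' where "E' = insert (set vs) E"
      have vsV: "set vs \<in> [V]\<^bsup>K\<^esup>"
        using vs unfolding \<Omega>_def vertex_lists_def nsets_def by (auto simp: distinct_card)
      have deg: "hdegree E' v \<le> D" for v
      proof (cases "v \<in> set vs")
        case True
        then have "hdegree E v \<noteq> D" using vs unfolding \<Omega>_def W_def vertex_lists_def by blast
        then have "hdegree E v < D" using E(3) by (simp add: le_neq_implies_less)
        moreover have "{e \<in> E'. v \<in> e} = insert (set vs) {e \<in> E. v \<in> e}"
          using True unfolding E'_def by blast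
        then have "hdegree E' v \<le> Suc (hdegree E v)"
          unfolding hdegree_def using E(1) by (simp add: card_insert_if)
        ultimately show ?thesis by simp
      next
        case False
        then have "{e \<in> E'. v \<in> e} = {e \<in> E. v \<in> e}" unfolding E'_def by blast
        then show ?thesis using E(3) unfolding hdegree_def by simp
      qed
      have size: "card E' \<le> Suc m'"
        using E unfolding E'_def by (simp add: card_insert_if)
      have hits: "real (card {i \<in> I. \<forall>vs\<in>F i. set vs \<notin> E'}) \<le> real (card I) * (1 - p) ^ Suc m'"
      proof -
        have J'_le: "card {i \<in> J. vs \<in> F i} \<le> card J"
          using \<open>finite J\<close> by (intro card_mono) auto
        have "{i \<in> I. \<forall>vs\<in>F i. set vs \<notin> E'} \<subseteq> J - {i \<in> J. vs \<in> F i}"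
          unfolding J_def E'_def by blast
        then have "card {i \<in> I. \<forall>vs\<in>F i. set vs \<notin> E'} \<le> card (J - {i \<in> J. vs \<in> F i})"
          using I unfolding J_def by (intro card_mono) auto
        also have "\<dots> = card J - card {i \<in> J. vs \<in> F i}"
          using I unfolding J_def by (intro card_Diff_subset) auto
        finally have "card {i \<in> I. \<forall>vs\<in>F i. set vs \<notin> E'} + card {i \<in> J. vs \<in> F i} \<le> card J"
          using J'_le by linarith
        then have "real (card {i \<in> I. \<forall>vs\<in>F i. set vs \<notin> E'}) + real (card {i \<in> J. vs \<in> F i})
            \<le> real (card J)" by linarith
        then have "real (card {i \<in> I. \<forall>vs\<in>F i. set vs \<notin> E'}) \<le> (1 - p) * real (card J)"
          using hit unfolding left_diff_distrib by linarith
        also have "\<dots> \<le> (1 - p) * (real (card I) * (1 - p) ^ m')"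
          using unhit p unfolding J_def by (intro mult_left_mono) auto
        finally show ?thesis by (simp add: mult_ac)
      qed
      have sub: "finite E'" "E' \<subseteq> [V]\<^bsup>K\<^esup>"
        using E(1,2) vsV unfolding E'_def by auto
      show ?thesis by (intro exI[of _ E'] conjI allI sub deg size hits)
    qed
  qed
  from this[OF order_refl] obtain E where E: "E \<subseteq> [V]\<^bsup>K\<^esup>" "\<forall>v. hdegree E v \<le> D"
    and le: "real (card {i \<in> I. \<forall>vs\<in>F i. set vs \<notin> E}) \<le> real (card I) * (1 - p) ^ m"
    by blast
  from le have "card {i \<in> I. \<forall>vs\<in>F i. set vs \<notin> E} = 0" using small by linarith
  then have "{i \<in> I. \<forall>vs\<in>F i. set vs \<notin> E} = {}" using I by simp
  then have "\<forall>i\<in>I. \<exists>vs\<in>F i. set vs \<in> E" by blast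
  with E show ?thesis by blast
qed

section \<open>Counting tuples through vertex sets separated by a map\<close>

lemma card_listset_ge:
  assumes "\<And>A. A \<in> set As \<Longrightarrow> finite A \<and> g \<le> real (card A)" "g \<ge> 0"
  shows "finite (listset As)" "real (card (listset As)) \<ge> g ^ length As"
proof -
  have "finite (listset As) \<and> real (card (listset As)) \<ge> g ^ length As"
    using assms(1)
  proof (induction As)
    case (Cons A As)
    have eq: "listset (A # As) = (\<lambda>(x, xs). x # xs) ` (A \<times> listset As)"
      by (auto simp: set_Cons_def)
    have "inj_on (\<lambda>(x, xs). x # xs) (A \<times> listset As)" by (auto simp: inj_on_def)
    then have "card (listset (A # As)) = card A * card (listset As)"
      unfolding eq by (simp add: card_image card_cartesian_product)
    moreover have "finite A" "g \<le> real (card A)" using Cons.prems by auto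
    moreover have "finite (listset As)" "g ^ length As \<le> real (card (listset As))"
      using Cons by auto
    ultimately show ?case
      unfolding eq using assms(2) by (auto intro!: mult_mono)
  qed simp
  then show "finite (listset As)" "real (card (listset As)) \<ge> g ^ length As" by auto
qed

lemma in_listset_iff: "xs \<in> listset As \<longleftrightarrow> length xs = length As \<and> (\<forall>i<length As. xs ! i \<in> As ! i)"
proof (induction As arbitrary: xs)
  case (Cons A As)
  then show ?case
    by (cases xs) (auto simp: set_Cons_def less_Suc_eq_0_disj)
qed auto

text \<open>Prefix and middle have fixed lengths, so a concatenation determines its parts and the
  counts multiply. In use, the outer positions range independently over sets, and \<open>Mid\<close>
  carries the correlated pair or triple.\<close>

lemma card_concat_lists_ge:
  fixes g :: real
  assumes "\<And>A. A \<in> set As \<union> set Bs \<Longrightarrow> finite A \<and> g \<le> real (card A)" "g \<ge> 0"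
    and Mid: "finite Mid" "\<And>xs. xs \<in> Mid \<Longrightarrow> length xs = h"
    and sub: "\<And>xs ys zs. xs \<in> listset As \<Longrightarrow> ys \<in> Mid \<Longrightarrow> zs \<in> listset Bs \<Longrightarrow> xs @ ys @ zs \<in> F"
    and F: "finite F"
  shows "real (card F) \<ge> g ^ (length As + length Bs) * real (card Mid)"
proof -
  let ?P = "listset As \<times> Mid \<times> listset Bs"
  let ?f = "\<lambda>(xs, ys, zs). xs @ ys @ zs"
  have inj: "inj_on ?f ?P"
    using Mid(2) by (fastforce simp: inj_on_def in_listset_iff)
  have "?f ` ?P \<subseteq> F" using sub by auto
  then have "card ?P \<le> card F"
    using F inj by (metis card_image card_mono)
  moreover have "g ^ length As \<le> real (card (listset As))" "g ^ length Bs \<le> real (card (listset Bs))"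
    using assms(1,2) by (auto intro!: card_listset_ge)
  then have "g ^ length As * (real (card Mid) * g ^ length Bs) \<le>
      real (card (listset As)) * (real (card Mid) * real (card (listset Bs)))"
    using assms(2) by (intro mult_mono) auto
  ultimately show ?thesis
    by (simp add: card_cartesian_product power_add mult_ac flip: of_nat_mult)
qed

text \<open>Take the first threshold below which at least g vertices lie. Raising a threshold by one
  adds a single fibre, so the overshoot is at most f.\<close>

lemma split_by_value:
  fixes \<phi> :: "'a \<Rightarrow> nat" and g f :: real
  assumes "finite U" "g \<le> real (card U)" "g \<ge> 0"
    and fib: "\<And>x. real (card {v \<in> U. \<phi> v = x}) \<le> f"
  shows "\<exists>P \<subseteq> U. g \<le> real (card P) \<and> real (card P) \<le> g + f \<and> (\<forall>v\<in>P. \<forall>w\<in>U - P. \<phi> v < \<phi> w)"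
proof -
  let ?P = "\<lambda>y. {v \<in> U. \<phi> v < y}"
  have "finite (\<phi> ` U)" using assms(1) by simp
  then obtain b where "\<forall>y\<in>\<phi> ` U. y < b" using finite_nat_set_iff_bounded by blast
  then have "?P b = U" by auto
  then have ex: "g \<le> real (card (?P b))" using assms(2) by simp
  define y where "y = (LEAST y. g \<le> real (card (?P y)))"
  have y: "g \<le> real (card (?P y))" unfolding y_def using ex by (rule LeastI)
  have f0: "f \<ge> 0" using fib[of 0] by (smt (verit) of_nat_0_le_iff)
  have "real (card (?P y)) \<le> g + f"
  proof (cases y)
    case 0
    then show ?thesis using f0 assms(3) by simp
  next
    case (Suc y')
    then have "\<not> g \<le> real (card (?P y'))"
      using not_less_Least[of y' "\<lambda>y. g \<le> real (card (?P y))"] unfolding y_def by simp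
    moreover have "?P y = ?P y' \<union> {v \<in> U. \<phi> v = y'}" using Suc by auto
    then have "card (?P y) \<le> card (?P y') + card {v \<in> U. \<phi> v = y'}"
      by (metis card_Un_le)
    ultimately show ?thesis using fib[of y'] by linarith
  qed
  then show ?thesis using y by (intro exI[of _ "?P y"]) auto
qed

text \<open>Slots are peeled off from below. Strict order between slots forbids cutting a fibre, so
  each slot may cost up to g + f.\<close>

lemma ordered_slots:
  fixes \<phi> :: "'a \<Rightarrow> nat" and g f :: real
  assumes "finite U" "real L * (g + f) \<le> real (card U)" "g \<ge> 0"
    and fib: "\<And>x. real (card {v \<in> U. \<phi> v = x}) \<le> f"
  shows "\<exists>G. (\<forall>i<L. G i \<subseteq> U \<and> g \<le> real (card (G i))) \<and>
     (\<forall>i j. i < j \<longrightarrow> j < L \<longrightarrow> (\<forall>v\<in>G i. \<forall>w\<in>G j. \<phi> v < \<phi> w))"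
  using assms
proof (induction L arbitrary: U)
  case (Suc L)
  have f0: "f \<ge> 0" using Suc.prems(4)[of 0] by (smt (verit) of_nat_0_le_iff)
  have "g \<le> real (card U)"
    using Suc.prems(2,3) f0 mult_right_mono[of 1 "real (Suc L)" "g + f"] by simp
  then obtain P where P: "P \<subseteq> U" "g \<le> real (card P)" "real (card P) \<le> g + f"
      "\<forall>v\<in>P. \<forall>w\<in>U - P. \<phi> v < \<phi> w"
    using split_by_value[of U g \<phi> f] Suc.prems by blast
  have "card (U - P) = card U - card P" "card P \<le> card U"
    using P(1) Suc.prems(1) by (auto simp: card_Diff_subset finite_subset card_mono)
  then have "real L * (g + f) \<le> real (card (U - P))"
    using P(3) Suc.prems(2) by (simp add: of_nat_diff algebra_simps)
  moreover have "real (card {v \<in> U - P. \<phi> v = x}) \<le> f" for x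
  proof -
    have "card {v \<in> U - P. \<phi> v = x} \<le> card {v \<in> U. \<phi> v = x}"
      using Suc.prems(1) by (intro card_mono) auto
    then show ?thesis using Suc.prems(4)[of x] by linarith
  qed
  ultimately obtain G where G: "\<forall>i<L. G i \<subseteq> U - P \<and> g \<le> real (card (G i))"
     "\<forall>i j. i < j \<longrightarrow> j < L \<longrightarrow> (\<forall>v\<in>G i. \<forall>w\<in>G j. \<phi> v < \<phi> w)"
    using Suc.IH[of "U - P"] Suc.prems(1,3) by blast
  define G' where "G' i = (case i of 0 \<Rightarrow> P | Suc i \<Rightarrow> G i)" for i
  have "G' i \<subseteq> U \<and> g \<le> real (card (G' i))" if "i < Suc L" for i
    using that P G(1) unfolding G'_def by (cases i) auto
  moreover have "\<phi> v < \<phi> w" if "i < j" "j < Suc L" "v \<in> G' i" "w \<in> G' j" for i j v w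
  proof -
    obtain j' where j': "j = Suc j'" using \<open>i < j\<close> by (cases j) auto
    show ?thesis
    proof (cases i)
      case 0
      then show ?thesis using that j' P(4) G(1) unfolding G'_def by auto
    next
      case (Suc i')
      then show ?thesis using that j' G(2) unfolding G'_def by auto
    qed
  qed
  ultimately show ?case by (intro exI[of _ G'] conjI allI impI ballI) auto
qed simp

section \<open>Hanging subtrees\<close>

text \<open>The heavy vertices form a union of classes of \<tau>, so restricting to them leaves
  every class intact and heavy. A negative h is separated because the light alternative would fail
  at empty classes.\<close>

lemma heavy_or_light:
  fixes \<tau> :: "'a \<Rightarrow> nat" and h :: real
  assumes "finite X"
  shows "\<exists>Y\<subseteq>X. card X \<le> 2 * card Y \<and>
    ((\<forall>x. real (card {v \<in> Y. \<tau> v = x}) \<le> h) \<or> (\<forall>v\<in>Y. h < real (card {w \<in> Y. \<tau> w = \<tau> v})))"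
proof (cases "h < 0")
  case True
  then have "h < real (card {w \<in> X. \<tau> w = \<tau> v})" for v by (smt (verit) of_nat_0_le_iff)
  then show ?thesis by (intro exI[of _ X]) auto
next
  case False
  let ?H = "{v \<in> X. h < real (card {w \<in> X. \<tau> w = \<tau> v})}"
  have sum: "card ?H + card (X - ?H) = card X"
    using assms by (metis (no_types, lifting) card_Diff_subset card_mono finite_subset le_add_diff_inverse mem_Collect_eq subsetI)
  show ?thesis
  proof (cases "card X \<le> 2 * card ?H")
    case True
    have "h < real (card {w \<in> ?H. \<tau> w = \<tau> v})" if "v \<in> ?H" for v
    proof -
      have "{w \<in> ?H. \<tau> w = \<tau> v} = {w \<in> X. \<tau> w = \<tau> v}" using that by auto
      then show ?thesis using that by simp
    qed
    then show ?thesis using True by (intro exI[of _ ?H]) blast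
  next
    case far: False
    let ?Y = "X - ?H"
    have "real (card {v \<in> ?Y. \<tau> v = x}) \<le> h" for x
    proof (cases "{v \<in> ?Y. \<tau> v = x} = {}")
      case True
      then show ?thesis using False by (simp only: card.empty)
    next
      case ne: False
      then obtain v where v: "v \<in> ?Y" "\<tau> v = x" by blast
      have "card {v \<in> ?Y. \<tau> v = x} \<le> card {w \<in> X. \<tau> w = \<tau> v}"
        using v assms by (intro card_mono) auto
      then show ?thesis using v by auto
    qed
    then show ?thesis using far sum by (intro exI[of _ ?Y]) auto
  qed
qed

text \<open>The subtrees of the binary tree hanging between the paths to \<open>y\<close> and \<open>y'\<close> are the level
  sets of one of the two maps below; a heavy level set lies in a single such subtree.\<close>

lemma hanging_subtrees:
  fixes \<phi> :: "'a \<Rightarrow> nat" and h :: real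
  assumes "finite X" and "\<forall>v\<in>X. y < \<phi> v \<and> \<phi> v < y'"
  shows "\<exists>Y\<subseteq>X. card X \<le> 4 * card Y \<and>
    ((\<forall>x. real (card {v \<in> Y. diff_bit y (\<phi> v) = x}) \<le> h) \<or>
     (\<forall>x. real (card {v \<in> Y. diff_bit (\<phi> v) y' = x}) \<le> h) \<or>
     (\<exists>\<tau> :: 'a \<Rightarrow> nat. (\<forall>v\<in>Y. h < real (card {w \<in> Y. \<tau> w = \<tau> v})) \<and>
       (\<forall>v\<in>Y. \<forall>w\<in>Y. \<tau> v = \<tau> w \<longrightarrow> \<phi> v < \<phi> w \<longrightarrow>
          (\<forall>x\<le>y. diff_bit (\<phi> v) (\<phi> w) < diff_bit x (\<phi> v)) \<and>
          (\<forall>x\<ge>y'. diff_bit (\<phi> v) (\<phi> w) < diff_bit (\<phi> w) x))))"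
proof -
  note X = assms(2)[rule_format]
  \<comment> \<open>The paths to y and y' part at a node. Vertices of X1 lie on the side of y and
    hang off the path to y; those of X2 hang off the path to y'. Passing to the larger side and then
    to the larger alternative of \<open>heavy_or_light\<close> costs a factor 2 each.\<close>
  define X1 where "X1 = {v \<in> X. diff_bit y (\<phi> v) < diff_bit (\<phi> v) y'}"
  define X2 where "X2 = {v \<in> X. diff_bit y (\<phi> v) > diff_bit (\<phi> v) y'}"
  have "X \<subseteq> X1 \<union> X2"
  proof
    fix v assume "v \<in> X"
    then show "v \<in> X1 \<union> X2"
      using X[of v] diff_bit_adjacent_neq[of y "\<phi> v" y'] unfolding X1_def X2_def by auto
  qed
  then have "card X \<le> card (X1 \<union> X2)"
    using assms(1) unfolding X1_def X2_def by (intro card_mono) auto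
  also have "\<dots> \<le> card X1 + card X2" by (rule card_Un_le)
  finally consider "card X \<le> 2 * card X1" | "card X \<le> 2 * card X2" by linarith
  then show ?thesis
  proof cases
    case 1
    obtain Y where Y: "Y \<subseteq> X1" "card X1 \<le> 2 * card Y"
      "(\<forall>x. real (card {v \<in> Y. diff_bit y (\<phi> v) = x}) \<le> h) \<or>
       (\<forall>v\<in>Y. h < real (card {w \<in> Y. diff_bit y (\<phi> w) = diff_bit y (\<phi> v)}))"
      using heavy_or_light[of X1 "\<lambda>v. diff_bit y (\<phi> v)" h] assms(1) unfolding X1_def by auto
    have "diff_bit (\<phi> v) (\<phi> w) < diff_bit x (\<phi> v)" "diff_bit (\<phi> v) (\<phi> w) < diff_bit (\<phi> w) x'"
      if "v \<in> Y" "w \<in> Y" "diff_bit y (\<phi> v) = diff_bit y (\<phi> w)" "\<phi> v < \<phi> w" "x \<le> y" "x' \<ge> y'" for v w x x'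
    proof -
      have vw: "y < \<phi> v" "\<phi> w < y'" "diff_bit y (\<phi> w) < diff_bit (\<phi> w) y'"
        using that Y(1) X unfolding X1_def by auto
      \<comment> \<open>Both vertices leave the path to y at the same level, hence lie in one
        hanging subtree and differ strictly below that level. On this side the difference from y' is
        higher still.\<close>
      have "diff_bit (\<phi> v) (\<phi> w) < diff_bit y (\<phi> v)"
        using diff_bit_eq_max[OF vw(1) that(4)] diff_bit_adjacent_neq[OF vw(1) that(4)] that(3)
        by linarith
      moreover have "diff_bit y (\<phi> v) \<le> diff_bit x (\<phi> v)" "diff_bit (\<phi> w) y' \<le> diff_bit (\<phi> w) x'"
        using diff_bit_subinterval[of x y "\<phi> v" "\<phi> v"] diff_bit_subinterval[of "\<phi> w" "\<phi> w" y' x']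
          that(5,6) vw(1,2) by simp_all
      ultimately show "diff_bit (\<phi> v) (\<phi> w) < diff_bit x (\<phi> v)" "diff_bit (\<phi> v) (\<phi> w) < diff_bit (\<phi> w) x'"
        using that(3) vw(3) by linarith+
    qed
    then have "\<forall>v\<in>Y. \<forall>w\<in>Y. diff_bit y (\<phi> v) = diff_bit y (\<phi> w) \<longrightarrow> \<phi> v < \<phi> w \<longrightarrow>
          (\<forall>x\<le>y. diff_bit (\<phi> v) (\<phi> w) < diff_bit x (\<phi> v)) \<and>
          (\<forall>x\<ge>y'. diff_bit (\<phi> v) (\<phi> w) < diff_bit (\<phi> w) x)"
      by blast
    note sep = this
    have YX: "Y \<subseteq> X" "card X \<le> 4 * card Y" using Y(1,2) 1 unfolding X1_def by auto
    from Y(3) show ?thesis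
    proof (elim disjE, goal_cases)
      case 1
      with YX show ?thesis by blast
    next
      case 2
      with sep show ?thesis
        by (intro exI[of _ Y] conjI YX, intro disjI2 exI[of _ "\<lambda>v. diff_bit y (\<phi> v)"]) (rule conjI)
    qed
  next
    case 2
    obtain Y where Y: "Y \<subseteq> X2" "card X2 \<le> 2 * card Y"
      "(\<forall>x. real (card {v \<in> Y. diff_bit (\<phi> v) y' = x}) \<le> h) \<or>
       (\<forall>v\<in>Y. h < real (card {w \<in> Y. diff_bit (\<phi> w) y' = diff_bit (\<phi> v) y'}))"
      using heavy_or_light[of X2 "\<lambda>v. diff_bit (\<phi> v) y'" h] assms(1) unfolding X2_def by auto
    have "diff_bit (\<phi> v) (\<phi> w) < diff_bit x (\<phi> v)" "diff_bit (\<phi> v) (\<phi> w) < diff_bit (\<phi> w) x'"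
      if "v \<in> Y" "w \<in> Y" "diff_bit (\<phi> v) y' = diff_bit (\<phi> w) y'" "\<phi> v < \<phi> w" "x \<le> y" "x' \<ge> y'" for v w x x'
    proof -
      have vw: "y < \<phi> v" "\<phi> w < y'" "diff_bit (\<phi> v) y' < diff_bit y (\<phi> v)"
        using that Y(1) X unfolding X2_def by auto
      have "diff_bit (\<phi> v) (\<phi> w) < diff_bit (\<phi> w) y'"
        using diff_bit_eq_max[OF that(4) vw(2)] diff_bit_adjacent_neq[OF that(4) vw(2)] that(3)
        by linarith
      moreover have "diff_bit y (\<phi> v) \<le> diff_bit x (\<phi> v)" "diff_bit (\<phi> w) y' \<le> diff_bit (\<phi> w) x'"
        using diff_bit_subinterval[of x y "\<phi> v" "\<phi> v"] diff_bit_subinterval[of "\<phi> w" "\<phi> w" y' x']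
          that(5,6) vw(1,2) by simp_all
      ultimately show "diff_bit (\<phi> v) (\<phi> w) < diff_bit x (\<phi> v)" "diff_bit (\<phi> v) (\<phi> w) < diff_bit (\<phi> w) x'"
        using that(3) vw(3) by linarith+
    qed
    then have "\<forall>v\<in>Y. \<forall>w\<in>Y. diff_bit (\<phi> v) y' = diff_bit (\<phi> w) y' \<longrightarrow> \<phi> v < \<phi> w \<longrightarrow>
          (\<forall>x\<le>y. diff_bit (\<phi> v) (\<phi> w) < diff_bit x (\<phi> v)) \<and>
          (\<forall>x\<ge>y'. diff_bit (\<phi> v) (\<phi> w) < diff_bit (\<phi> w) x)"
      by blast
    note sep = this
    have YX: "Y \<subseteq> X" "card X \<le> 4 * card Y" using Y(1,2) 2 unfolding X2_def by auto
    from Y(3) show ?thesis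
    proof (elim disjE, goal_cases)
      case 1
      with YX show ?thesis by blast
    next
      case 2
      with sep show ?thesis
        by (intro exI[of _ Y] conjI YX, intro disjI2 exI[of _ "\<lambda>v. diff_bit (\<phi> v) y'"]) (rule conjI)
    qed
  qed
qed

section \<open>Hitting pairs inside bundles\<close>

text \<open>In a labelling of the vertices, label \<open>i < K\<close> marks the candidates for position \<open>i\<close>, and the
  labels \<open>K + 2 r\<close>, \<open>K + 2 r + 1\<close> mark the two halves of the \<open>r\<close>-th bundle, from which positions
  \<open>b\<close> and \<open>b + 1\<close> are filled. Unused vertices receive the otherwise unused label \<open>b\<close>.\<close>

definition pair_tuples :: "nat \<Rightarrow> 'a set \<Rightarrow> nat \<Rightarrow> ('a \<Rightarrow> nat) \<Rightarrow> 'a list set" where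
  "pair_tuples K V b g = {vs \<in> vertex_lists K V.
     (\<forall>i<K. i \<noteq> b \<longrightarrow> i \<noteq> Suc b \<longrightarrow> g (vs ! i) = i) \<and>
     (\<exists>r. g (vs ! b) = K + 2 * r \<and> g (vs ! Suc b) = K + 2 * r + 1)}"

text \<open>These conditions make the number of pairs robust under deleting a small set W. A vertex
  of an upper half (label K + 2 r + 1) has at least \<theta> |V| partners in its lower half, and the
  factor 4 allows a bundle whose lower half is mostly deleted to be charged to W.\<close>

definition dense_labelling :: "nat \<Rightarrow> 'a set \<Rightarrow> real \<Rightarrow> real \<Rightarrow> nat \<Rightarrow> ('a \<Rightarrow> nat) \<Rightarrow> bool" where
  "dense_labelling K V \<gamma> \<theta> b g \<longleftrightarrow>
     (\<forall>i<K. i \<noteq> b \<longrightarrow> i \<noteq> Suc b \<longrightarrow> \<gamma> * real (card V) \<le> real (card {v \<in> V. g v = i})) \<and>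
     \<gamma> * real (card V) \<le> real (card {v \<in> V. \<exists>r. g v = K + 2 * r + 1}) \<and>
     (\<forall>r. card {v \<in> V. g v = K + 2 * r + 1} \<le> 4 * card {v \<in> V. g v = K + 2 * r}) \<and>
     (\<forall>r. {v \<in> V. g v = K + 2 * r + 1} \<noteq> {} \<longrightarrow> \<theta> * real (card V) \<le> real (card {v \<in> V. g v = K + 2 * r}))"

text \<open>No map into points occurs: the labellings and positions give at most K q ^ |V| cases,
  however many points the step-ups have produced. This is why one edge set serves every
  step.\<close>

definition pair_hitting :: "nat \<Rightarrow> 'a set \<Rightarrow> 'a set set \<Rightarrow> real \<Rightarrow> real \<Rightarrow> nat \<Rightarrow> bool" where
  "pair_hitting K V E \<gamma> \<theta> q \<longleftrightarrow>
     (\<forall>g b. g \<in> V \<rightarrow> {..<q} \<longrightarrow> b + 2 \<le> K \<longrightarrow> dense_labelling K V \<gamma> \<theta> b g \<longrightarrow>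
        (\<exists>vs \<in> pair_tuples K V b g. set vs \<in> E))"

lemma pair_tuples_distinct:
  assumes "vs \<in> pair_tuples K V b g"
  shows "distinct vs"
proof -
  obtain r where r: "g (vs ! b) = K + 2 * r" "g (vs ! Suc b) = K + 2 * r + 1"
    and oth: "\<And>i. i < K \<Longrightarrow> i \<noteq> b \<Longrightarrow> i \<noteq> Suc b \<Longrightarrow> g (vs ! i) = i" and len: "length vs = K"
    using assms unfolding pair_tuples_def vertex_lists_def by auto
  have "g (vs ! i) = (if i = b then K + 2 * r else if i = Suc b then K + 2 * r + 1 else i)" if "i < K" for i
    using r oth[OF that] by auto
  then have "inj_on (\<lambda>i. g (vs ! i)) {..<K}"
    by (auto simp: inj_on_def split: if_splits)
  then have "distinct (map g vs)"
    using len by (auto simp: distinct_conv_nth inj_on_def)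
  then show ?thesis by (simp add: distinct_map)
qed

text \<open>A bundle is spoiled if W leaves less than \<theta> |V| / 2 of its lower half. Then W
  contains at least half of that lower half, so the upper half is at most 8 times as large as the
  part of W there. Spoiled bundles and W itself cost at most 9 |W| upper vertices, which is at most
  half of \<gamma> |V|; hence the 18.\<close>

lemma pair_tuples_dense:
  fixes \<gamma> \<theta> t :: real
  assumes V: "finite V" and lab: "dense_labelling K V \<gamma> \<theta> b g" and b: "b + 2 \<le> K"
    and W: "W \<subseteq> V" "real (card W) \<le> t * real (card V)" and t: "18 * t \<le> \<gamma>" and pos: "\<gamma> \<ge> 0" "\<theta> \<ge> 0"
  shows "real (card {vs \<in> pair_tuples K V b g. set vs \<inter> W = {}}) \<ge>
    (\<gamma> / 2) ^ (K - 1) * (\<theta> / 2) * real (card V) ^ K"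
proof -
  define n where "n = real (card V)"
  have n0: "n \<ge> 0" unfolding n_def by simp
  have finW: "finite W" using V W finite_subset by blast
  define Q where "Q r = {v \<in> V. g v = K + 2 * r + 1}" for r
  define P where "P r = {v \<in> V. g v = K + 2 * r}" for r
  define Y where "Y = {y \<in> V - W. \<exists>r. g y = K + 2 * r + 1 \<and> \<theta> * n / 2 \<le> real (card (P r - W))}"
  define B where "B = {r. Q r \<noteq> {} \<and> real (card (P r - W)) < \<theta> * n / 2}"
  have fin: "finite (P r)" "finite (Q r)" "finite Y" for r
    using V unfolding P_def Q_def Y_def by auto
  have "B \<subseteq> (\<lambda>v. (g v - K) div 2) ` V"
  proof
    fix r assume "r \<in> B"
    then obtain v where "v \<in> V" "g v = K + 2 * r + 1" unfolding B_def Q_def by blast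
    then show "r \<in> (\<lambda>v. (g v - K) div 2) ` V" by (intro image_eqI[of _ _ v]) auto
  qed
  then have finB: "finite B" using V finite_subset by blast
  have QP: "card (Q r) \<le> 4 * card (P r)" for r
    using lab unfolding dense_labelling_def P_def Q_def by blast
  have bad: "card (Q r) \<le> 8 * card (P r \<inter> W)" if "r \<in> B" for r
  proof -
    have "\<theta> * n \<le> real (card (P r))"
      using that lab unfolding B_def dense_labelling_def P_def Q_def n_def by blast
    moreover have "card (P r) = card (P r - W) + card (P r \<inter> W)"
      by (metis add.commute card_Diff_subset_Int card_mono fin(1) finite_Int inf.cobounded1 le_add_diff_inverse)
    moreover have "real (card (P r - W)) < \<theta> * n / 2" using that unfolding B_def by blast
    ultimately have "card (P r) \<le> 2 * card (P r \<inter> W)" by linarith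
    then show ?thesis using QP[of r] by linarith
  qed
  have "(\<Sum>r\<in>B. card (P r \<inter> W)) = card (\<Union>r\<in>B. P r \<inter> W)"
    using finB fin by (intro card_UN_disjoint[symmetric]) (auto simp: P_def)
  also have "\<dots> \<le> card W" using finW by (intro card_mono) auto
  finally have sumW: "(\<Sum>r\<in>B. card (P r \<inter> W)) \<le> card W" .
  have "card (\<Union>r\<in>B. Q r) \<le> (\<Sum>r\<in>B. card (Q r))" using finB by (rule card_UN_le)
  also have "\<dots> \<le> (\<Sum>r\<in>B. 8 * card (P r \<inter> W))" using bad by (rule sum_mono)
  also have "\<dots> \<le> 8 * card W" using sumW by (simp flip: sum_distrib_left)
  finally have badQ: "card (\<Union>r\<in>B. Q r) \<le> 8 * card W" .
  have "{v \<in> V. \<exists>r. g v = K + 2 * r + 1} \<subseteq> Y \<union> W \<union> (\<Union>r\<in>B. Q r)"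
  proof
    fix v assume "v \<in> {v \<in> V. \<exists>r. g v = K + 2 * r + 1}"
    then obtain r where r: "v \<in> V" "g v = K + 2 * r + 1" by blast
    then have "v \<in> Q r" unfolding Q_def by blast
    then show "v \<in> Y \<union> W \<union> (\<Union>r\<in>B. Q r)"
      using r unfolding Y_def B_def by (cases "\<theta> * n / 2 \<le> real (card (P r - W))") auto
  qed
  then have "card {v \<in> V. \<exists>r. g v = K + 2 * r + 1} \<le> card (Y \<union> W \<union> (\<Union>r\<in>B. Q r))"
    using fin finB finW by (intro card_mono) auto
  also have "\<dots> \<le> card Y + card W + card (\<Union>r\<in>B. Q r)"
    by (meson add_le_mono1 card_Un_le le_trans)
  also have "\<dots> \<le> card Y + 9 * card W" using badQ by simp
  finally have "card {v \<in> V. \<exists>r. g v = K + 2 * r + 1} \<le> card Y + 9 * card W" .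
  moreover have "\<gamma> * n \<le> real (card {v \<in> V. \<exists>r. g v = K + 2 * r + 1})"
    using lab unfolding dense_labelling_def n_def by blast
  ultimately have "\<gamma> * n \<le> real (card Y) + 9 * (t * n)"
    using W(2) unfolding n_def by linarith
  moreover have tn: "18 * (t * n) \<le> \<gamma> * n" using t n0 mult_right_mono[of "18 * t" \<gamma> n] by simp
  ultimately have Y: "\<gamma> / 2 * n \<le> real (card Y)" by (simp add: field_simps)
  \<comment> \<open>The label just below that of y names the lower half of its bundle without
    choosing the index r.\<close>
  define P' where "P' y = {v \<in> V - W. g y = Suc (g v)}" for y
  define Mid where "Mid = (\<lambda>(y, x). [x, y]) ` Sigma Y P'"
  have finP': "finite (P' y)" for y using V unfolding P'_def by simp
  have P': "\<theta> / 2 * n \<le> real (card (P' y))" if "y \<in> Y" for y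
  proof -
    obtain r where r: "g y = K + 2 * r + 1" "\<theta> * n / 2 \<le> real (card (P r - W))"
      using \<open>y \<in> Y\<close> unfolding Y_def by blast
    have "P' y = P r - W" using r(1) unfolding P'_def P_def by auto
    then show ?thesis using r(2) by simp
  qed
  have "inj_on (\<lambda>(y, x). [x, y]) (Sigma Y P')" by (auto simp: inj_on_def)
  then have "card Mid = (\<Sum>y\<in>Y. card (P' y))"
    unfolding Mid_def using fin(3) finP' by (simp add: card_image)
  then have "real (card Mid) = (\<Sum>y\<in>Y. real (card (P' y)))" by simp
  moreover have "(\<Sum>y\<in>Y. \<theta> / 2 * n) \<le> (\<Sum>y\<in>Y. real (card (P' y)))"
    using P' by (rule sum_mono)
  ultimately have "real (card Y) * (\<theta> / 2 * n) \<le> real (card Mid)" by simp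
  moreover have "\<gamma> / 2 * n * (\<theta> / 2 * n) \<le> real (card Y) * (\<theta> / 2 * n)"
    using Y pos n0 by (intro mult_right_mono) auto
  ultimately have Mid: "\<gamma> / 2 * n * (\<theta> / 2 * n) \<le> real (card Mid)" by linarith
  define G where "G i = {v \<in> V - W. g v = i}" for i
  have G: "finite (G i) \<and> \<gamma> / 2 * n \<le> real (card (G i))" if "i < K" "i \<noteq> b" "i \<noteq> Suc b" for i
  proof -
    have "{v \<in> V. g v = i} \<subseteq> G i \<union> W" unfolding G_def by blast
    then have "card {v \<in> V. g v = i} \<le> card (G i \<union> W)"
      using V finW unfolding G_def by (intro card_mono) auto
    also have "\<dots> \<le> card (G i) + card W" by (rule card_Un_le)
    finally have "card {v \<in> V. g v = i} \<le> card (G i) + card W" .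
    moreover have "\<gamma> * n \<le> real (card {v \<in> V. g v = i})"
      using lab that unfolding dense_labelling_def n_def by blast
    ultimately have "\<gamma> * n \<le> real (card (G i)) + t * n" using W(2) unfolding n_def by linarith
    moreover have "0 \<le> t * n" using W(2) unfolding n_def by (meson of_nat_0_le_iff order_trans)
    ultimately have "\<gamma> / 2 * n \<le> real (card (G i))" using tn by simp
    then show ?thesis using V unfolding G_def by simp
  qed
  define As where "As = map G [0..<b]"
  define Bs where "Bs = map G [b + 2..<K]"
  let ?F = "{vs \<in> pair_tuples K V b g. set vs \<inter> W = {}}"
  have len: "length As + length Bs = K - 2" using b unfolding As_def Bs_def by simp
  have "(\<gamma> / 2 * n) ^ (length As + length Bs) * real (card Mid) \<le> real (card ?F)"
  proof (rule card_concat_lists_ge[where h = 2])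
    show "finite A \<and> \<gamma> / 2 * n \<le> real (card A)" if "A \<in> set As \<union> set Bs" for A
      using that G b unfolding As_def Bs_def by auto
    show "0 \<le> \<gamma> / 2 * n" using pos n0 by simp
    show "finite Mid" using fin(3) finP' unfolding Mid_def by auto
    show "length xs = 2" if "xs \<in> Mid" for xs using that unfolding Mid_def by auto
    have "?F \<subseteq> vertex_lists K V" unfolding pair_tuples_def by blast
    then show "finite ?F" using finite_vertex_lists[OF V] finite_subset by blast
    show "xs @ ys @ zs \<in> ?F" if xs: "xs \<in> listset As" and ys: "ys \<in> Mid" and zs: "zs \<in> listset Bs" for xs ys zs
    proof -
      obtain y x where yx: "y \<in> Y" "x \<in> P' y" "ys = [x, y]" using ys unfolding Mid_def by auto
      obtain r where r: "g y = K + 2 * r + 1" using yx(1) unfolding Y_def by blast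
      have x: "g x = K + 2 * r" "x \<in> V - W" using yx(2) r unfolding P'_def by auto
      have y: "y \<in> V - W" using yx(1) unfolding Y_def by blast
      have lx: "length xs = b" and xs': "\<And>i. i < b \<Longrightarrow> xs ! i \<in> V - W \<and> g (xs ! i) = i"
        using xs unfolding in_listset_iff As_def G_def by auto
      have lz: "length zs = K - (b + 2)"
        and zs': "\<And>i. i < K - (b + 2) \<Longrightarrow> zs ! i \<in> V - W \<and> g (zs ! i) = b + 2 + i"
        using zs unfolding in_listset_iff Bs_def G_def by auto
      let ?vs = "xs @ ys @ zs"
      have "set xs \<subseteq> V - W" using xs' lx by (metis in_set_conv_nth subsetI)
      moreover have "set zs \<subseteq> V - W" using zs' lz by (metis in_set_conv_nth subsetI)
      ultimately have set: "set ?vs \<subseteq> V - W" using x y yx(3) by auto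
      have "length ?vs = K" using lx lz yx(3) b by simp
      moreover have "g (?vs ! i) = i" if "i < K" "i \<noteq> b" "i \<noteq> Suc b" for i
      proof (cases "i < b")
        case True
        then show ?thesis using xs' lx by (simp add: nth_append)
      next
        case False
        then have "\<exists>i'. i = b + 2 + i'" using that by (metis Suc_eq_plus1 add_2_eq_Suc' le_Suc_ex less_Suc_eq not_less_eq not_less add_Suc_right)
        then obtain i' where i': "i = b + 2 + i'" by blast
        then have "?vs ! i = zs ! i'" using lx yx(3) by (simp add: nth_append)
        then show ?thesis using zs'[of i'] i' that by simp
      qed
      moreover have "?vs ! b = x" "?vs ! Suc b = y" using lx yx(3) by (simp_all add: nth_append)
      ultimately show ?thesis
        using set x(1) r unfolding pair_tuples_def vertex_lists_def by auto
    qed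
  qed
  then have F: "(\<gamma> / 2 * n) ^ (K - 2) * real (card Mid) \<le> real (card ?F)" unfolding len .
  have "(\<gamma> / 2 * n) ^ (K - 2) * (\<gamma> / 2 * n * (\<theta> / 2 * n)) \<le> (\<gamma> / 2 * n) ^ (K - 2) * real (card Mid)"
    using Mid pos n0 by (intro mult_left_mono) auto
  moreover have "(\<gamma> / 2 * n) ^ (K - 2) * (\<gamma> / 2 * n * (\<theta> / 2 * n)) = (\<gamma> / 2) ^ (K - 1) * (\<theta> / 2) * n ^ K"
  proof -
    obtain k where k: "K = k + 2" using b le_Suc_ex[of 2 K] by (metis add.commute add_leD2)
    show ?thesis unfolding k by (simp add: power_mult_distrib power_divide mult_ac)
  qed
  ultimately show ?thesis using F unfolding n_def by linarith
qed

text \<open>Each class of \<tau> becomes a bundle, split by \<phi>. The lower half receives at least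
  a quarter; as the class exceeds h and fibres have size at most h / 4, the upper half keeps at
  least half. Each class has more than h vertices, so at most R classes exist and q labels suffice.
  The pair that is hit lies in one class and is increasing under \<phi>.\<close>

lemma bundle_hit:
  fixes \<phi> \<tau> :: "'a \<Rightarrow> nat" and h \<gamma> \<theta> :: real
  assumes V: "finite V" and hit: "pair_hitting K V E \<gamma> \<theta> q" and b: "b + 2 \<le> K"
    and G: "\<And>i. i < K \<Longrightarrow> i \<noteq> b \<Longrightarrow> i \<noteq> Suc b \<Longrightarrow> G i \<subseteq> V \<and> \<gamma> * real (card V) \<le> real (card (G i))"
    and disj: "\<And>i j. i < j \<Longrightarrow> j < K \<Longrightarrow> i \<noteq> b \<Longrightarrow> i \<noteq> Suc b \<Longrightarrow> j \<noteq> b \<Longrightarrow> j \<noteq> Suc b \<Longrightarrow> G i \<inter> G j = {}"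
    and disjY: "\<And>i. i < K \<Longrightarrow> i \<noteq> b \<Longrightarrow> i \<noteq> Suc b \<Longrightarrow> G i \<inter> Y = {}"
    and Y: "Y \<subseteq> V" "2 * \<gamma> * real (card V) \<le> real (card Y)"
    and heavy: "\<And>v. v \<in> Y \<Longrightarrow> h < real (card {w \<in> Y. \<tau> w = \<tau> v})"
    and fib: "\<And>x. real (card {v \<in> Y. \<phi> v = x}) \<le> h / 4"
    and h: "h > 0" "\<theta> * real (card V) \<le> h / 4"
    and R: "real (card V) \<le> h * real R" "K + 2 * R \<le> q"
  shows "\<exists>vs. length vs = K \<and> set vs \<in> E \<and> (\<forall>i<K. i \<noteq> b \<longrightarrow> i \<noteq> Suc b \<longrightarrow> vs ! i \<in> G i) \<and>
     vs ! b \<in> Y \<and> vs ! Suc b \<in> Y \<and> \<tau> (vs ! b) = \<tau> (vs ! Suc b) \<and> \<phi> (vs ! b) < \<phi> (vs ! Suc b)"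
proof -
  define B where "B c = {v \<in> Y. \<tau> v = c}" for c
  define T where "T = \<tau> ` Y"
  have finY: "finite Y" using Y V finite_subset by blast
  then have finT: "finite T" and finB: "finite (B c)" for c unfolding T_def B_def by auto
  have Bh: "h < real (card (B c))" if "c \<in> T" for c
    using that heavy unfolding T_def B_def by auto
  have "\<forall>c\<in>T. \<exists>P\<subseteq>B c. real (card (B c)) / 4 \<le> real (card P) \<and> real (card P) \<le> real (card (B c)) / 4 + h / 4 \<and>
      (\<forall>v\<in>P. \<forall>w\<in>B c - P. \<phi> v < \<phi> w)"
  proof (intro ballI split_by_value)
    fix c
    show "real (card {v \<in> B c. \<phi> v = x}) \<le> h / 4" for x
    proof -
      have "card {v \<in> B c. \<phi> v = x} \<le> card {v \<in> Y. \<phi> v = x}"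
        using finY unfolding B_def by (intro card_mono) auto
      then show ?thesis using fib[of x] by linarith
    qed
  qed (use finB in auto)
  from bchoice[OF this] obtain P where
    "\<forall>c\<in>T. P c \<subseteq> B c \<and> real (card (B c)) / 4 \<le> real (card (P c)) \<and>
      real (card (P c)) \<le> real (card (B c)) / 4 + h / 4 \<and> (\<forall>v\<in>P c. \<forall>w\<in>B c - P c. \<phi> v < \<phi> w)" ..
  then have P: "\<And>c. c \<in> T \<Longrightarrow> P c \<subseteq> B c"
      "\<And>c. c \<in> T \<Longrightarrow> real (card (B c)) / 4 \<le> real (card (P c))"
      "\<And>c. c \<in> T \<Longrightarrow> real (card (P c)) \<le> real (card (B c)) / 4 + h / 4"
      "\<And>c v w. c \<in> T \<Longrightarrow> v \<in> P c \<Longrightarrow> w \<in> B c - P c \<Longrightarrow> \<phi> v < \<phi> w" by simp_all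
  have Q: "real (card (B c)) / 2 \<le> real (card (B c - P c))" if "c \<in> T" for c
  proof -
    have "card (B c - P c) = card (B c) - card (P c)" "card (P c) \<le> card (B c)"
      using P(1)[OF that] finB[of c] by (auto simp: card_Diff_subset finite_subset card_mono)
    then show ?thesis using P(3)[OF that] Bh[OF that] by (simp add: of_nat_diff)
  qed
  have sumB: "(\<Sum>c\<in>T. real (card (B c))) = real (card Y)"
    using sum.group[OF finY finT, of \<tau> "\<lambda>_. 1 :: real"] unfolding T_def B_def by simp
  have "real (card T) * h \<le> (\<Sum>c\<in>T. real (card (B c)))"
    using sum_mono[of T "\<lambda>_. h" "\<lambda>c. real (card (B c))"] Bh by (simp add: less_imp_le)
  also have "\<dots> \<le> real (card V)" using sumB card_mono[OF V Y(1)] by simp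
  also have "\<dots> \<le> real R * h" using R by (simp add: mult.commute)
  finally have TR: "card T \<le> R" using h(1) by simp
  obtain idx where idx: "bij_betw idx T {0..<card T}"
    using ex_bij_betw_finite_nat[OF finT] by blast
  then have inj_idx: "inj_on idx T" by (rule bij_betw_imp_inj_on)
  have idx_less: "idx (\<tau> v) < R" if "v \<in> Y" for v
  proof -
    have "\<tau> v \<in> T" using that unfolding T_def by blast
    then have "idx (\<tau> v) \<in> {0..<card T}" using idx bij_betwE by blast
    then show ?thesis using TR by simp
  qed
  define val where "val i \<longleftrightarrow> i < K \<and> i \<noteq> b \<and> i \<noteq> Suc b" for i
  define g where "g v = (if v \<in> Y then K + 2 * idx (\<tau> v) + (if v \<in> P (\<tau> v) then 0 else 1)
     else if \<exists>i. val i \<and> v \<in> G i then SOME i. val i \<and> v \<in> G i else b)" for v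
  have gY: "g v = K + 2 * idx (\<tau> v) + (if v \<in> P (\<tau> v) then 0 else 1)" if "v \<in> Y" for v
    using that unfolding g_def by simp
  have gG: "g v = i" if "val i" "v \<in> G i" for v i
  proof -
    have "v \<notin> Y" using disjY that unfolding val_def by blast
    moreover have "(SOME i. val i \<and> v \<in> G i) = i"
    proof (rule some_equality)
      show "j = i" if "val j \<and> v \<in> G j" for j
        using disj[of i j] disj[of j i] that \<open>val i\<close> \<open>v \<in> G i\<close> unfolding val_def
        by (metis disjoint_iff nat_neq_iff)
    qed (use that in auto)
    ultimately show ?thesis using that unfolding g_def by auto
  qed
  have gN: "g v = b \<or> val (g v) \<and> v \<in> G (g v)" if "v \<notin> Y" for v
  proof (cases "\<exists>i. val i \<and> v \<in> G i")
    case True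
    then show ?thesis using gG by blast
  qed (use that in \<open>auto simp: g_def\<close>)
  have gN_less: "g v < K" if "v \<notin> Y" for v using gN[OF that] b unfolding val_def by auto
  have odd: "{v \<in> V. g v = K + 2 * r + 1} = {v \<in> Y. idx (\<tau> v) = r \<and> v \<notin> P (\<tau> v)}" for r
  proof -
    have "g v = K + 2 * r + 1 \<longleftrightarrow> v \<in> Y \<and> idx (\<tau> v) = r \<and> v \<notin> P (\<tau> v)" for v
      using gN_less[of v] gY[of v] by (cases "v \<in> Y") (auto, presburger+)
    then show ?thesis using Y(1) by blast
  qed
  have even: "{v \<in> V. g v = K + 2 * r} = {v \<in> Y. idx (\<tau> v) = r \<and> v \<in> P (\<tau> v)}" for r
  proof -
    have "g v = K + 2 * r \<longleftrightarrow> v \<in> Y \<and> idx (\<tau> v) = r \<and> v \<in> P (\<tau> v)" for v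
      using gN_less[of v] gY[of v] by (cases "v \<in> Y") (auto, presburger+)
    then show ?thesis using Y(1) by blast
  qed
  have cls: "{v \<in> Y. idx (\<tau> v) = r \<and> v \<notin> P (\<tau> v)} = B c - P c" "{v \<in> Y. idx (\<tau> v) = r \<and> v \<in> P (\<tau> v)} = P c"
    if "c \<in> T" "idx c = r" for c r
  proof -
    have "idx (\<tau> v) = r \<longleftrightarrow> \<tau> v = c" if "v \<in> Y" for v
      using inj_on_eq_iff[OF inj_idx, of "\<tau> v" c] \<open>c \<in> T\<close> \<open>idx c = r\<close> that by (simp add: T_def)
    then show "{v \<in> Y. idx (\<tau> v) = r \<and> v \<notin> P (\<tau> v)} = B c - P c"
      "{v \<in> Y. idx (\<tau> v) = r \<and> v \<in> P (\<tau> v)} = P c"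
      using P(1)[OF \<open>c \<in> T\<close>] unfolding B_def by auto
  qed
  have "dense_labelling K V \<gamma> \<theta> b g"
    unfolding dense_labelling_def
  proof (intro conjI allI impI)
    fix i assume i: "i < K" "i \<noteq> b" "i \<noteq> Suc b"
    then have "G i \<subseteq> {v \<in> V. g v = i}" using G[OF i] gG unfolding val_def by blast
    then have "card (G i) \<le> card {v \<in> V. g v = i}" using V by (intro card_mono) auto
    then show "\<gamma> * real (card V) \<le> real (card {v \<in> V. g v = i})" using G[OF i] by linarith
  next
    let ?Q = "{v \<in> V. \<exists>r. g v = K + 2 * r + 1}"
    have Qeq: "?Q = {v \<in> Y. v \<notin> P (\<tau> v)}"
    proof -
      have "?Q = (\<Union>r. {v \<in> V. g v = K + 2 * r + 1})" by blast
      then show ?thesis unfolding odd by blast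
    qed
    have "real (card ?Q) = (\<Sum>c\<in>T. real (card {v \<in> ?Q. \<tau> v = c}))"
      using sum.group[of ?Q T \<tau> "\<lambda>_. 1 :: real"] finT V unfolding Qeq T_def
      by (simp add: finY image_subset_iff)
    also have "\<dots> = (\<Sum>c\<in>T. real (card (B c - P c)))"
      unfolding Qeq B_def by (intro sum.cong refl arg_cong[of _ _ "\<lambda>A. real (card A)"]) auto
    finally have "real (card ?Q) \<ge> (\<Sum>c\<in>T. real (card (B c)) / 2)"
      using sum_mono[of T "\<lambda>c. real (card (B c)) / 2" "\<lambda>c. real (card (B c - P c))"] Q by simp
    then show "\<gamma> * real (card V) \<le> real (card ?Q)"
      using Y(2) sumB by (simp flip: sum_divide_distrib)
  next
    fix r
    show "card {v \<in> V. g v = K + 2 * r + 1} \<le> 4 * card {v \<in> V. g v = K + 2 * r}"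
    proof (cases "\<exists>c\<in>T. idx c = r")
      case True
      then obtain c where c: "c \<in> T" "idx c = r" by blast
      have "card (B c - P c) \<le> card (B c)" using finB by (intro card_mono) auto
      then have "card (B c - P c) \<le> 4 * card (P c)" using P(2)[OF c(1)] by linarith
      then show ?thesis unfolding odd even cls[OF c] .
    next
      case False
      then have "{v \<in> Y. idx (\<tau> v) = r \<and> v \<notin> P (\<tau> v)} = {}" unfolding T_def by blast
      then show ?thesis unfolding odd by (simp only: card.empty le0)
    qed
  next
    fix r
    assume "{v \<in> V. g v = K + 2 * r + 1} \<noteq> {}"
    then obtain c where c: "c \<in> T" "idx c = r" unfolding odd T_def by blast
    have "h / 4 \<le> real (card (P c))" using P(2)[OF c(1)] Bh[OF c(1)] by linarith
    then show "\<theta> * real (card V) \<le> real (card {v \<in> V. g v = K + 2 * r})"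
      unfolding even cls[OF c] using h(2) by linarith
  qed
  moreover have "g \<in> V \<rightarrow> {..<q}"
  proof
    fix v assume "v \<in> V"
    show "g v \<in> {..<q}"
      using gN_less[of v] gY[of v] idx_less[of v] R(2) by (cases "v \<in> Y") (auto split: if_splits)
  qed
  ultimately obtain vs where vs: "vs \<in> pair_tuples K V b g" "set vs \<in> E"
    using hit b unfolding pair_hitting_def by blast
  then obtain r where r: "g (vs ! b) = K + 2 * r" "g (vs ! Suc b) = K + 2 * r + 1"
    and oth: "\<And>i. i < K \<Longrightarrow> i \<noteq> b \<Longrightarrow> i \<noteq> Suc b \<Longrightarrow> g (vs ! i) = i" and len: "length vs = K" and sV: "set vs \<subseteq> V"
    unfolding pair_tuples_def vertex_lists_def by auto
  have inV: "vs ! b \<in> V" "vs ! Suc b \<in> V" using sV len b by (auto simp: subset_iff)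
  have p: "vs ! b \<in> Y" "idx (\<tau> (vs ! b)) = r" "vs ! b \<in> P (\<tau> (vs ! b))"
    using even[of r] inV(1) r(1) by blast+
  have p': "vs ! Suc b \<in> Y" "idx (\<tau> (vs ! Suc b)) = r" "vs ! Suc b \<notin> P (\<tau> (vs ! Suc b))"
    using odd[of r] inV(2) r(2) by blast+
  have eq: "\<tau> (vs ! b) = \<tau> (vs ! Suc b)"
    using inj_on_eq_iff[OF inj_idx, of "\<tau> (vs ! b)" "\<tau> (vs ! Suc b)"] p(1,2) p'(1,2) by (simp add: T_def)
  have "\<phi> (vs ! b) < \<phi> (vs ! Suc b)"
    using P(4)[of "\<tau> (vs ! b)" "vs ! b" "vs ! Suc b"] p p' eq unfolding T_def B_def by auto
  moreover have "vs ! i \<in> G i" if "i < K" "i \<noteq> b" "i \<noteq> Suc b" for i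
  proof -
    have "vs ! i \<notin> Y" using oth[OF that] gY[of "vs ! i"] that by auto
    then show ?thesis using gN[of "vs ! i"] oth[OF that] that by auto
  qed
  ultimately show ?thesis using vs(2) len p(1) p'(1) eq by blast
qed

text \<open>The map \<sigma> decides which slot fills which position, and only b and b + 1 share
  one. The order of the slots gives all inequalities between \<phi>-values except the one at b,
  which the bundle provides.\<close>

lemma bundle_hit_in_slots:
  fixes \<phi> \<tau> :: "'a \<Rightarrow> nat" and h \<gamma> \<theta> :: real
  assumes V: "finite V" and hit: "pair_hitting K V E \<gamma> \<theta> q" and b: "b + 2 \<le> K"
    and slots: "\<And>i. i < L \<Longrightarrow> G i \<subseteq> V \<and> \<gamma> * real (card V) \<le> real (card (G i))"
    and ordered: "\<And>i j v w. i < j \<Longrightarrow> j < L \<Longrightarrow> v \<in> G i \<Longrightarrow> w \<in> G j \<Longrightarrow> \<phi> v < \<phi> w"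
    and \<sigma>: "\<And>i. i < K \<Longrightarrow> \<sigma> i < L" "\<And>i j. i < j \<Longrightarrow> j < K \<Longrightarrow> \<sigma> i < \<sigma> j \<or> i = b \<and> j = Suc b"
    and Y: "Y \<subseteq> G (\<sigma> b)" "\<sigma> (Suc b) = \<sigma> b" "2 * \<gamma> * real (card V) \<le> real (card Y)"
    and heavy: "\<And>v. v \<in> Y \<Longrightarrow> h < real (card {w \<in> Y. \<tau> w = \<tau> v})"
    and fib: "\<And>x. real (card {v \<in> Y. \<phi> v = x}) \<le> h / 4"
    and h: "h > 0" "\<theta> * real (card V) \<le> h / 4"
    and R: "real (card V) \<le> h * real R" "K + 2 * R \<le> q"
  shows "\<exists>vs. length vs = K \<and> set vs \<in> E \<and> (\<forall>i<K. vs ! i \<in> G (\<sigma> i)) \<and> sorted_wrt (<) (map \<phi> vs) \<and>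
     vs ! b \<in> Y \<and> vs ! Suc b \<in> Y \<and> \<tau> (vs ! b) = \<tau> (vs ! Suc b)"
proof -
  have less: "\<phi> v < \<phi> w" if "i < j" "j < K" "\<not> (i = b \<and> j = Suc b)" "v \<in> G (\<sigma> i)" "w \<in> G (\<sigma> j)" for i j v w
    using ordered[of "\<sigma> i" "\<sigma> j" v w] \<sigma>(1)[of j] \<sigma>(2)[of i j] that by blast
  have "\<exists>vs. length vs = K \<and> set vs \<in> E \<and> (\<forall>i<K. i \<noteq> b \<longrightarrow> i \<noteq> Suc b \<longrightarrow> vs ! i \<in> G (\<sigma> i)) \<and>
     vs ! b \<in> Y \<and> vs ! Suc b \<in> Y \<and> \<tau> (vs ! b) = \<tau> (vs ! Suc b) \<and> \<phi> (vs ! b) < \<phi> (vs ! Suc b)"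
  proof (rule bundle_hit[OF V hit b, where G = "\<lambda>i. G (\<sigma> i)" and h = h and R = R])
    show "G (\<sigma> i) \<subseteq> V \<and> \<gamma> * real (card V) \<le> real (card (G (\<sigma> i)))" if "i < K" for i
      using slots \<sigma>(1) that by blast
    show "G (\<sigma> i) \<inter> G (\<sigma> j) = {}" if "i < j" "j < K" "i \<noteq> b" for i j
      using less[of i j] that by fastforce
    show "G (\<sigma> i) \<inter> Y = {}" if "i < K" "i \<noteq> b" "i \<noteq> Suc b" for i
      using less[of i b] less[of b i] that Y(1) b by (cases "i < b") (fastforce)+
    show "Y \<subseteq> V" using Y(1) slots[of "\<sigma> b"] \<sigma>(1)[of b] b by auto
  qed (use Y(3) heavy fib h R in auto)
  then obtain vs where vs: "length vs = K" "set vs \<in> E" "\<And>i. i < K \<Longrightarrow> i \<noteq> b \<Longrightarrow> i \<noteq> Suc b \<Longrightarrow> vs ! i \<in> G (\<sigma> i)"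
    "vs ! b \<in> Y" "vs ! Suc b \<in> Y" "\<tau> (vs ! b) = \<tau> (vs ! Suc b)" "\<phi> (vs ! b) < \<phi> (vs ! Suc b)" by blast
  have mem: "vs ! i \<in> G (\<sigma> i)" if "i < K" for i
    using vs(3)[OF that] vs(4,5) Y(1,2) by (cases "i = b \<or> i = Suc b") auto
  have "\<phi> (vs ! i) < \<phi> (vs ! j)" if "i < j" "j < K" for i j
    using less[OF that _ mem mem] that vs(7) by (cases "i = b \<and> j = Suc b") auto
  then have "sorted_wrt (<) (map \<phi> vs)" using vs(1) by (simp add: sorted_wrt_iff_nth_less)
  then show ?thesis using vs mem by blast
qed

section \<open>The step-up\<close>

definition unavoidable_colours ::
  "nat \<Rightarrow> 'a set \<Rightarrow> 'a set set \<Rightarrow> nat \<Rightarrow> nat \<Rightarrow> (nat list \<Rightarrow> bool) \<Rightarrow> real \<Rightarrow> real \<Rightarrow> bool" where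
  "unavoidable_colours K V E j M C \<epsilon> \<beta> \<longleftrightarrow>
     (\<forall>U (\<phi> :: 'a \<Rightarrow> nat) a c. U \<subseteq> V \<longrightarrow> \<epsilon> * real (card V) \<le> real (card U) \<longrightarrow>
        (\<forall>v\<in>U. \<phi> v < M) \<longrightarrow> (\<forall>x. real (card {v \<in> U. \<phi> v = x}) \<le> \<beta> * real (card V)) \<longrightarrow> a + j \<le> K \<longrightarrow>
        (\<exists>vs. set vs \<in> E \<and> set vs \<subseteq> U \<and> length vs = K \<and> sorted_wrt (<) (map \<phi> vs) \<and>
          C (take j (drop a (map \<phi> vs))) = c))"

lemma unavoidable_coloursD:
  assumes "unavoidable_colours K V E j M C \<epsilon> \<beta>"
    and "U \<subseteq> V" "\<epsilon> * real (card V) \<le> real (card U)" "\<And>v. v \<in> U \<Longrightarrow> \<phi> v < M"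
    and "\<And>x. real (card {v \<in> U. \<phi> v = x}) \<le> \<beta> * real (card V)" "a + j \<le> K"
  shows "\<exists>vs. set vs \<in> E \<and> set vs \<subseteq> U \<and> length vs = K \<and> sorted_wrt (<) (map \<phi> vs) \<and>
          C (take j (drop a (map \<phi> vs))) = c"
  using assms unfolding unavoidable_colours_def by blast

text \<open>Points below 2 ^ M have differences below M, so the levels form a map into M points with
  light fibres, to which the hypothesis on \<open>C\<close> applies in place of \<phi>. Its
  increasing tuples of levels are combs.\<close>

lemma light_levels_step_up:
  fixes \<phi> :: "'a \<Rightarrow> nat"
  assumes IH: "unavoidable_colours K V E j M C \<epsilon> \<beta>" and j: "j \<ge> 2" and a: "a + Suc j \<le> K"
    and Y: "Y \<subseteq> V" "\<epsilon> * real (card V) \<le> real (card Y)"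
    and yy: "\<And>v. v \<in> Y \<Longrightarrow> y < \<phi> v \<and> \<phi> v < y'" "y' < 2 ^ M"
    and light: "(\<forall>x. real (card {v \<in> Y. diff_bit y (\<phi> v) = x}) \<le> \<beta> * real (card V)) \<or>
                (\<forall>x. real (card {v \<in> Y. diff_bit (\<phi> v) y' = x}) \<le> \<beta> * real (card V))"
  shows "\<exists>vs. set vs \<in> E \<and> set vs \<subseteq> Y \<and> length vs = K \<and> sorted_wrt (<) (map \<phi> vs) \<and>
          step_up C (take (Suc j) (drop a (map \<phi> vs))) = c"
  using light
proof
  assume light: "\<forall>x. real (card {v \<in> Y. diff_bit y (\<phi> v) = x}) \<le> \<beta> * real (card V)"
  have "diff_bit y (\<phi> v) < M" if "v \<in> Y" for v
    using yy(1)[OF that] yy(2) by (intro diff_bit_less) auto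
  then obtain vs where vs: "set vs \<in> E" "set vs \<subseteq> Y" "length vs = K"
     "sorted_wrt (<) (map (\<lambda>v. diff_bit y (\<phi> v)) vs)"
     "C (take j (drop (Suc a) (map (\<lambda>v. diff_bit y (\<phi> v)) vs))) = c"
    using unavoidable_coloursD[OF IH Y, of "\<lambda>v. diff_bit y (\<phi> v)" "Suc a" c] light a by auto
  have "y < \<phi> v" if "v \<in> set vs" for v using that vs(2) yy(1) by blast
  note comb = step_up_right_comb(1)[OF vs(3) a this vs(4)] step_up_right_comb(2)[OF vs(3) a this vs(4), of C]
  show ?thesis using comb(1) vs(1-3) comb(2)[unfolded vs(5)] by (intro exI[of _ vs] conjI)
next
  assume light: "\<forall>x. real (card {v \<in> Y. diff_bit (\<phi> v) y' = x}) \<le> \<beta> * real (card V)"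
  have "diff_bit (\<phi> v) y' < M" if "v \<in> Y" for v
    using yy(1)[OF that] yy(2) by (intro diff_bit_less) auto
  then obtain vs where vs: "set vs \<in> E" "set vs \<subseteq> Y" "length vs = K"
     "sorted_wrt (<) (map (\<lambda>v. diff_bit (\<phi> v) y') vs)"
     "C (take j (drop (K - a - j) (map (\<lambda>v. diff_bit (\<phi> v) y') vs))) = c"
    using unavoidable_coloursD[OF IH Y, of "\<lambda>v. diff_bit (\<phi> v) y'" "K - a - j" c] light a by auto
  have "\<phi> v < y'" if "v \<in> set vs" for v using that vs(2) yy(1) by blast
  note comb = step_up_left_comb(1)[OF vs(3) a j this vs(4)] step_up_left_comb(2)[OF vs(3) a j this vs(4), of C]
  have "set (rev vs) \<in> E" "set (rev vs) \<subseteq> Y" "length (rev vs) = K" using vs(1-3) by simp_all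
  then show ?thesis using comb(1) comb(2)[unfolded vs(5)] by (intro exI[of _ "rev vs"] conjI)
qed

lemma window_nth:
  assumes "length vs = K" "a + Suc j \<le> K" "i \<le> j"
  shows "take (Suc j) (drop a (map \<phi> vs)) ! i = \<phi> (vs ! (a + i))"
  using assms by simp

text \<open>Of the 2 K + 11 slots, the middle 11 steer the differences at the window's start and the
  K on either side hold the remaining positions. If light levels do not settle the matter, heavy
  bundles supply pairs whose difference is smaller than that from anything outside their
  surroundings. Such a pair in the middle of four points makes a local minimum; at one end it helps
  to make a local maximum. The fibre bound drops by 4 because a bundle of size \<beta> |V| can be
  split only if fibres have at most a quarter of that size.\<close>

lemma unavoidable_colours_step_up:
  fixes \<epsilon> \<epsilon>' \<beta> \<gamma> \<theta> :: real
  assumes V: "finite V" "V \<noteq> {}" and IH: "unavoidable_colours K V E j M C \<epsilon> \<beta>"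
    and hit: "pair_hitting K V E \<gamma> \<theta> q" and j: "j \<ge> 3"
    and pos: "\<beta> > 0" "\<epsilon>' > 0"
    and L: "L = 2 * K + 11" and small: "8 * real L * \<epsilon> \<le> \<epsilon>'" "16 * real L * \<gamma> \<le> \<epsilon>'" "real L * \<beta> \<le> \<epsilon>'" "4 * \<theta> \<le> \<beta>"
    and R: "1 \<le> \<beta> * real R" "K + 2 * R \<le> q"
  shows "unavoidable_colours K V E (Suc j) (2 ^ M) (step_up C) \<epsilon>' (\<beta> / 4)"
  unfolding unavoidable_colours_def
proof (intro allI impI)
  fix U and \<phi> :: "'a \<Rightarrow> nat" and a c
  assume U: "U \<subseteq> V" "\<epsilon>' * real (card V) \<le> real (card U)" and M: "\<forall>v\<in>U. \<phi> v < 2 ^ M"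
    and fib: "\<forall>x. real (card {v \<in> U. \<phi> v = x}) \<le> \<beta> / 4 * real (card V)" and a: "a + Suc j \<le> K"
  define n where "n = real (card V)"
  have n: "n > 0" using V unfolding n_def by (simp add: card_gt_0_iff)
  have finU: "finite U" using U V finite_subset by blast
  have L0: "real L > 0" using L by simp
  \<comment> \<open>Half of the share of a slot; the other half pays for uncut fibres. A quarter of
    a slot still has \<epsilon>' |V| / (8 L) vertices, whence the constant 8 L for \<epsilon>, and
    16 L for \<gamma> because bundles need density 2 \<gamma>.\<close>
  define s where "s = \<epsilon>' / (2 * real L) * n"
  have s: "s > 0" using pos n L0 unfolding s_def by simp
  have "real L * (s + \<beta> / 4 * n) = (\<epsilon>' / 2 + real L * \<beta> / 4) * n"
    using L0 unfolding s_def by (simp add: field_simps)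
  also have "\<dots> \<le> \<epsilon>' * n" using small(3) pos n by (intro mult_right_mono) auto
  also have "\<dots> \<le> real (card U)" using U(2) unfolding n_def .
  finally have "real L * (s + \<beta> / 4 * n) \<le> real (card U)" .
  then have "\<exists>G. (\<forall>i<L. G i \<subseteq> U \<and> s \<le> real (card (G i))) \<and>
     (\<forall>i j. i < j \<longrightarrow> j < L \<longrightarrow> (\<forall>v\<in>G i. \<forall>w\<in>G j. \<phi> v < \<phi> w))"
    using s fib by (intro ordered_slots[OF finU]) (auto simp: n_def)
  then obtain G where slots: "\<forall>i<L. G i \<subseteq> U \<and> s \<le> real (card (G i))"
    "\<forall>i j. i < j \<longrightarrow> j < L \<longrightarrow> (\<forall>v\<in>G i. \<forall>w\<in>G j. \<phi> v < \<phi> w)" by (elim exE conjE)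
  have G: "G i \<subseteq> U \<and> s \<le> real (card (G i))" if "i < L" for i
    using slots(1) that by simp
  have less: "\<phi> v < \<phi> w" if "i < j" "j < L" "v \<in> G i" "w \<in> G j" for i j v w
    using slots(2) that by simp
  have "\<exists>v. v \<in> G i" if "i < L" for i
  proof -
    have "real (card (G i)) > 0" using G[OF that] s by linarith
    then have "G i \<noteq> {}" by auto
    then show ?thesis by blast
  qed
  then have "\<forall>i. \<exists>v. i < L \<longrightarrow> v \<in> G i" by blast
  from choice[OF this] obtain rep where rep: "\<And>i. i < L \<Longrightarrow> rep i \<in> G i" by blast
  \<comment> \<open>A representative of each middle slot. For 0 < i < 10, slot K + i lies strictly
    between \<open>y (i - 1)\<close> and \<open>y (i + 1)\<close>, which serve as its two
    paths.\<close>
  define y where "y i = \<phi> (rep (K + i))" for i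
  have yM: "y i < 2 ^ M" if "i < 11" for i
    using rep[of "K + i"] G[of "K + i"] M that L unfolding y_def by auto
  have y_less: "y i < \<phi> w" if "K + i < l" "l < L" "w \<in> G l" for i l w
    unfolding y_def using less[OF that(1,2) rep that(3)] that by simp
  have less_y: "\<phi> w < y i" if "l < K + i" "i < 11" "w \<in> G l" for i l w
    unfolding y_def using less[OF that(1) _ that(3) rep, of] that L by simp
  have y_mono: "y i < y i'" if "i < i'" "i' < 11" for i i'
    using less_y[of "K + i" i' "rep (K + i)"] rep[of "K + i"] that L unfolding y_def by simp
  let ?good = "\<exists>vs. set vs \<in> E \<and> set vs \<subseteq> U \<and> length vs = K \<and> sorted_wrt (<) (map \<phi> vs) \<and>
          step_up C (take (Suc j) (drop a (map \<phi> vs))) = c"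
  have dich: "?good \<or> (\<exists>Y \<tau>. Y \<subseteq> G (K + i) \<and> 2 * \<gamma> * n \<le> real (card Y) \<and>
       (\<forall>v\<in>Y. \<beta> * n < real (card {w \<in> Y. (\<tau> :: 'a \<Rightarrow> nat) w = \<tau> v})) \<and>
       (\<forall>v\<in>Y. \<forall>w\<in>Y. \<tau> v = \<tau> w \<longrightarrow> \<phi> v < \<phi> w \<longrightarrow>
          (\<forall>x\<le>y (i - 1). diff_bit (\<phi> v) (\<phi> w) < diff_bit x (\<phi> v)) \<and>
          (\<forall>x\<ge>y (i + 1). diff_bit (\<phi> v) (\<phi> w) < diff_bit (\<phi> w) x)))"
    if i: "0 < i" "i < 10" for i
  proof -
    have iL: "K + i < L" using i L by simp
    have X: "y (i - 1) < \<phi> v \<and> \<phi> v < y (i + 1)" if "v \<in> G (K + i)" for v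
      using y_less[OF _ iL that, of "i - 1"] less_y[OF _ _ that, of "i + 1"] i by simp
    have finX: "finite (G (K + i))" using G[OF iL] finU finite_subset by blast
    have "\<forall>v\<in>G (K + i). y (i - 1) < \<phi> v \<and> \<phi> v < y (i + 1)" using X by blast
    from hanging_subtrees[where \<phi> = \<phi> and h = "\<beta> * n", OF finX this]
    obtain Y where Y: "Y \<subseteq> G (K + i)" "card (G (K + i)) \<le> 4 * card Y"
      and cases: "(\<forall>x. real (card {v \<in> Y. diff_bit (y (i - 1)) (\<phi> v) = x}) \<le> \<beta> * n) \<or>
     (\<forall>x. real (card {v \<in> Y. diff_bit (\<phi> v) (y (i + 1)) = x}) \<le> \<beta> * n) \<or>
     (\<exists>\<tau> :: 'a \<Rightarrow> nat. (\<forall>v\<in>Y. \<beta> * n < real (card {w \<in> Y. \<tau> w = \<tau> v})) \<and>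
       (\<forall>v\<in>Y. \<forall>w\<in>Y. \<tau> v = \<tau> w \<longrightarrow> \<phi> v < \<phi> w \<longrightarrow>
          (\<forall>x\<le>y (i - 1). diff_bit (\<phi> v) (\<phi> w) < diff_bit x (\<phi> v)) \<and>
          (\<forall>x\<ge>y (i + 1). diff_bit (\<phi> v) (\<phi> w) < diff_bit (\<phi> w) x)))"
      by (elim exE conjE) (rule that)
    have YU: "Y \<subseteq> U" using Y(1) G[OF iL] by blast
    have cY: "s / 4 \<le> real (card Y)" using Y(2) G[OF iL] by linarith
    have "\<epsilon> * n \<le> s / 4"
    proof -
      have "\<epsilon> \<le> \<epsilon>' / (2 * real L) / 4" using small(1) L0 by (simp add: field_simps)
      from mult_right_mono[OF this, of n] show ?thesis using n unfolding s_def by simp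
    qed
    then have eY: "\<epsilon> * real (card V) \<le> real (card Y)" using cY unfolding n_def by linarith
    have "2 * \<gamma> * n \<le> s / 4"
    proof -
      have "2 * \<gamma> \<le> \<epsilon>' / (2 * real L) / 4" using small(2) L0 by (simp add: field_simps)
      from mult_right_mono[OF this, of n] show ?thesis using n unfolding s_def by simp
    qed
    then have gY: "2 * \<gamma> * n \<le> real (card Y)" using cY by linarith
    have YX: "y (i - 1) < \<phi> v \<and> \<phi> v < y (i + 1)" if "v \<in> Y" for v using X Y(1) that by blast
    have light: ?good if "(\<forall>x. real (card {v \<in> Y. diff_bit (y (i - 1)) (\<phi> v) = x}) \<le> \<beta> * n) \<or>
       (\<forall>x. real (card {v \<in> Y. diff_bit (\<phi> v) (y (i + 1)) = x}) \<le> \<beta> * n)"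
    proof -
      have "\<exists>vs. set vs \<in> E \<and> set vs \<subseteq> Y \<and> length vs = K \<and> sorted_wrt (<) (map \<phi> vs) \<and>
          step_up C (take (Suc j) (drop a (map \<phi> vs))) = c"
        using that j YU U(1) yM[of "i + 1"] i
        by (intro light_levels_step_up[where \<phi> = \<phi> and y = "y (i - 1)" and y' = "y (i + 1)", OF IH _ a _ eY YX])
          (auto simp: n_def)
      then show ?thesis using YU by blast
    qed
    from cases show ?thesis
    proof (elim disjE, goal_cases)
      case 1
      then have ?good by (intro light disjI1)
      then show ?thesis by (rule disjI1)
    next
      case 2
      then have ?good by (intro light disjI2)
      then show ?thesis by (rule disjI1)
    next
      case 3
      with Y(1) gY show ?thesis by (intro disjI2 exI[of _ Y]) (simp only: simp_thms ex_simps)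
    qed
  qed
  have fibY: "real (card {v \<in> Y. \<phi> v = x}) \<le> \<beta> * n / 4" if "Y \<subseteq> U" for Y x
  proof -
    have "card {v \<in> Y. \<phi> v = x} \<le> card {v \<in> U. \<phi> v = x}"
      using finU that by (intro card_mono) auto
    moreover have "real (card {v \<in> U. \<phi> v = x}) \<le> \<beta> * n / 4" using fib unfolding n_def by simp
    ultimately show ?thesis by linarith
  qed
  have \<gamma>s: "\<gamma> * n \<le> s"
  proof -
    have "\<epsilon>' / (2 * real L) \<ge> 8 * \<gamma>" using small(2) L0 by (simp add: field_simps)
    moreover have "\<epsilon>' / (2 * real L) > 0" using pos L0 by simp
    ultimately have "\<gamma> \<le> \<epsilon>' / (2 * real L)" by linarith
    from mult_right_mono[OF this, of n] show ?thesis using n unfolding s_def by simp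
  qed
  have hitting: "\<exists>vs. length vs = K \<and> set vs \<in> E \<and> set vs \<subseteq> U \<and> (\<forall>i<K. vs ! i \<in> G (\<sigma> i)) \<and> sorted_wrt (<) (map \<phi> vs) \<and>
     vs ! b \<in> Y \<and> vs ! Suc b \<in> Y \<and> \<tau> (vs ! b) = \<tau> (vs ! Suc b)"
    if b: "b + 2 \<le> K" and \<sigma>: "\<And>i. i < K \<Longrightarrow> \<sigma> i < L" "\<And>i j. i < j \<Longrightarrow> j < K \<Longrightarrow> \<sigma> i < \<sigma> j \<or> i = b \<and> j = Suc b"
      and Y: "Y \<subseteq> G (\<sigma> b)" "\<sigma> (Suc b) = \<sigma> b" "2 * \<gamma> * n \<le> real (card Y)"
      and heavy: "\<forall>v\<in>Y. \<beta> * n < real (card {w \<in> Y. (\<tau> :: 'a \<Rightarrow> nat) w = \<tau> v})" for b \<sigma> Y \<tau>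
  proof -
    have YU: "Y \<subseteq> U" using b Y(1) G[of "\<sigma> b"] \<sigma>(1)[of b] by auto
    have "\<exists>vs. length vs = K \<and> set vs \<in> E \<and> (\<forall>i<K. vs ! i \<in> G (\<sigma> i)) \<and> sorted_wrt (<) (map \<phi> vs) \<and>
       vs ! b \<in> Y \<and> vs ! Suc b \<in> Y \<and> \<tau> (vs ! b) = \<tau> (vs ! Suc b)"
    proof (rule bundle_hit_in_slots[where G = G and \<sigma> = \<sigma> and L = L and \<phi> = \<phi> and h = "\<beta> * n" and R = R, OF V(1) hit b])
      show "G i \<subseteq> V \<and> \<gamma> * real (card V) \<le> real (card (G i))" if "i < L" for i
        using G[OF that] U(1) \<gamma>s unfolding n_def by auto
      show "\<phi> v < \<phi> w" if "i < j" "j < L" "v \<in> G i" "w \<in> G j" for i j v w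
        using less that by blast
      show "\<theta> * real (card V) \<le> \<beta> * n / 4"
        using small(4) n mult_right_mono[of "4 * \<theta>" \<beta> n] unfolding n_def by simp
      show "real (card V) \<le> \<beta> * n * real R"
        using R(1) n mult_right_mono[of 1 "\<beta> * real R" n] unfolding n_def by (simp add: mult_ac)
      show "\<beta> * n < real (card {w \<in> Y. \<tau> w = \<tau> v})" if "v \<in> Y" for v
        using heavy that by blast
      show "0 < \<beta> * n" using pos n by simp
      show "2 * \<gamma> * real (card V) \<le> real (card Y)" using Y(3) unfolding n_def .
    qed (fact \<sigma> Y fibY[OF YU] R)+
    then obtain vs where vs: "length vs = K" "set vs \<in> E" "\<forall>i<K. vs ! i \<in> G (\<sigma> i)" "sorted_wrt (<) (map \<phi> vs)"
       "vs ! b \<in> Y" "vs ! Suc b \<in> Y" "\<tau> (vs ! b) = \<tau> (vs ! Suc b)" by blast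
    have "set vs \<subseteq> U"
    proof
      fix v assume "v \<in> set vs"
      then obtain i where "i < K" "v = vs ! i" using vs(1) by (metis in_set_conv_nth)
      then show "v \<in> U" using vs(3) G[of "\<sigma> i"] \<sigma>(1)[of i] by auto
    qed
    then show ?thesis using vs by blast
  qed
  have lenw: "length (take (Suc j) (drop a (map \<phi> vs))) \<ge> 4" if "length vs = K" for vs
    using that a j by simp
  show ?good
  proof (rule ccontr)
    assume bad: "\<not> ?good"
    from dich[of 1] bad obtain Y1 \<tau>1 where Y1: "Y1 \<subseteq> G (K + 1)" "2 * \<gamma> * n \<le> real (card Y1)"
       "\<forall>v\<in>Y1. \<beta> * n < real (card {w \<in> Y1. (\<tau>1 :: 'a \<Rightarrow> nat) w = \<tau>1 v})"
       "\<And>v w x. v \<in> Y1 \<Longrightarrow> w \<in> Y1 \<Longrightarrow> \<tau>1 v = \<tau>1 w \<Longrightarrow> \<phi> v < \<phi> w \<Longrightarrow> x \<le> y 0 \<Longrightarrow> diff_bit (\<phi> v) (\<phi> w) < diff_bit x (\<phi> v)"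
       "\<And>v w x. v \<in> Y1 \<Longrightarrow> w \<in> Y1 \<Longrightarrow> \<tau>1 v = \<tau>1 w \<Longrightarrow> \<phi> v < \<phi> w \<Longrightarrow> x \<ge> y 2 \<Longrightarrow> diff_bit (\<phi> v) (\<phi> w) < diff_bit (\<phi> w) x"
      by (auto simp: numeral_2_eq_2)
    from dich[of 9] bad obtain Y9 \<tau>9 where Y9: "Y9 \<subseteq> G (K + 9)" "2 * \<gamma> * n \<le> real (card Y9)"
       "\<forall>v\<in>Y9. \<beta> * n < real (card {w \<in> Y9. (\<tau>9 :: 'a \<Rightarrow> nat) w = \<tau>9 v})"
       "\<And>v w x. v \<in> Y9 \<Longrightarrow> w \<in> Y9 \<Longrightarrow> \<tau>9 v = \<tau>9 w \<Longrightarrow> \<phi> v < \<phi> w \<Longrightarrow> x \<le> y 8 \<Longrightarrow> diff_bit (\<phi> v) (\<phi> w) < diff_bit x (\<phi> v)"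
      by auto
    show False
    proof (cases c)
      case False
      \<comment> \<open>Positions a + 1 and a + 2 form the pair in slot K + 1. Position a lies below
        \<open>y 0\<close> and a + 3 above \<open>y 2\<close>, so both outer differences exceed the
        middle one: a local minimum.\<close>
      define \<sigma> where "\<sigma> i = (if i \<le> a then i else if i \<le> a + 2 then K + 1 else K + 11 + i)" for i
      have "\<exists>vs. length vs = K \<and> set vs \<in> E \<and> set vs \<subseteq> U \<and> (\<forall>i<K. vs ! i \<in> G (\<sigma> i)) \<and> sorted_wrt (<) (map \<phi> vs) \<and>
         vs ! Suc a \<in> Y1 \<and> vs ! Suc (Suc a) \<in> Y1 \<and> \<tau>1 (vs ! Suc a) = \<tau>1 (vs ! Suc (Suc a))"
        by (rule hitting) (use a j L Y1 in \<open>auto simp: \<sigma>_def\<close>)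
      then obtain vs where vs: "length vs = K" "set vs \<in> E" "set vs \<subseteq> U" "\<And>i. i < K \<Longrightarrow> vs ! i \<in> G (\<sigma> i)"
        "sorted_wrt (<) (map \<phi> vs)" "vs ! Suc a \<in> Y1" "vs ! Suc (Suc a) \<in> Y1" "\<tau>1 (vs ! Suc a) = \<tau>1 (vs ! Suc (Suc a))"
        by blast
      have inc: "\<phi> (vs ! Suc a) < \<phi> (vs ! Suc (Suc a))"
        using sorted_wrt_nth_less[OF vs(5), of "Suc a" "Suc (Suc a)"] vs(1) a j by simp
      have "\<phi> (vs ! a) < y 0" using less_y[of a 0 "vs ! a"] vs(4)[of a] a unfolding \<sigma>_def by simp
      moreover have "y 2 < \<phi> (vs ! (a + 3))"
        using y_less[of 2 "K + 11 + (a + 3)" "vs ! (a + 3)"] vs(4)[of "a + 3"] a j L unfolding \<sigma>_def by simp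
      ultimately have "step_up C (take (Suc j) (drop a (map \<phi> vs))) = c"
        using Y1(4,5)[OF vs(6,7,8) inc] lenw[OF vs(1)] False a j vs(1)
        by (intro step_up_local_extremum) (auto simp: window_nth eval_nat_numeral)
      then show False using bad vs by blast
    next
      case True
      \<comment> \<open>The two gaps have distinct differences. Window positions a + 1 and a + 2 are
        placed across the larger gap, so their difference is at least that of the gap. Two positions
        inside the smaller gap give one smaller outer difference; a bundle pair beyond the larger
        gap, in slot K + 1 or K + 9, gives the other. The result is a local maximum.\<close>
      have "y 2 < y 5" "y 5 < y 8" using y_mono by simp_all
      then consider "diff_bit (y 5) (y 8) < diff_bit (y 2) (y 5)" | "diff_bit (y 2) (y 5) < diff_bit (y 5) (y 8)"
        using diff_bit_adjacent_neq nat_neq_iff by metis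
      then show False
      proof cases
        case 1
        define \<sigma> where "\<sigma> i = (if i < a then i else if i \<le> a + 1 then K + 1 else if i \<le> a + 3 then K + 6 + (i - (a + 2)) else K + 11 + i)" for i
        have "\<exists>vs. length vs = K \<and> set vs \<in> E \<and> set vs \<subseteq> U \<and> (\<forall>i<K. vs ! i \<in> G (\<sigma> i)) \<and> sorted_wrt (<) (map \<phi> vs) \<and>
           vs ! a \<in> Y1 \<and> vs ! Suc a \<in> Y1 \<and> \<tau>1 (vs ! a) = \<tau>1 (vs ! Suc a)"
          by (rule hitting) (use a j L Y1 in \<open>auto simp: \<sigma>_def\<close>)
        then obtain vs where vs: "length vs = K" "set vs \<in> E" "set vs \<subseteq> U" "\<And>i. i < K \<Longrightarrow> vs ! i \<in> G (\<sigma> i)"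
          "sorted_wrt (<) (map \<phi> vs)" "vs ! a \<in> Y1" "vs ! Suc a \<in> Y1" "\<tau>1 (vs ! a) = \<tau>1 (vs ! Suc a)"
          by blast
        have inc: "\<phi> (vs ! i) < \<phi> (vs ! i')" if "i < i'" "i' \<le> a + 3" for i i'
          using sorted_wrt_nth_less[OF vs(5), of i i'] vs(1) a j that by simp
        have in67: "vs ! (a + 2) \<in> G (K + 6)" "vs ! (a + 3) \<in> G (K + 7)"
          using vs(4)[of "a + 2"] vs(4)[of "a + 3"] a j unfolding \<sigma>_def by (simp_all add: add.commute)
        have b5: "y 5 < \<phi> (vs ! (a + 2))" using y_less[OF _ _ in67(1), of 5] L by simp
        have b8: "\<phi> (vs ! (a + 3)) < y 8" using less_y[OF _ _ in67(2), of 8] by simp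
        have b2: "\<phi> (vs ! (a + 1)) < y 2" using less_y[of "K + 1" 2 "vs ! (a + 1)"] vs(7) Y1(1) by auto
        have "diff_bit (\<phi> (vs ! a)) (\<phi> (vs ! (a + 1))) < diff_bit (\<phi> (vs ! (a + 1))) (\<phi> (vs ! (a + 2)))"
          using Y1(5)[OF vs(6,7,8) inc, of "\<phi> (vs ! (a + 2))"] b5 \<open>y 2 < y 5\<close> by simp
        moreover have "diff_bit (\<phi> (vs ! (a + 2))) (\<phi> (vs ! (a + 3))) \<le> diff_bit (y 5) (y 8)"
          using b5 b8 inc[of "a + 2" "a + 3"] by (intro diff_bit_subinterval) auto
        moreover have "diff_bit (y 2) (y 5) \<le> diff_bit (\<phi> (vs ! (a + 1))) (\<phi> (vs ! (a + 2)))"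
          using b2 b5 \<open>y 2 < y 5\<close> by (intro diff_bit_subinterval) auto
        ultimately have "step_up C (take (Suc j) (drop a (map \<phi> vs))) = c"
          using lenw[OF vs(1)] True a j vs(1) 1
          by (intro step_up_local_extremum) (auto simp: window_nth)
        then show False using bad vs by blast
      next
        case 2
        define \<sigma> where "\<sigma> i = (if i < a then i else if i \<le> a + 1 then K + 3 + (i - a) else if i \<le> a + 3 then K + 9 else K + 11 + i)" for i
        have "\<exists>vs. length vs = K \<and> set vs \<in> E \<and> set vs \<subseteq> U \<and> (\<forall>i<K. vs ! i \<in> G (\<sigma> i)) \<and> sorted_wrt (<) (map \<phi> vs) \<and>
           vs ! (a + 2) \<in> Y9 \<and> vs ! Suc (a + 2) \<in> Y9 \<and> \<tau>9 (vs ! (a + 2)) = \<tau>9 (vs ! Suc (a + 2))"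
          by (rule hitting) (use a j L Y9 in \<open>auto simp: \<sigma>_def\<close>)
        then obtain vs where vs: "length vs = K" "set vs \<in> E" "set vs \<subseteq> U" "\<And>i. i < K \<Longrightarrow> vs ! i \<in> G (\<sigma> i)"
          "sorted_wrt (<) (map \<phi> vs)" "vs ! (a + 2) \<in> Y9" "vs ! Suc (a + 2) \<in> Y9" "\<tau>9 (vs ! (a + 2)) = \<tau>9 (vs ! Suc (a + 2))"
          by blast
        have inc: "\<phi> (vs ! i) < \<phi> (vs ! i')" if "i < i'" "i' \<le> a + 3" for i i'
          using sorted_wrt_nth_less[OF vs(5), of i i'] vs(1) a j that by simp
        have in34: "vs ! a \<in> G (K + 3)" "vs ! (a + 1) \<in> G (K + 4)"
          using vs(4)[of a] vs(4)[of "a + 1"] a j unfolding \<sigma>_def by (simp_all add: add.commute)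
        have b2: "y 2 < \<phi> (vs ! a)" using y_less[OF _ _ in34(1), of 2] L by simp
        have b5: "\<phi> (vs ! (a + 1)) < y 5" using less_y[OF _ _ in34(2), of 5] by simp
        have b8: "y 8 < \<phi> (vs ! (a + 2))" using y_less[of 8 "K + 9" "vs ! (a + 2)"] vs(6) Y9(1) L by auto
        have "diff_bit (\<phi> (vs ! (a + 2))) (\<phi> (vs ! (a + 3))) < diff_bit (\<phi> (vs ! (a + 1))) (\<phi> (vs ! (a + 2)))"
          using Y9(4)[OF vs(6,7,8) inc, of "\<phi> (vs ! (a + 1))"] b5 \<open>y 5 < y 8\<close> by (simp add: eval_nat_numeral)
        moreover have "diff_bit (\<phi> (vs ! a)) (\<phi> (vs ! (a + 1))) \<le> diff_bit (y 2) (y 5)"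
          using b2 b5 inc[of a "a + 1"] by (intro diff_bit_subinterval) auto
        moreover have "diff_bit (y 5) (y 8) \<le> diff_bit (\<phi> (vs ! (a + 1))) (\<phi> (vs ! (a + 2)))"
          using b8 b5 \<open>y 5 < y 8\<close> by (intro diff_bit_subinterval) auto
        ultimately have "step_up C (take (Suc j) (drop a (map \<phi> vs))) = c"
          using lenw[OF vs(1)] True a j vs(1) 2
          by (intro step_up_local_extremum) (auto simp: window_nth)
        then show False using bad vs by blast
      qed
    qed
  qed
qed

section \<open>Triples\<close>

lemma sum_Pow_half_power:
  assumes "finite A"
  shows "(\<Sum>R\<in>Pow A. (1 / 2 :: real) ^ card (R \<inter> X)) = 2 ^ card (A - X) * (3 / 2) ^ card (A \<inter> X)"
  using assms
proof (induction A rule: finite_induct)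
  case (insert e A)
  have disj: "Pow A \<inter> insert e ` Pow A = {}" using insert.hyps by auto
  have inj: "inj_on (insert e) (Pow A)" using insert.hyps by (auto simp: inj_on_def)
  have "(\<Sum>R\<in>Pow (insert e A). (1 / 2 :: real) ^ card (R \<inter> X)) =
      (\<Sum>R\<in>Pow A. (1 / 2) ^ card (R \<inter> X)) + (\<Sum>R\<in>Pow A. (1 / 2) ^ card (insert e R \<inter> X))"
    unfolding Pow_insert using insert.hyps(1) disj inj by (simp add: sum.union_disjoint sum.reindex)
  also have "(\<Sum>R\<in>Pow A. (1 / 2 :: real) ^ card (insert e R \<inter> X)) =
      (if e \<in> X then 1 / 2 else 1) * (\<Sum>R\<in>Pow A. (1 / 2) ^ card (R \<inter> X))"
    unfolding sum_distrib_left
  proof (intro sum.cong refl)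
    fix R assume "R \<in> Pow A"
    then have "finite (R \<inter> X)" "e \<notin> R" using insert.hyps finite_subset by auto
    then show "(1 / 2 :: real) ^ card (insert e R \<inter> X) = (if e \<in> X then 1 / 2 else 1) * (1 / 2) ^ card (R \<inter> X)"
      by (simp add: Int_insert_left)
  qed
  finally show ?case
    using insert by (simp add: insert_Diff_if Int_insert_left)
qed simp

text \<open>Markov's inequality for (1 / 2) ^ card (R \<inter> X) with R uniformly random. The mean
  is (3 / 4) ^ card X, at most 2 powr (- 3 card X / 8); dividing by 2 powr (- card X / 8) leaves the
  bound.\<close>

lemma card_sparse_subsets_le:
  assumes "finite A" "X \<subseteq> A"
  shows "real (card {R \<in> Pow A. 8 * card (R \<inter> X) < card X}) \<le> 2 ^ card A * 2 powr (- real (card X) / 4)"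
proof -
  let ?B = "{R \<in> Pow A. 8 * card (R \<inter> X) < card X}"
  have "real (card ?B) * 2 powr (- real (card X) / 8) = (\<Sum>R\<in>?B. 2 powr (- real (card X) / 8))" by simp
  also have "\<dots> \<le> (\<Sum>R\<in>?B. (1 / 2 :: real) ^ card (R \<inter> X))"
  proof (rule sum_mono)
    fix R assume "R \<in> ?B"
    then have "- real (card X) / 8 \<le> - real (card (R \<inter> X))" by simp
    then have "2 powr (- real (card X) / 8) \<le> 2 powr (- real (card (R \<inter> X)))" by (intro powr_mono) auto
    also have "\<dots> = (1 / 2 :: real) ^ card (R \<inter> X)"
      by (simp add: powr_minus powr_realpow power_divide field_simps)
    finally show "2 powr (- real (card X) / 8) \<le> (1 / 2 :: real) ^ card (R \<inter> X)" .
  qed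
  also have "\<dots> \<le> (\<Sum>R\<in>Pow A. (1 / 2 :: real) ^ card (R \<inter> X))"
    using assms(1) by (intro sum_mono2) auto
  also have "\<dots> = 2 ^ card (A - X) * (3 / 2) ^ card (A \<inter> X)" by (rule sum_Pow_half_power[OF assms(1)])
  also have "\<dots> = 2 ^ card A * (3 / 4) ^ card X"
  proof -
    have "card (A - X) = card A - card X" "card X \<le> card A" "A \<inter> X = X"
      using assms by (auto simp: card_Diff_subset finite_subset card_mono)
    moreover have "(2 :: real) ^ (card A - card X) * 2 ^ card X = 2 ^ card A"
      using \<open>card X \<le> card A\<close> by (simp flip: power_add)
    moreover have "(3 / 2 :: real) ^ card X = 2 ^ card X * (3 / 4) ^ card X"
      by (simp flip: power_mult_distrib)
    ultimately show ?thesis by (simp add: mult.assoc[symmetric])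
  qed
  also have "(3 / 4 :: real) ^ card X \<le> (2 powr (- 3 / 8)) ^ card X"
  proof (intro power_mono)
    have "(3 / 4 :: real) ^ 8 \<le> 1 / 8" by (simp add: field_simps)
    also have "(1 / 8 :: real) = (2 powr (- 3 / 8)) ^ 8"
    proof -
      have "(2 powr (- 3 / 8) :: real) ^ 8 = 2 powr (- 3)" by (simp add: powr_power)
      also have "\<dots> = 1 / 8" by (simp add: powr_minus powr_numeral)
      finally show ?thesis by simp
    qed
    finally show "(3 / 4 :: real) \<le> 2 powr (- 3 / 8)"
      using power_mono_iff[of "3 / 4 :: real" "2 powr (- 3 / 8)" 8] by simp
  qed simp
  also have "\<dots> = 2 powr (- 3 * real (card X) / 8)" by (simp add: powr_power mult.commute)
  also have "\<dots> = 2 powr (- real (card X) / 4) * 2 powr (- real (card X) / 8)"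
    by (simp flip: powr_add)
  finally show ?thesis by (simp add: mult.assoc)
qed

text \<open>A union bound by counting. For each of the at most M ^ s sets S, either colour may fall
  below an eighth of the triples; complementation exchanges the two failures and accounts for the
  factor 2. The hypothesis says that the failures do not exhaust all colourings.\<close>

lemma balanced_triple_colouring:
  assumes "2 * real M ^ s < 2 powr (real (s choose 3) / 4)"
  shows "\<exists>C :: nat list \<Rightarrow> bool. \<forall>S c. S \<subseteq> {..<M} \<longrightarrow> card S = s \<longrightarrow>
     s choose 3 \<le> 8 * card {T \<in> [S]\<^bsup>3\<^esup>. C (sorted_list_of_set T) = c}"
proof -
  define A where "A = [{..<M}]\<^bsup>3\<^esup>"
  define \<S> where "\<S> = [{..<M}]\<^bsup>s\<^esup>"
  have finA: "finite A" and fin\<S>: "finite \<S>" unfolding A_def \<S>_def by (auto intro: finite_imp_finite_nsets)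
  define bad where "bad S = {R \<in> Pow A. 8 * card (R \<inter> [S]\<^bsup>3\<^esup>) < s choose 3}" for S
  define Bad where "Bad = (\<Union>S\<in>\<S>. bad S \<union> (\<lambda>R. A - R) ` bad S)"
  have bad_le: "real (card (bad S)) \<le> 2 ^ card A * 2 powr (- real (s choose 3) / 4)" if "S \<in> \<S>" for S
  proof -
    have "[S]\<^bsup>3\<^esup> \<subseteq> A" "card ([S]\<^bsup>3\<^esup>) = s choose 3"
      using that unfolding A_def \<S>_def by (auto simp: nsets_def intro!: card_nsets[unfolded nsets_def])
    then show ?thesis using card_sparse_subsets_le[OF finA, of "[S]\<^bsup>3\<^esup>"] unfolding bad_def by simp
  qed
  have finbad: "finite (bad S)" for S using finA unfolding bad_def by simp
  have "card (bad S \<union> (\<lambda>R. A - R) ` bad S) \<le> 2 * card (bad S)" for S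
    using card_Un_le[of "bad S" "(\<lambda>R. A - R) ` bad S"] card_image_le[OF finbad[of S], of "\<lambda>R. A - R"] by simp
  then have "(\<Sum>S\<in>\<S>. card (bad S \<union> (\<lambda>R. A - R) ` bad S)) \<le> (\<Sum>S\<in>\<S>. 2 * card (bad S))"
    by (intro sum_mono)
  with card_UN_le[OF fin\<S>] have "card Bad \<le> (\<Sum>S\<in>\<S>. 2 * card (bad S))"
    unfolding Bad_def by (rule order_trans)
  then have "real (card Bad) \<le> (\<Sum>S\<in>\<S>. 2 * real (card (bad S)))"
    by (simp flip: of_nat_sum sum_distrib_left)
  also have "\<dots> \<le> (\<Sum>S\<in>\<S>. 2 * (2 ^ card A * 2 powr (- real (s choose 3) / 4)))"
    using bad_le by (intro sum_mono) simp
  also have "\<dots> = real (card \<S>) * (2 * (2 ^ card A * 2 powr (- real (s choose 3) / 4)))" by simp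
  also have "\<dots> \<le> real M ^ s * (2 * (2 ^ card A * 2 powr (- real (s choose 3) / 4)))"
  proof (rule mult_right_mono)
    have "card \<S> \<le> M ^ s"
      unfolding \<S>_def by (cases "s \<le> M") (auto simp: card_nsets binomial_le_pow binomial_eq_0)
    then show "real (card \<S>) \<le> real M ^ s" by (metis of_nat_le_iff of_nat_power)
  qed simp
  also have "\<dots> = 2 ^ card A * ((2 * real M ^ s) * 2 powr (- real (s choose 3) / 4))" by simp
  also have "\<dots> < 2 ^ card A * (2 powr (real (s choose 3) / 4) * 2 powr (- real (s choose 3) / 4))"
    using assms by simp
  also have "\<dots> = real (card (Pow A))" using finA by (simp add: card_Pow flip: powr_add)
  finally have "card Bad < card (Pow A)" by simp
  moreover have "Bad \<subseteq> Pow A" unfolding Bad_def bad_def by auto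
  ultimately obtain R where R: "R \<in> Pow A" "R \<notin> Bad"
    using finA by (metis card_mono finite_Pow_iff finite_subset leD subsetI)
  define C where "C xs \<longleftrightarrow> set xs \<in> R" for xs :: "nat list"
  have "s choose 3 \<le> 8 * card {T \<in> [S]\<^bsup>3\<^esup>. C (sorted_list_of_set T) = c}"
    if S: "S \<subseteq> {..<M}" "card S = s" for S c
  proof -
    have S\<S>: "S \<in> \<S>" using S finite_subset unfolding \<S>_def nsets_def by blast
    have SA: "[S]\<^bsup>3\<^esup> \<subseteq> A" using S unfolding A_def nsets_def by auto
    have C: "C (sorted_list_of_set T) \<longleftrightarrow> T \<in> R" if "T \<in> [S]\<^bsup>3\<^esup>" for T
      using that unfolding C_def nsets_def by simp
    show ?thesis
    proof (cases c)
      case True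
      then have "{T \<in> [S]\<^bsup>3\<^esup>. C (sorted_list_of_set T) = c} = R \<inter> [S]\<^bsup>3\<^esup>" using C by blast
      moreover have "R \<notin> bad S" using R(2) S\<S> unfolding Bad_def by blast
      ultimately show ?thesis using R(1) unfolding bad_def by simp
    next
      case False
      then have eq: "{T \<in> [S]\<^bsup>3\<^esup>. C (sorted_list_of_set T) = c} = (A - R) \<inter> [S]\<^bsup>3\<^esup>" using C SA by blast
      have "A - R \<notin> bad S"
      proof
        assume "A - R \<in> bad S"
        then have "A - (A - R) \<in> (\<lambda>R. A - R) ` bad S" by blast
        moreover have "A - (A - R) = R" using R(1) by blast
        ultimately show False using R(2) S\<S> unfolding Bad_def by auto
      qed
      then show ?thesis unfolding eq bad_def by simp
    qed
  qed
  then show ?thesis by blast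
qed

lemma sorted_list_of_set_strict_sorted:
  assumes "sorted_wrt (<) (xs :: 'b::linorder list)"
  shows "sorted_list_of_set (set xs) = xs"
  using assms sorted_list_of_set.idem_if_sorted_distinct strict_sorted_iff by blast

section \<open>Density of coloured windows under a map with small fibres\<close>

text \<open>Averaging the colour count over all transversals of the rows.\<close>

lemma coloured_triples_in_rows:
  fixes \<phi> :: "'a \<Rightarrow> nat" and R :: "nat \<Rightarrow> 'a set"
  assumes C: "\<And>S. S \<subseteq> {..<M} \<Longrightarrow> card S = s \<Longrightarrow>
       s choose 3 \<le> 8 * card {T \<in> [S]\<^bsup>3\<^esup>. C (sorted_list_of_set T) = c}"
    and R: "\<And>i. i < s \<Longrightarrow> finite (R i) \<and> card (R i) = r" and r: "r > 0"
    and M: "\<And>i v. i < s \<Longrightarrow> v \<in> R i \<Longrightarrow> \<phi> v < M"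
    and less: "\<And>i j v w. i < j \<Longrightarrow> j < s \<Longrightarrow> v \<in> R i \<Longrightarrow> w \<in> R j \<Longrightarrow> \<phi> v < \<phi> w"
  shows "r ^ 3 * (s choose 3) \<le> 8 * card {ts. length ts = 3 \<and> set ts \<subseteq> (\<Union>i<s. R i) \<and>
     sorted_wrt (<) (map \<phi> ts) \<and> C (map \<phi> ts) = c}"
proof -
  define \<Omega> where "\<Omega> = PiE {..<s} R"
  define J where "J = [{..<s}]\<^bsup>3\<^esup>"
  define TL where "TL = {ts. length ts = 3 \<and> set ts \<subseteq> (\<Union>i<s. R i) \<and>
     sorted_wrt (<) (map \<phi> ts) \<and> C (map \<phi> ts) = c}"
  have fin\<Omega>: "finite \<Omega>" unfolding \<Omega>_def using R by (intro finite_PiE) auto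
  have card\<Omega>: "card \<Omega> = r ^ s" unfolding \<Omega>_def using R by (simp add: card_PiE)
  have finJ: "finite J" unfolding J_def by (auto intro: finite_imp_finite_nsets)
  have J: "I \<subseteq> {..<s}" "finite I" "card I = 3" if "I \<in> J" for I
    using that unfolding J_def nsets_def by auto
  \<comment> \<open>This depends on \<rho> only through its values on I, so it makes sense both for
    full transversals and for their restrictions to I.\<close>
  define good where "good I \<rho> \<longleftrightarrow> C (sorted_list_of_set ((\<lambda>i. \<phi> (\<rho> i)) ` I)) = c" for I and \<rho> :: "nat \<Rightarrow> 'a"
  have mono: "\<phi> (\<rho> i) < \<phi> (\<rho> j)" if "\<rho> \<in> PiE I R" "I \<subseteq> {..<s}" "i \<in> I" "j \<in> I" "i < j" for \<rho> I i j
    using less[of i j "\<rho> i" "\<rho> j"] that by (auto simp: PiE_iff)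
  have count\<rho>: "s choose 3 \<le> 8 * card {I \<in> J. good I \<rho>}" if \<rho>: "\<rho> \<in> \<Omega>" for \<rho>
  proof -
    let ?f = "\<lambda>i. \<phi> (\<rho> i)"
    let ?S = "?f ` {..<s}"
    have inj: "inj_on ?f {..<s}"
      using mono[of \<rho> "{..<s}"] \<rho> unfolding \<Omega>_def inj_on_def by (metis lessThan_iff linorder_neqE_nat nat_neq_iff subset_refl)
    have "?S \<subseteq> {..<M}" using \<rho> M unfolding \<Omega>_def by (auto simp: PiE_iff)
    moreover have "card ?S = s" using inj by (simp add: card_image)
    ultimately have CS: "s choose 3 \<le> 8 * card {T \<in> [?S]\<^bsup>3\<^esup>. C (sorted_list_of_set T) = c}" by (rule C)
    have "{T \<in> [?S]\<^bsup>3\<^esup>. C (sorted_list_of_set T) = c} \<subseteq> (`) ?f ` {I \<in> J. good I \<rho>}"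
    proof
      fix T assume T: "T \<in> {T \<in> [?S]\<^bsup>3\<^esup>. C (sorted_list_of_set T) = c}"
      then have T': "T \<subseteq> ?S" "finite T" "card T = 3" unfolding nsets_def by auto
      then obtain I where I: "I \<subseteq> {..<s}" "T = ?f ` I" by (meson subset_imageE)
      then have "card I = 3" using T'(3) inj by (metis card_image inj_on_subset)
      then have "I \<in> J" using I(1) finite_subset unfolding J_def nsets_def by blast
      then show "T \<in> (`) ?f ` {I \<in> J. good I \<rho>}" using T I(2) unfolding good_def by blast
    qed
    then have "card {T \<in> [?S]\<^bsup>3\<^esup>. C (sorted_list_of_set T) = c} \<le> card {I \<in> J. good I \<rho>}"
      using finJ by (intro surj_card_le) auto
    then show ?thesis using CS by linarith
  qed
  define Tr where "Tr I = {\<tau> \<in> PiE I R. good I \<tau>}" for I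
  have finTr: "finite (Tr I)" if "I \<in> J" for I
  proof -
    have "finite (PiE I R)" using J[OF that] R by (intro finite_PiE) auto
    then show ?thesis unfolding Tr_def by simp
  qed
  \<comment> \<open>A transversal splits into its part on I and the rest, so each triple lies in at
    most r ^ (s - 3) transversals. Cancelling this factor from r ^ s leaves r ^ 3.\<close>
  have countI: "card {\<rho> \<in> \<Omega>. good I \<rho>} \<le> card (Tr I) * r ^ (s - 3)" if I: "I \<in> J" for I
  proof -
    let ?I' = "{..<s} - I"
    let ?h = "\<lambda>\<rho>. (restrict \<rho> I, restrict \<rho> ?I')"
    have inj: "inj_on ?h {\<rho> \<in> \<Omega>. good I \<rho>}"
    proof (rule inj_onI)
      fix \<rho> \<rho>' assume \<rho>: "\<rho> \<in> {\<rho> \<in> \<Omega>. good I \<rho>}" "\<rho>' \<in> {\<rho> \<in> \<Omega>. good I \<rho>}" and eq: "?h \<rho> = ?h \<rho>'"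
      show "\<rho> = \<rho>'"
      proof
        fix i
        show "\<rho> i = \<rho>' i"
        proof (cases "i < s")
          case True
          have "restrict \<rho> I i = restrict \<rho>' I i" "restrict \<rho> ?I' i = restrict \<rho>' ?I' i" using eq by auto
          then show ?thesis using True by (cases "i \<in> I") auto
        next
          case False
          then show ?thesis using \<rho> unfolding \<Omega>_def by (auto simp: PiE_def extensional_def)
        qed
      qed
    qed
    have "good I (restrict \<rho> I) \<longleftrightarrow> good I \<rho>" for \<rho>
    proof -
      have "(\<lambda>i. \<phi> (restrict \<rho> I i)) ` I = (\<lambda>i. \<phi> (\<rho> i)) ` I" by (intro image_cong) auto
      then show ?thesis unfolding good_def by simp
    qed
    then have sub: "?h ` {\<rho> \<in> \<Omega>. good I \<rho>} \<subseteq> Tr I \<times> PiE ?I' R"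
      using J(1)[OF I] unfolding Tr_def \<Omega>_def by (auto simp: PiE_iff split: if_splits)
    have "finite (PiE ?I' R)" using R by (intro finite_PiE) auto
    then have fin: "finite (Tr I \<times> PiE ?I' R)" using finTr[OF I] by simp
    have "card {\<rho> \<in> \<Omega>. good I \<rho>} \<le> card (Tr I \<times> PiE ?I' R)"
      using inj sub fin by (rule card_inj_on_le)
    also have "\<dots> = card (Tr I) * r ^ (s - 3)"
    proof -
      have "card (PiE ?I' R) = (\<Prod>i\<in>?I'. r)" using R by (subst card_PiE) auto
      then show ?thesis using J[OF I] by (simp add: card_Diff_subset card_cartesian_product)
    qed
    finally show ?thesis .
  qed
  let ?emb = "\<lambda>(I, \<tau>). map \<tau> (sorted_list_of_set I)"
  have mem: "?emb (I, \<tau>) \<in> TL" if "I \<in> J" "\<tau> \<in> Tr I" for I \<tau>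
  proof -
    let ?is = "sorted_list_of_set I"
    have \<tau>: "\<tau> \<in> PiE I R" "good I \<tau>" using that unfolding Tr_def by auto
    have set: "set ?is = I" "length ?is = 3" "sorted_wrt (<) ?is" using J[OF that(1)] by auto
    have srt: "sorted_wrt (<) (map \<phi> (map \<tau> ?is))"
      using set(3) mono[OF \<tau>(1) J(1)[OF that(1)]] set(1)
      unfolding sorted_wrt_map by (auto intro: sorted_wrt_mono_rel[of _ "(<)"])
    have "set (map \<phi> (map \<tau> ?is)) = (\<lambda>i. \<phi> (\<tau> i)) ` I" using set(1) by auto
    then have "sorted_list_of_set ((\<lambda>i. \<phi> (\<tau> i)) ` I) = map \<phi> (map \<tau> ?is)"
      using sorted_list_of_set_strict_sorted[OF srt] by simp
    then have "C (map \<phi> (map \<tau> ?is)) = c" using \<tau>(2) unfolding good_def by simp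
    moreover have "set (map \<tau> ?is) \<subseteq> (\<Union>i<s. R i)"
      using \<tau>(1) set(1) J(1)[OF that(1)] by (auto simp: PiE_iff)
    ultimately show ?thesis using srt set(2) unfolding TL_def by simp
  qed
  have row_unique: "i = j" if "v \<in> R i" "v \<in> R j" "i < s" "j < s" for i j v
    using less[of i j v v] less[of j i v v] that by (metis less_irrefl linorder_neqE_nat)
  \<comment> \<open>Rows are disjoint: every entry of the list determines its row, hence the list
    determines I and the values on I.\<close>
  have "inj_on ?emb (Sigma J Tr)"
  proof (rule inj_onI, clarify)
    fix I \<tau> I' \<tau>'
    assume I: "I \<in> J" "\<tau> \<in> Tr I" and I': "I' \<in> J" "\<tau>' \<in> Tr I'"
      and eq: "map \<tau> (sorted_list_of_set I) = map \<tau>' (sorted_list_of_set I')"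
    have \<tau>: "\<tau> \<in> PiE I R" "\<tau>' \<in> PiE I' R" using I I' unfolding Tr_def by auto
    have "sorted_list_of_set I = sorted_list_of_set I'"
    proof (rule nth_equalityI)
      show "length (sorted_list_of_set I) = length (sorted_list_of_set I')"
        using J[OF I(1)] J[OF I'(1)] by simp
      fix k assume "k < length (sorted_list_of_set I)"
      then have k: "k < 3" using J[OF I(1)] by simp
      let ?i = "sorted_list_of_set I ! k" and ?i' = "sorted_list_of_set I' ! k"
      have mem: "?i \<in> I" "?i' \<in> I'"
        using k J[OF I(1)] J[OF I'(1)] by (metis length_sorted_list_of_set nth_mem set_sorted_list_of_set)+
      have "\<tau> ?i = \<tau>' ?i'"
        using arg_cong[OF eq, of "\<lambda>xs. xs ! k"] k J[OF I(1)] J[OF I'(1)] by simp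
      moreover have "\<tau> ?i \<in> R ?i" "\<tau>' ?i' \<in> R ?i'" using \<tau> mem by (auto simp: PiE_iff)
      ultimately show "?i = ?i'"
        using row_unique[of "\<tau> ?i" ?i ?i'] mem J(1)[OF I(1)] J(1)[OF I'(1)] by auto
    qed
    then have II: "I = I'" using J(2)[OF I(1)] J(2)[OF I'(1)] by (metis set_sorted_list_of_set)
    moreover have "\<tau> = \<tau>'"
    proof (rule PiE_ext[of _ I R])
      show "\<tau> \<in> PiE I R" "\<tau>' \<in> PiE I R" using \<tau> II by auto
      show "\<tau> i = \<tau>' i" if "i \<in> I" for i
        using eq II that J(2)[OF I(1)] by (metis map_eq_conv set_sorted_list_of_set)
    qed
    ultimately show "I = I' \<and> \<tau> = \<tau>'" by blast
  qed
  moreover have "?emb ` Sigma J Tr \<subseteq> TL" using mem by auto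
  moreover have "finite TL"
  proof (rule finite_subset)
    show "TL \<subseteq> {ts. set ts \<subseteq> (\<Union>i<s. R i) \<and> length ts = 3}" unfolding TL_def by auto
    show "finite {ts. set ts \<subseteq> (\<Union>i<s. R i) \<and> length ts = 3}"
      using R by (intro finite_lists_length_eq) auto
  qed
  ultimately have "card (Sigma J Tr) \<le> card TL" by (rule card_inj_on_le)
  then have sumTr: "(\<Sum>I\<in>J. card (Tr I)) \<le> card TL" using finJ finTr by simp
  have "r ^ s * (s choose 3) = (\<Sum>\<rho>\<in>\<Omega>. s choose 3)" using card\<Omega> by simp
  also have "\<dots> \<le> (\<Sum>\<rho>\<in>\<Omega>. 8 * card {I \<in> J. good I \<rho>})" using count\<rho> by (rule sum_mono)
  also have "\<dots> = 8 * (\<Sum>\<rho>\<in>\<Omega>. \<Sum>I\<in>J. if good I \<rho> then 1 else 0)"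
    using finJ by (simp add: sum_distrib_left flip: sum.inter_filter)
  also have "\<dots> = 8 * (\<Sum>I\<in>J. \<Sum>\<rho>\<in>\<Omega>. if good I \<rho> then 1 else 0)" by (subst sum.swap) (rule refl)
  also have "\<dots> = 8 * (\<Sum>I\<in>J. card {\<rho> \<in> \<Omega>. good I \<rho>})"
    using fin\<Omega> by (simp flip: sum.inter_filter)
  also have "\<dots> \<le> 8 * (\<Sum>I\<in>J. card (Tr I) * r ^ (s - 3))" using countI by (intro mult_left_mono sum_mono) auto
  also have "\<dots> \<le> 8 * (card TL * r ^ (s - 3))" using sumTr by (simp flip: sum_distrib_right)
  finally have le: "r ^ s * (s choose 3) \<le> 8 * card TL * r ^ (s - 3)" by simp
  show ?thesis
  proof (cases "s \<ge> 3")
    case True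
    then have "r ^ s = r ^ 3 * r ^ (s - 3)" by (simp flip: power_add)
    then have "r ^ (s - 3) * (r ^ 3 * (s choose 3)) \<le> r ^ (s - 3) * (8 * card TL)" using le by (simp add: mult_ac)
    then show ?thesis using r unfolding TL_def by simp
  next
    case False
    then show ?thesis by (simp add: binomial_eq_0)
  qed
qed

text \<open>The three window vertices all come from slot a, cut into s rows of r vertices. A
  transversal of the rows has s distinct values under \<phi>, so the balance of \<open>C\<close>
  applies to it. The other K - 3 positions range freely over slots of their own.\<close>

lemma coloured_windows_dense:
  fixes \<phi> :: "'a \<Rightarrow> nat" and g f :: real
  assumes U: "finite U" "real K * (g + f) \<le> real (card U)" "g \<ge> 0"
    and fib: "\<And>x. real (card {v \<in> U. \<phi> v = x}) \<le> f"
    and M: "\<And>v. v \<in> U \<Longrightarrow> \<phi> v < M"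
    and C: "\<And>S. S \<subseteq> {..<M} \<Longrightarrow> card S = s \<Longrightarrow>
       s choose 3 \<le> 8 * card {T \<in> [S]\<^bsup>3\<^esup>. C (sorted_list_of_set T) = c}"
    and r: "r > 0" "real s * (real r + f) \<le> g" and a: "a + 3 \<le> K"
  shows "g ^ (K - 3) * (real (r ^ 3 * (s choose 3)) / 8) \<le>
    real (card {vs \<in> vertex_lists K U. sorted_wrt (<) (map \<phi> vs) \<and> C (take 3 (drop a (map \<phi> vs))) = c})"
proof -
  obtain G where slots: "\<forall>i<K. G i \<subseteq> U \<and> g \<le> real (card (G i))"
    "\<forall>i j. i < j \<longrightarrow> j < K \<longrightarrow> (\<forall>v\<in>G i. \<forall>w\<in>G j. \<phi> v < \<phi> w)"
    using ordered_slots[of U K g f \<phi>, OF U fib] by (elim exE conjE)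
  have G: "G i \<subseteq> U" "g \<le> real (card (G i))" if "i < K" for i using slots(1) that by auto
  have less: "\<phi> v < \<phi> w" if "i < j" "j < K" "v \<in> G i" "w \<in> G j" for i j v w
    using slots(2) that by simp
  have finG: "finite (G i)" if "i < K" for i using G(1)[OF that] U(1) finite_subset by blast
  have aK: "a < K" using a by simp
  have fibG: "real (card {v \<in> G a. \<phi> v = x}) \<le> f" for x
  proof -
    have "card {v \<in> G a. \<phi> v = x} \<le> card {v \<in> U. \<phi> v = x}"
      using U(1) G(1)[OF aK] by (intro card_mono) auto
    then show ?thesis using fib[of x] by linarith
  qed
  have "real s * (real r + f) \<le> real (card (G a))" using r(2) G(2)[OF aK] by linarith
  then have "\<exists>H. (\<forall>i<s. H i \<subseteq> G a \<and> real r \<le> real (card (H i))) \<and>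
     (\<forall>i j. i < j \<longrightarrow> j < s \<longrightarrow> (\<forall>v\<in>H i. \<forall>w\<in>H j. \<phi> v < \<phi> w))"
    by (intro ordered_slots[OF finG[OF aK] _ _ fibG]) auto
  then obtain H where rows: "\<forall>i<s. H i \<subseteq> G a \<and> real r \<le> real (card (H i))"
    "\<forall>i j. i < j \<longrightarrow> j < s \<longrightarrow> (\<forall>v\<in>H i. \<forall>w\<in>H j. \<phi> v < \<phi> w)"
    by (elim exE conjE)
  have "\<forall>i. \<exists>T. i < s \<longrightarrow> T \<subseteq> H i \<and> card T = r"
  proof
    fix i
    show "\<exists>T. i < s \<longrightarrow> T \<subseteq> H i \<and> card T = r"
    proof (cases "i < s")
      case True
      then have "r \<le> card (H i)" using rows(1) by simp
      then obtain T where "T \<subseteq> H i" "card T = r" by (rule obtain_subset_with_card_n)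
      then show ?thesis by blast
    qed simp
  qed
  from choice[OF this] obtain R where R: "\<And>i. i < s \<Longrightarrow> R i \<subseteq> H i \<and> card (R i) = r" by blast
  have Ra: "R i \<subseteq> G a" if "i < s" for i using R[OF that] rows(1) that by blast
  define TL where "TL = {ts. length ts = 3 \<and> set ts \<subseteq> (\<Union>i<s. R i) \<and>
     sorted_wrt (<) (map \<phi> ts) \<and> C (map \<phi> ts) = c}"
  have TL: "r ^ 3 * (s choose 3) \<le> 8 * card TL"
    unfolding TL_def
  proof (rule coloured_triples_in_rows[OF C])
    show "finite (R i) \<and> card (R i) = r" if "i < s" for i
      using R[OF that] Ra[OF that] finG[OF aK] finite_subset by blast
    show "\<phi> v < M" if "i < s" "v \<in> R i" for i v
      using Ra[OF that(1)] G(1)[OF aK] M that(2) by blast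
    show "\<phi> v < \<phi> w" if "i < j" "j < s" "v \<in> R i" "w \<in> R j" for i j v w
    proof -
      have "v \<in> H i" "w \<in> H j" using R[of i] R[of j] that by auto
      then show ?thesis using rows(2) that by simp
    qed
  qed (use r in auto)
  have RU: "(\<Union>i<s. R i) \<subseteq> G a" using Ra by blast
  define As where "As = map G [0..<a]"
  define Bs where "Bs = map G [a + 3..<K]"
  let ?F = "{vs \<in> vertex_lists K U. sorted_wrt (<) (map \<phi> vs) \<and> C (take 3 (drop a (map \<phi> vs))) = c}"
  have len: "length As + length Bs = K - 3" using a unfolding As_def Bs_def by simp
  have "g ^ (length As + length Bs) * real (card TL) \<le> real (card ?F)"
  proof (rule card_concat_lists_ge[where h = 3])
    show "finite A \<and> g \<le> real (card A)" if "A \<in> set As \<union> set Bs" for A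
      using that G(2) finG a unfolding As_def Bs_def by auto
    have "TL \<subseteq> vertex_lists 3 (G a)" using RU unfolding TL_def vertex_lists_def by blast
    then show "finite TL" using finite_vertex_lists[OF finG[OF aK]] finite_subset by blast
    show "length xs = 3" if "xs \<in> TL" for xs using that unfolding TL_def by blast
    have "?F \<subseteq> vertex_lists K U" by blast
    then show "finite ?F" using finite_vertex_lists[OF U(1)] finite_subset by blast
    show "xs @ ys @ zs \<in> ?F" if xs: "xs \<in> listset As" and ys: "ys \<in> TL" and zs: "zs \<in> listset Bs" for xs ys zs
    proof -
      have lx: "length xs = a" and xs': "\<And>i. i < a \<Longrightarrow> xs ! i \<in> G i"
        using xs unfolding in_listset_iff As_def by auto
      have lz: "length zs = K - (a + 3)" and zs': "\<And>i. i < K - (a + 3) \<Longrightarrow> zs ! i \<in> G (a + 3 + i)"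
        using zs unfolding in_listset_iff Bs_def by auto
      have ly: "length ys = 3" "set ys \<subseteq> G a" "sorted_wrt (<) (map \<phi> ys)" "C (map \<phi> ys) = c"
        using ys RU unfolding TL_def by auto
      have sx: "\<exists>i<a. x \<in> G i" if "x \<in> set xs" for x
        using that xs' lx by (metis in_set_conv_nth)
      have sz: "\<exists>i<K. a < i \<and> z \<in> G i" if "z \<in> set zs" for z
      proof -
        obtain i where "i < K - (a + 3)" "z = zs ! i" using \<open>z \<in> set zs\<close> lz by (metis in_set_conv_nth)
        then show ?thesis using zs'[of i] by (intro exI[of _ "a + 3 + i"]) auto
      qed
      have "sorted_wrt (<) (map \<phi> xs)"
        using less[OF _ _ xs' xs'] aK lx by (auto simp: sorted_wrt_iff_nth_less)
      moreover have "sorted_wrt (<) (map \<phi> zs)"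
        using less[OF _ _ zs' zs'] lz by (auto simp: sorted_wrt_iff_nth_less)
      moreover have "\<phi> x < \<phi> y" if "x \<in> set xs" "y \<in> set ys" for x y
        using sx[OF that(1)] less[of _ a x y] aK ly(2) that(2) by blast
      moreover have "\<phi> y < \<phi> z" if "y \<in> set ys" "z \<in> set zs" for y z
        using sz[OF that(2)] less[of a _ y z] ly(2) that(1) by blast
      moreover have "\<phi> x < \<phi> z" if "x \<in> set xs" "z \<in> set zs" for x z
        using sx[OF that(1)] sz[OF that(2)] less[of _ _ x z] by (meson less_trans)
      ultimately have "sorted_wrt (<) (map \<phi> (xs @ ys @ zs))"
        using ly(3) by (auto simp: sorted_wrt_append)
      moreover have "set (xs @ ys @ zs) \<subseteq> U"
      proof -
        have "set xs \<subseteq> U" using sx G(1) aK by (meson less_trans subsetD subsetI)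
        moreover have "set zs \<subseteq> U" using sz G(1) by blast
        ultimately show ?thesis using ly(2) G(1)[OF aK] by auto
      qed
      moreover have "take 3 (drop a (map \<phi> (xs @ ys @ zs))) = map \<phi> ys" using lx ly(1) by simp
      moreover have "length (xs @ ys @ zs) = K" using lx ly(1) lz a by simp
      ultimately show ?thesis using ly(4) unfolding vertex_lists_def by simp
    qed
  qed (use U(3) in auto)
  then have F: "g ^ (K - 3) * real (card TL) \<le> real (card ?F)" unfolding len .
  have "real (r ^ 3 * (s choose 3)) \<le> real (8 * card TL)" using TL by (rule of_nat_mono)
  then have "real (r ^ 3 * (s choose 3)) / 8 \<le> real (card TL)" by simp
  then have "g ^ (K - 3) * (real (r ^ 3 * (s choose 3)) / 8) \<le> g ^ (K - 3) * real (card TL)"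
    using U(3) by (intro mult_left_mono) auto
  then show ?thesis using F by linarith
qed

section \<open>Existence of the two edge sets\<close>

lemma ex_triple_unavoidable:
  fixes \<epsilon> \<beta> t p g :: real
  assumes V: "finite V" "V \<noteq> {}" and D: "D > 0"
    and C: "\<And>S c. S \<subseteq> {..<M} \<Longrightarrow> card S = s \<Longrightarrow>
       s choose 3 \<le> 8 * card {T \<in> [S]\<^bsup>3\<^esup>. C (sorted_list_of_set T) = c}"
    and g: "real K * (g + \<beta> * real (card V)) \<le> (\<epsilon> - t) * real (card V)" "g \<ge> 0"
    and r: "r > 0" "real s * (real r + \<beta> * real (card V)) \<le> g"
    and p: "0 < p" "p < 1" "p * real (card V) ^ K \<le> g ^ (K - 3) * (real (r ^ 3 * (s choose 3)) / 8)"
    and \<beta>: "\<beta> \<ge> 0"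
    and m: "real K * real m \<le> t * real (card V) * real D"
    and small: "2 * real K * real (M + 1) ^ card V * (1 - p) ^ m < 1"
  shows "\<exists>E. E \<subseteq> [V]\<^bsup>K\<^esup> \<and> (\<forall>v. hdegree E v \<le> D) \<and> unavoidable_colours K V E 3 M C \<epsilon> \<beta>"
proof -
  define n where "n = real (card V)"
  \<comment> \<open>The value M marks the vertices outside U, so one map on V encodes both U and
    \<phi>; hence the (M + 1) ^ |V| in the union bound.\<close>
  define dom where "dom \<phi> = {v \<in> V. \<phi> v < M}" for \<phi> :: "'a \<Rightarrow> nat"
  define I where "I = {(\<phi>, a, c) \<in> (V \<rightarrow>\<^sub>E {..M}) \<times> {..<K} \<times> (UNIV :: bool set). a + 3 \<le> K \<and>
     \<epsilon> * n \<le> real (card (dom \<phi>)) \<and> (\<forall>x. real (card {v \<in> dom \<phi>. \<phi> v = x}) \<le> \<beta> * n)}"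
  define F where "F = (\<lambda>(\<phi>, a, c). {vs \<in> vertex_lists K (dom \<phi>). sorted_wrt (<) (map \<phi> vs) \<and>
     C (take 3 (drop a (map \<phi> vs))) = c})"
  let ?P = "(V \<rightarrow>\<^sub>E {..M}) \<times> {..<K} \<times> (UNIV :: bool set)"
  have IP: "I \<subseteq> ?P" unfolding I_def by blast
  have finP: "finite ?P" using V(1) by (intro finite_cartesian_product finite_PiE) auto
  have "card ?P = (M + 1) ^ card V * (K * 2)"
    using V(1) by (simp add: card_cartesian_product card_PiE)
  then have "card I \<le> 2 * K * (M + 1) ^ card V" using card_mono[OF finP IP] by (simp add: mult_ac)
  from of_nat_mono[OF this, where 'a = real] have "real (card I) \<le> 2 * real K * real (M + 1) ^ card V" by simp
  then have "real (card I) * (1 - p) ^ m \<le> 2 * real K * real (M + 1) ^ card V * (1 - p) ^ m"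
    using p by (intro mult_right_mono) auto
  then have small': "real (card I) * (1 - p) ^ m < 1" using small by linarith
  have "\<exists>E. E \<subseteq> [V]\<^bsup>K\<^esup> \<and> (\<forall>v. hdegree E v \<le> D) \<and> (\<forall>i\<in>I. \<exists>vs\<in>F i. set vs \<in> E)"
  proof (rule greedy_hitting_hypergraph[where I = I and F = F, OF V finite_subset[OF IP finP] D p(1,2) _ _ m small'])
    fix i assume "i \<in> I"
    then obtain \<phi> a c where i: "i = (\<phi>, a, c)" and a: "a + 3 \<le> K"
      and dom: "\<epsilon> * n \<le> real (card (dom \<phi>))" "\<And>x. real (card {v \<in> dom \<phi>. \<phi> v = x}) \<le> \<beta> * n"
      unfolding I_def by auto
    have domV: "dom \<phi> \<subseteq> V" "finite (dom \<phi>)" using V(1) unfolding dom_def by auto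
    show "F i \<subseteq> {vs \<in> vertex_lists K V. distinct vs}"
    proof
      fix vs assume "vs \<in> F i"
      then have "vs \<in> vertex_lists K (dom \<phi>)" "sorted_wrt (<) (map \<phi> vs)" unfolding F_def i by auto
      moreover have "distinct (map \<phi> vs)" using \<open>sorted_wrt (<) (map \<phi> vs)\<close> strict_sorted_iff by blast
      ultimately show "vs \<in> {vs \<in> vertex_lists K V. distinct vs}"
        using domV unfolding vertex_lists_def by (auto simp: distinct_map)
    qed
    fix W assume W: "W \<subseteq> V" "real (card W) \<le> t * real (card V)"
    \<comment> \<open>Avoiding the saturated vertices costs t of the density \<epsilon>, which is
      why g has to fit into \<epsilon> - t.\<close>
    define U where "U = dom \<phi> - W"
    have finU: "finite U" using domV unfolding U_def by simp
    have "dom \<phi> \<subseteq> U \<union> W" unfolding U_def by blast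
    then have "card (dom \<phi>) \<le> card (U \<union> W)"
      using finU W(1) V(1) by (intro card_mono) (auto intro: finite_subset)
    also have "\<dots> \<le> card U + card W" by (rule card_Un_le)
    finally have "(\<epsilon> - t) * n \<le> real (card U)"
      using dom(1) W(2) unfolding n_def by (simp add: algebra_simps)
    then have cU: "real K * (g + \<beta> * n) \<le> real (card U)" using g(1) unfolding n_def by linarith
    have fibU: "real (card {v \<in> U. \<phi> v = x}) \<le> \<beta> * n" for x
    proof -
      have "card {v \<in> U. \<phi> v = x} \<le> card {v \<in> dom \<phi>. \<phi> v = x}"
        using domV unfolding U_def by (intro card_mono) auto
      then show ?thesis using dom(2)[of x] by linarith
    qed
    have "g ^ (K - 3) * (real (r ^ 3 * (s choose 3)) / 8) \<le>
      real (card {vs \<in> vertex_lists K U. sorted_wrt (<) (map \<phi> vs) \<and> C (take 3 (drop a (map \<phi> vs))) = c})"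
      using r(2) unfolding n_def[symmetric]
      by (intro coloured_windows_dense[OF finU cU g(2) fibU _ C r(1) _ a]) (auto simp: U_def dom_def)
    also have "{vs \<in> vertex_lists K U. sorted_wrt (<) (map \<phi> vs) \<and> C (take 3 (drop a (map \<phi> vs))) = c} =
      {vs \<in> F i. set vs \<inter> W = {}}"
      unfolding F_def i U_def vertex_lists_def by auto
    finally show "p * real (card V) ^ K \<le> real (card {vs \<in> F i. set vs \<inter> W = {}})" using p(3) by linarith
  qed
  then obtain E where E: "E \<subseteq> [V]\<^bsup>K\<^esup>" "\<forall>v. hdegree E v \<le> D" and hits: "\<forall>i\<in>I. \<exists>vs\<in>F i. set vs \<in> E"
    by (elim exE conjE)
  have "unavoidable_colours K V E 3 M C \<epsilon> \<beta>"
    unfolding unavoidable_colours_def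
  proof (intro allI impI)
    fix U and \<phi> :: "'a \<Rightarrow> nat" and a c
    assume U: "U \<subseteq> V" "\<epsilon> * real (card V) \<le> real (card U)" and M: "\<forall>v\<in>U. \<phi> v < M"
      and fib: "\<forall>x. real (card {v \<in> U. \<phi> v = x}) \<le> \<beta> * real (card V)" and a: "a + 3 \<le> K"
    define \<psi> where "\<psi> = restrict (\<lambda>v. if v \<in> U then \<phi> v else M) V"
    have \<psi>: "\<psi> v = \<phi> v" if "v \<in> U" for v using that U(1) unfolding \<psi>_def by auto
    have dom: "dom \<psi> = U" using U(1) M unfolding dom_def \<psi>_def by auto
    have "{v \<in> U. \<psi> v = x} = {v \<in> U. \<phi> v = x}" for x using \<psi> by auto
    moreover have "\<psi> \<in> V \<rightarrow>\<^sub>E {..M}" using M unfolding \<psi>_def by (auto simp: less_imp_le)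
    ultimately have "(\<psi>, a, c) \<in> I"
      using U(2) fib a unfolding I_def n_def by (simp add: dom)
    then obtain vs where vs: "vs \<in> F (\<psi>, a, c)" "set vs \<in> E" using hits by blast
    then have vs': "length vs = K" "set vs \<subseteq> U" "sorted_wrt (<) (map \<psi> vs)" "C (take 3 (drop a (map \<psi> vs))) = c"
      unfolding F_def vertex_lists_def by (auto simp: dom)
    have eq: "map \<psi> vs = map \<phi> vs" using vs'(2) \<psi> by auto
    show "\<exists>vs. set vs \<in> E \<and> set vs \<subseteq> U \<and> length vs = K \<and> sorted_wrt (<) (map \<phi> vs) \<and>
          C (take 3 (drop a (map \<phi> vs))) = c"
      using vs'[unfolded eq] vs(2) by (intro exI[of _ vs] conjI)
  qed
  then show ?thesis using E by (intro exI[of _ E] conjI)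
qed

text \<open>The density p comes from \<open>pair_tuples_dense\<close> and is small because of its
  factor \<theta>. What compensates is the small number of cases, labellings with q values instead
  of maps into M points.\<close>

lemma ex_pair_hitting:
  fixes \<gamma> \<theta> t p :: real
  assumes V: "finite V" "V \<noteq> {}" and D: "D > 0" and pos: "\<gamma> \<ge> 0" "\<theta> \<ge> 0" "18 * t \<le> \<gamma>"
    and p: "0 < p" "p < 1" "p = (\<gamma> / 2) ^ (K - 1) * (\<theta> / 2)"
    and m: "real K * real m \<le> t * real (card V) * real D"
    and small: "real K * real q ^ card V * (1 - p) ^ m < 1"
  shows "\<exists>E. E \<subseteq> [V]\<^bsup>K\<^esup> \<and> (\<forall>v. hdegree E v \<le> D) \<and> pair_hitting K V E \<gamma> \<theta> q"
proof -
  define I where "I = {(g, b) \<in> (V \<rightarrow>\<^sub>E {..<q}) \<times> {..<K}. b + 2 \<le> K \<and> dense_labelling K V \<gamma> \<theta> b g}"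
  define F where "F = (\<lambda>(g :: 'a \<Rightarrow> nat, b). pair_tuples K V b g)"
  let ?P = "(V \<rightarrow>\<^sub>E {..<q}) \<times> {..<K}"
  have IP: "I \<subseteq> ?P" unfolding I_def by blast
  have finP: "finite ?P" using V(1) by (intro finite_cartesian_product finite_PiE) auto
  have "card ?P = q ^ card V * K" using V(1) by (simp add: card_cartesian_product card_PiE)
  then have "card I \<le> K * q ^ card V" using card_mono[OF finP IP] by (simp add: mult_ac)
  from of_nat_mono[OF this, where 'a = real] have "real (card I) \<le> real K * real q ^ card V" by simp
  then have "real (card I) * (1 - p) ^ m \<le> real K * real q ^ card V * (1 - p) ^ m"
    using p by (intro mult_right_mono) auto
  then have small': "real (card I) * (1 - p) ^ m < 1" using small by linarith
  have "\<exists>E. E \<subseteq> [V]\<^bsup>K\<^esup> \<and> (\<forall>v. hdegree E v \<le> D) \<and> (\<forall>i\<in>I. \<exists>vs\<in>F i. set vs \<in> E)"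
  proof (rule greedy_hitting_hypergraph[where I = I and F = F, OF V finite_subset[OF IP finP] D p(1,2) _ _ m small'])
    fix i assume "i \<in> I"
    then obtain g b where i: "i = (g, b)" "b + 2 \<le> K" "dense_labelling K V \<gamma> \<theta> b g" unfolding I_def by auto
    show "F i \<subseteq> {vs \<in> vertex_lists K V. distinct vs}"
    proof
      fix vs assume "vs \<in> F i"
      then have "vs \<in> pair_tuples K V b g" unfolding F_def i by simp
      then show "vs \<in> {vs \<in> vertex_lists K V. distinct vs}"
        using pair_tuples_distinct unfolding pair_tuples_def by blast
    qed
    fix W assume W: "W \<subseteq> V" "real (card W) \<le> t * real (card V)"
    show "p * real (card V) ^ K \<le> real (card {vs \<in> F i. set vs \<inter> W = {}})"
      using pair_tuples_dense[OF V(1) i(3,2) W pos(3,1,2)] unfolding p(3) F_def i(1) by simp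
  qed
  then obtain E where E: "E \<subseteq> [V]\<^bsup>K\<^esup>" "\<forall>v. hdegree E v \<le> D" and hits: "\<forall>i\<in>I. \<exists>vs\<in>F i. set vs \<in> E"
    by (elim exE conjE)
  have "pair_hitting K V E \<gamma> \<theta> q"
    unfolding pair_hitting_def
  proof (intro allI impI)
    fix g :: "'a \<Rightarrow> nat" and b
    assume g: "g \<in> V \<rightarrow> {..<q}" "b + 2 \<le> K" "dense_labelling K V \<gamma> \<theta> b g"
    define g' where "g' = restrict g V"
    have eq: "{v \<in> V. g' v = x} = {v \<in> V. g v = x}"
      "{v \<in> V. \<exists>r. g' v = K + 2 * r + 1} = {v \<in> V. \<exists>r. g v = K + 2 * r + 1}" for x
      unfolding g'_def by auto
    have "dense_labelling K V \<gamma> \<theta> b g'" using g(3) unfolding dense_labelling_def eq .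
    moreover have "g' \<in> V \<rightarrow>\<^sub>E {..<q}" using g(1) unfolding g'_def by auto
    ultimately have "(g', b) \<in> I" using g(2) unfolding I_def by simp
    then obtain vs where vs: "vs \<in> pair_tuples K V b g'" "set vs \<in> E" using hits unfolding F_def by auto
    have "g' (vs ! i) = g (vs ! i)" if "i < K" for i
    proof -
      have "length vs = K" "set vs \<subseteq> V" using vs(1) unfolding pair_tuples_def vertex_lists_def by auto
      then have "vs ! i \<in> V" using that nth_mem by blast
      then show ?thesis unfolding g'_def by simp
    qed
    then have "vs \<in> pair_tuples K V b g" using vs(1) g(2) unfolding pair_tuples_def by simp
    then show "\<exists>vs\<in>pair_tuples K V b g. set vs \<in> E" using vs(2) by blast
  qed
  then show ?thesis using E by (intro exI[of _ E] conjI)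
qed

section \<open>Iteration and the Ramsey number\<close>

lemma unavoidable_colours_mono_edges:
  assumes un: "unavoidable_colours K V E j M C \<epsilon> \<beta>" and sub: "E \<subseteq> E'"
  shows "unavoidable_colours K V E' j M C \<epsilon> \<beta>"
  unfolding unavoidable_colours_def
proof (intro allI impI)
  fix U and \<phi> :: "'a \<Rightarrow> nat" and a c
  assume "U \<subseteq> V" "\<epsilon> * real (card V) \<le> real (card U)" "\<forall>v\<in>U. \<phi> v < M"
    "\<forall>x. real (card {v \<in> U. \<phi> v = x}) \<le> \<beta> * real (card V)" "a + j \<le> K"
  then have "\<exists>vs. set vs \<in> E \<and> set vs \<subseteq> U \<and> length vs = K \<and> sorted_wrt (<) (map \<phi> vs) \<and>
      C (take j (drop a (map \<phi> vs))) = c"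
    by (intro unavoidable_coloursD[OF un]) auto
  then show "\<exists>vs. set vs \<in> E' \<and> set vs \<subseteq> U \<and> length vs = K \<and> sorted_wrt (<) (map \<phi> vs) \<and>
      C (take j (drop a (map \<phi> vs))) = c"
    using sub by blast
qed

lemma pair_hitting_mono_edges:
  "pair_hitting K V E \<gamma> \<theta> q \<Longrightarrow> E \<subseteq> E' \<Longrightarrow> pair_hitting K V E' \<gamma> \<theta> q"
  unfolding pair_hitting_def by (meson subsetD)

lemma hdegree_Un_le:
  assumes "finite E" "finite E'"
  shows "hdegree (E \<union> E') v \<le> hdegree E v + hdegree E' v"
proof -
  have "{e \<in> E \<union> E'. v \<in> e} = {e \<in> E. v \<in> e} \<union> {e \<in> E'. v \<in> e}" by blast
  then show ?thesis unfolding hdegree_def by (simp add: card_Un_le)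
qed

definition iter_exp :: "nat \<Rightarrow> nat \<Rightarrow> nat" where
  "iter_exp i m = ((\<lambda>x. 2 ^ x) ^^ i) m"

lemma iter_exp_simps [simp]: "iter_exp 0 m = m" "iter_exp (Suc i) m = 2 ^ iter_exp i m"
  unfolding iter_exp_def by simp_all

text \<open>A step multiplies \<epsilon> by \<Lambda> and divides \<beta> by 4. Since the
  pair-hitting edges stay fixed, \<theta> and R are adapted to the fibre bound \<beta> / 4 ^ K,
  below all that occur, and \<gamma> to the initial and smallest density \<epsilon>.\<close>

lemma unavoidable_colours_iterate:
  fixes \<epsilon> \<beta> \<gamma> \<theta> \<Lambda> :: real
  assumes V: "finite V" "V \<noteq> {}" and base: "unavoidable_colours K V E 3 M C \<epsilon> \<beta>"
    and hit: "pair_hitting K V E \<gamma> \<theta> q"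
    and \<Lambda>: "\<Lambda> = 16 * real (2 * K + 11)"
    and pos: "\<epsilon> > 0" "\<beta> > 0" and small: "\<gamma> \<le> \<epsilon>" "\<beta> \<le> \<epsilon>" "4 * \<theta> \<le> \<beta> / 4 ^ K"
    and R: "1 \<le> \<beta> / 4 ^ K * real R" "K + 2 * R \<le> q"
    and i: "i \<le> K"
  shows "unavoidable_colours K V E (3 + i) (iter_exp i M) (stepped_up C i) (\<epsilon> * \<Lambda> ^ i) (\<beta> / 4 ^ i)"
  using i
proof (induction i)
  case 0
  then show ?case using base by simp
next
  case (Suc i)
  let ?L = "2 * K + 11"
  have L1: "\<Lambda> \<ge> 1" using \<Lambda> by simp
  then have \<Lambda>i: "\<Lambda> ^ i \<ge> 1" by simp
  then have e: "\<epsilon> \<le> \<epsilon> * \<Lambda> ^ i" using pos by simp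
  have eq: "\<epsilon> * \<Lambda> ^ Suc i = 16 * real ?L * (\<epsilon> * \<Lambda> ^ i)" using \<Lambda> by simp
  have "(4::real) ^ i \<le> 4 ^ K" using Suc.prems by (intro power_increasing) auto
  then have bi: "\<beta> / 4 ^ K \<le> \<beta> / 4 ^ i" using pos by (intro divide_left_mono) auto
  have bi': "\<beta> / 4 ^ i \<le> \<beta>" using pos by (simp add: divide_le_eq)
  have "unavoidable_colours K V E (Suc (3 + i)) (2 ^ iter_exp i M) (step_up (stepped_up C i)) (\<epsilon> * \<Lambda> ^ Suc i) (\<beta> / 4 ^ i / 4)"
  proof (rule unavoidable_colours_step_up[OF V _ hit, where L = ?L and R = R])
    show "unavoidable_colours K V E (3 + i) (iter_exp i M) (stepped_up C i) (\<epsilon> * \<Lambda> ^ i) (\<beta> / 4 ^ i)"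
      using Suc by simp
    show "0 < \<epsilon> * \<Lambda> ^ Suc i" using pos L1 by simp
    show "8 * real ?L * (\<epsilon> * \<Lambda> ^ i) \<le> \<epsilon> * \<Lambda> ^ Suc i"
      unfolding eq using pos L1 by (intro mult_right_mono) auto
    show "16 * real ?L * \<gamma> \<le> \<epsilon> * \<Lambda> ^ Suc i"
      unfolding eq using small(1) e by (intro mult_left_mono) auto
    have "real ?L * (\<beta> / 4 ^ i) \<le> (16 * real ?L) * (\<epsilon> * \<Lambda> ^ i)"
    proof (intro mult_mono)
      show "\<beta> / 4 ^ i \<le> \<epsilon> * \<Lambda> ^ i" using bi' small(2) e by linarith
    qed (use pos in auto)
    then show "real ?L * (\<beta> / 4 ^ i) \<le> \<epsilon> * \<Lambda> ^ Suc i" unfolding eq .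
    show "4 * \<theta> \<le> \<beta> / 4 ^ i" using small(3) bi by linarith
    show "1 \<le> \<beta> / 4 ^ i * real R" using R(1) mult_right_mono[OF bi, of "real R"] by linarith
  qed (use pos R in auto)
  then show ?case by (simp add: mult.commute[of "4 ^ i" "4 :: real"])
qed

section \<open>From unavoidable colours to a lower bound on the Ramsey number\<close>

lemma not_arrows_if_unavoidable:
  assumes K: "K > 0" and V: "finite V" and un: "unavoidable_colours K V E K M C 1 \<beta>"
    and f: "f > 0" "real f \<le> \<beta> * real (card V)" and N: "N \<le> M * f"
    and E: "E \<subseteq> [V]\<^bsup>K\<^esup>"
  shows "\<not> hypergraph_arrows K N V E"
proof
  assume arr: "hypergraph_arrows K N V E"
  \<comment> \<open>Vertex x lies in block x div f. A set with two vertices in one block is coloured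
    by \<open>C\<close> on a shorter list, with whatever result: the edges found below meet K
    distinct blocks.\<close>
  define \<chi> :: "nat set \<Rightarrow> nat" where "\<chi> e = (if C (sorted_list_of_set ((\<lambda>x. x div f) ` e)) then 1 else 0)" for e
  have "\<chi> \<in> [{..<N}]\<^bsup>K\<^esup> \<rightarrow> {..<2}" unfolding \<chi>_def by auto
  then obtain h i where h: "inj_on h V" "h \<in> V \<rightarrow> {..<N}" "\<And>e. e \<in> E \<Longrightarrow> \<chi> (h ` e) = i"
    using arr unfolding hypergraph_arrows_def mono_copy_def by blast
  define \<phi> where "\<phi> v = h v div f" for v
  have \<phi>M: "\<phi> v < M" if "v \<in> V" for v
  proof -
    have "h v < N" using h(2) that by blast
    then have "h v < M * f" using N by simp
    then show ?thesis unfolding \<phi>_def using f(1) by (simp add: div_less_iff_less_mult)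
  qed
  have fib: "real (card {v \<in> V. \<phi> v = x}) \<le> \<beta> * real (card V)" for x
  proof -
    have "h ` {v \<in> V. \<phi> v = x} \<subseteq> {x * f..<x * f + f}"
    proof
      fix y assume "y \<in> h ` {v \<in> V. \<phi> v = x}"
      then have "y div f = x" unfolding \<phi>_def by auto
      then have "x * f + y mod f = y" using div_mult_mod_eq[of y f] by simp
      moreover have "y mod f < f" using f(1) by simp
      ultimately show "y \<in> {x * f..<x * f + f}" unfolding atLeastLessThan_iff by linarith
    qed
    moreover have "inj_on h {v \<in> V. \<phi> v = x}" using h(1) by (auto intro: inj_on_subset)
    ultimately have "card {v \<in> V. \<phi> v = x} \<le> card {x * f..<x * f + f}"
      by (intro card_inj_on_le) auto
    then show ?thesis using f(2) by simp
  qed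
  have col: "\<exists>e\<in>E. \<chi> (h ` e) = (if c then 1 else 0)" for c
  proof -
    obtain vs where vs: "set vs \<in> E" "length vs = K" "sorted_wrt (<) (map \<phi> vs)" "C (take K (drop 0 (map \<phi> vs))) = c"
      using unavoidable_coloursD[OF un subset_refl, of \<phi> 0 c] \<phi>M fib by auto
    have "(\<lambda>x. x div f) ` h ` set vs = set (map \<phi> vs)" unfolding \<phi>_def by auto
    then have "sorted_list_of_set ((\<lambda>x. x div f) ` h ` set vs) = map \<phi> vs"
      using sorted_list_of_set_strict_sorted[OF vs(3)] by simp
    then have "\<chi> (h ` set vs) = (if c then 1 else 0)" using vs(2,4) unfolding \<chi>_def by simp
    then show ?thesis using vs(1) by blast
  qed
  show False using col[of True] col[of False] h(3) by fastforce
qed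

lemma ramsey_number_ge:
  assumes "uniform_hypergraph k V E" "\<And>N. N < M \<Longrightarrow> \<not> hypergraph_arrows k N V E"
  shows "M \<le> ramsey_number k V E"
proof (rule ccontr)
  assume "\<not> M \<le> ramsey_number k V E"
  then have "\<not> hypergraph_arrows k (ramsey_number k V E) V E" using assms(2) by simp
  moreover have "hypergraph_arrows k (ramsey_number k V E) V E"
    unfolding ramsey_number_def using hypergraph_arrows_exists[OF assms(1)] by (rule LeastI_ex)
  ultimately show False by blast
qed

section \<open>Estimates for towers and for the union bound\<close>

lemma tw_ge_1:
  assumes "x \<ge> 1"
  shows "tw (Suc i) x \<ge> 1"
proof (induction i)
  case (Suc i)
  then show ?case by (simp add: ge_one_powr_ge_zero)
qed (use assms in simp)

text \<open>The factor D survives exponentiation: D \<le> 2 ^ (D - 1) gives D * 2 powr T \<le> 2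
  powr (D * T) for T \<ge> 1. It is carried along to pay for the blocks, whose size is only known to
  be at least n / \<Delta>.\<close>

lemma iter_exp_ge_tw:
  fixes x :: real
  assumes x: "x \<ge> 1" and D: "D \<ge> 1" and M: "real D * 2 powr x \<le> real M"
  shows "real D * tw (i + 2) x \<le> real (iter_exp i M)"
proof (induction i)
  case 0
  then show ?case using M by (simp add: numeral_2_eq_2)
next
  case (Suc i)
  let ?T = "tw (i + 2) x"
  define d where "d = real D"
  have T: "?T \<ge> 1" using tw_ge_1[OF x, of "Suc i"] by simp
  have d: "d \<ge> 1" using D unfolding d_def by simp
  obtain D' where D': "D = Suc D'" using D by (cases D) auto
  have "Suc D' \<le> 2 ^ D'" using less_exp[of D'] by (rule Suc_leI)
  from of_nat_mono[OF this, where 'a = real] have "d \<le> 2 powr (d - 1)"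
    unfolding d_def D' by (simp add: powr_realpow)
  also have "\<dots> \<le> 2 powr ((d - 1) * ?T)"
    using T d by (intro powr_mono) (auto simp: mult_le_cancel_left1)
  finally have "d * 2 powr ?T \<le> 2 powr ((d - 1) * ?T) * 2 powr ?T" by (intro mult_right_mono) auto
  also have "\<dots> = 2 powr (d * ?T)" by (simp add: algebra_simps flip: powr_add)
  also have "\<dots> \<le> 2 powr real (iter_exp i M)" using Suc unfolding d_def by (intro powr_mono) auto
  also have "\<dots> = real (iter_exp (Suc i) M)" by (simp add: powr_realpow)
  finally show ?case unfolding d_def by simp
qed

text \<open>Since 1 - p \<le> exp (- p), the logarithm of the product is at most n (ln A + ln B - p
  x), where n \<ge> 1 absorbs the single ln A.\<close>

lemma union_bound_less_1:
  fixes p A B x :: real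
  assumes p: "0 < p" "p < 1" and A: "A \<ge> 1" and B: "B \<ge> 1" and n: "n \<ge> 1"
    and le: "ln A + ln B < p * x" and m: "real n * x \<le> real m"
  shows "A * B ^ n * (1 - p) ^ m < 1"
proof -
  have "1 - p \<le> exp (- p)" using exp_ge_add_one_self[of "- p"] by simp
  then have "(1 - p) ^ m \<le> exp (- p) ^ m" using p by (intro power_mono) auto
  also have "\<dots> = exp (- p * real m)" by (simp add: mult.commute flip: exp_of_nat_mult)
  also have "\<dots> \<le> exp (- p * (real n * x))" using m p by simp
  finally have "A * B ^ n * (1 - p) ^ m \<le> A * B ^ n * exp (- p * (real n * x))"
    using A B by (intro mult_left_mono) auto
  also have "\<dots> = exp (ln A + real n * ln B - p * (real n * x))"
    using A B by (simp add: exp_add exp_diff exp_of_nat_mult exp_minus field_simps)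
  also have "\<dots> < 1"
  proof -
    have "ln A \<le> real n * ln A" using A n by (simp add: mult_le_cancel_right1)
    then have "ln A + real n * ln B - p * (real n * x) \<le> real n * (ln A + ln B - p * x)"
      by (simp add: algebra_simps)
    also have "\<dots> < 0" using le n by (intro mult_pos_neg) auto
    finally show ?thesis by simp
  qed
  finally show ?thesis .
qed

section \<open>Choice of constants and conclusion\<close>

theorem theorem1p1:
  fixes k :: nat
  assumes "k \<ge> 3"
  shows "\<exists>c::real. c > 0 \<and>
    (\<forall>\<Delta> n :: nat. real \<Delta> \<ge> 1 / c \<longrightarrow> n \<ge> 2 ^ \<Delta> \<longrightarrow>
      (\<exists>(V :: nat set) (E :: nat set set).
         uniform_hypergraph k V E \<and> card V = n \<and> max_hdegree V E \<le> \<Delta> \<and>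
         real (ramsey_number k V E) \<ge> tw (k - 1) (c * real \<Delta>) * real n))"
proof -
  define K where "K = real k"
  have K: "K \<ge> 3" using assms unfolding K_def by simp
  define \<Lambda> where "\<Lambda> = 16 * real (2 * k + 11)"
  have \<Lambda>1: "\<Lambda> \<ge> 1" unfolding \<Lambda>_def by simp
  \<comment> \<open>After k - 3 steps, each multiplying by \<Lambda>, the density is exactly 1, so
    the final statement concerns U = V.\<close>
  define \<epsilon> where "\<epsilon> = 1 / \<Lambda> ^ (k - 3)"
  have \<epsilon>: "0 < \<epsilon>" "\<epsilon> \<le> 1" "\<epsilon> * \<Lambda> ^ (k - 3) = 1" using \<Lambda>1 unfolding \<epsilon>_def by auto
  define t where "t = \<epsilon> / 18"
  \<comment> \<open>Density of coloured windows: the first factor comes from the free slots, the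
    second from \<beta> s = \<epsilon> / (8 K), r \<ge> \<beta> n / 2 and the bound (s / 3) ^ 3 for
    s choose 3; 1728 is 8 * 6 ^ 3.\<close>
  define p0 where "p0 = (\<epsilon> / (4 * K)) ^ (k - 3) * ((\<epsilon> / (8 * K)) ^ 3 / 1728)"
  \<comment> \<open>The greedy edges number at least c4 \<Delta> n: D \<ge> \<Delta> / 3 allows t /
    (3 K), and half of it is given up for rounding.\<close>
  define c4 where "c4 = t / (6 * K)"
  \<comment> \<open>As p0 c4 = 2 c1, the gain p0 c4 \<Delta> of the union bound pays for ln (M + 1)
    \<le> c1 \<Delta> + 1 and leaves c1 \<Delta> for the constants.\<close>
  define c1 where "c1 = p0 * c4 / 2"
  \<comment> \<open>The pair density will be c5 / s, and C6 s will bound the number q of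
    labels.\<close>
  define c5 where "c5 = (\<epsilon> / 2) ^ (k - 1) * (\<epsilon> / (8 * K) / 4 ^ (k + 1) / 2)"
  define C6 where "C6 = K + 2 + 2 * 4 ^ k * (8 * K) / \<epsilon>"
  have t: "0 < t" "t < 1" using \<epsilon> unfolding t_def by auto
  have "\<epsilon> / (4 * K) \<le> 1" "\<epsilon> / (8 * K) \<le> 1" using \<epsilon> K by (simp_all add: divide_le_eq)
  then have "(\<epsilon> / (4 * K)) ^ (k - 3) \<le> 1" "(\<epsilon> / (8 * K)) ^ 3 \<le> 1"
    using \<epsilon> K by (auto intro!: power_le_one)
  then have "p0 \<le> 1 * (1 / 1728)" unfolding p0_def using \<epsilon> K by (intro mult_mono) auto
  then have p0: "0 < p0" "p0 < 1" using \<epsilon> K unfolding p0_def by auto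
  have c4: "0 < c4" "c4 \<le> 1" using t K unfolding c4_def by (auto simp: divide_le_eq)
  have "p0 * c4 \<le> 1 * 1" using p0 c4 by (intro mult_mono) auto
  then have c1: "0 < c1" "c1 \<le> 1" using p0 c4 unfolding c1_def by auto
  have "(\<epsilon> / 2) ^ (k - 1) \<le> 1" using \<epsilon> by (auto intro!: power_le_one)
  moreover have "\<epsilon> / (8 * K) / 4 ^ (k + 1) / 2 < 1"
  proof -
    have "\<epsilon> / (8 * K) / 4 ^ (k + 1) \<le> 1 / 1"
      using \<open>\<epsilon> / (8 * K) \<le> 1\<close> by (intro frac_le one_le_power) auto
    then show ?thesis by simp
  qed
  ultimately have "c5 < 1 * 1" unfolding c5_def using \<epsilon> K by (intro mult_le_less_imp_less) auto
  then have c5: "0 < c5" "c5 < 1" using \<epsilon> K unfolding c5_def by auto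
  have C6: "C6 > 0" using \<epsilon> K unfolding C6_def by (simp add: add_pos_pos)
  have "eventually (\<lambda>\<Delta>. ln (2 * K) + 1 < c1 * real \<Delta>) at_top"
    using c1 by real_asymp
  moreover have "eventually (\<lambda>\<Delta>. ln K + ln (C6 * (2 * real \<Delta> powr (2 / 3))) < c5 * c4 / 2 * real \<Delta> powr (1 / 3)) at_top"
    using C6 mult_pos_pos[OF c5(1) c4(1)] by real_asymp
  moreover have "eventually (\<lambda>\<Delta>. 108 * (1 + real \<Delta>) < real \<Delta> powr (4 / 3)) at_top"
    by real_asymp
  moreover have "eventually (\<lambda>\<Delta>. 2 * real \<Delta> \<le> 2 powr (c1 * real \<Delta> / 2)) at_top"
    using c1 by real_asymp
  moreover have "eventually (\<lambda>\<Delta>. 2 / real \<Delta> \<le> \<epsilon> / (8 * K * 4 ^ k) / (2 * real \<Delta> powr (2 / 3))) at_top"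
  proof -
    define c where "c = \<epsilon> / (8 * K * 4 ^ k)"
    have "c > 0" using \<epsilon> K unfolding c_def by simp
    then have "eventually (\<lambda>\<Delta>. 2 / real \<Delta> \<le> c / (2 * real \<Delta> powr (2 / 3))) at_top" by real_asymp
    then show ?thesis unfolding c_def .
  qed
  moreover have "eventually (\<lambda>\<Delta> :: nat. \<Delta> \<ge> 3) at_top" by (rule eventually_ge_at_top)
  ultimately have "eventually (\<lambda>\<Delta> :: nat. ln (2 * K) + 1 < c1 * real \<Delta> \<and>
     ln K + ln (C6 * (2 * real \<Delta> powr (2 / 3))) < c5 * c4 / 2 * real \<Delta> powr (1 / 3) \<and>
     108 * (1 + real \<Delta>) < real \<Delta> powr (4 / 3) \<and> 2 * real \<Delta> \<le> 2 powr (c1 * real \<Delta> / 2) \<and>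
     2 / real \<Delta> \<le> \<epsilon> / (8 * K * 4 ^ k) / (2 * real \<Delta> powr (2 / 3)) \<and> \<Delta> \<ge> 3) at_top"
    by (intro eventually_conj)
  then obtain \<Delta>0 where large: "\<And>\<Delta>. \<Delta> \<ge> \<Delta>0 \<Longrightarrow> ln (2 * K) + 1 < c1 * real \<Delta> \<and>
     ln K + ln (C6 * (2 * real \<Delta> powr (2 / 3))) < c5 * c4 / 2 * real \<Delta> powr (1 / 3) \<and>
     108 * (1 + real \<Delta>) < real \<Delta> powr (4 / 3) \<and> 2 * real \<Delta> \<le> 2 powr (c1 * real \<Delta> / 2) \<and>
     2 / real \<Delta> \<le> \<epsilon> / (8 * K * 4 ^ k) / (2 * real \<Delta> powr (2 / 3)) \<and> \<Delta> \<ge> 3"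
    unfolding eventually_sequentially by blast
  \<comment> \<open>The second entry turns \<Delta> \<ge> 1 / c into \<Delta> \<ge> \<Delta>0; the
    first leaves a factor 2 powr (c1 \<Delta> / 2) of M to absorb 2 \<Delta>.\<close>
  define c where "c = min (c1 / 2) (1 / (real \<Delta>0 + 1))"
  have c: "c > 0" using c1 unfolding c_def by simp
  have "\<exists>(V :: nat set) (E :: nat set set).
         uniform_hypergraph k V E \<and> card V = n \<and> max_hdegree V E \<le> \<Delta> \<and>
         real (ramsey_number k V E) \<ge> tw (k - 1) (c * real \<Delta>) * real n"
    if \<Delta>c: "real \<Delta> \<ge> 1 / c" and n: "n \<ge> 2 ^ \<Delta>" for \<Delta> n :: nat
  proof -
    have "real \<Delta>0 + 1 \<le> 1 / c"
    proof -
      have "c \<le> 1 / (real \<Delta>0 + 1)" unfolding c_def by simp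
      then show ?thesis using c by (simp add: field_simps)
    qed
    then have "\<Delta> \<ge> \<Delta>0" using \<Delta>c by linarith
    note big = large[OF this]
    define x where "x = real \<Delta>"
    have e1: "ln (2 * K) + 1 < c1 * x" and e2: "ln K + ln (C6 * (2 * x powr (2 / 3))) < c5 * c4 / 2 * x powr (1 / 3)"
      and e3: "108 * (1 + x) < x powr (4 / 3)" and e4: "2 * x \<le> 2 powr (c1 * x / 2)"
      and e5: "2 / x \<le> \<epsilon> / (8 * K * 4 ^ k) / (2 * x powr (2 / 3))" and \<Delta>3: "\<Delta> \<ge> 3"
      using big unfolding x_def by simp_all
    have x3: "x \<ge> 3" using \<Delta>3 unfolding x_def by simp
    have cx: "c * x \<ge> 1" "c * x \<le> c1 * x / 2"
    proof -
      show "c * x \<ge> 1" using \<Delta>c c unfolding x_def by (simp add: field_simps)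
      have "c \<le> c1 / 2" unfolding c_def by simp
      from mult_right_mono[OF this, of x] show "c * x \<le> c1 * x / 2" using x3 by simp
    qed
    define N where "N = real n"
    have "\<Delta> < n" using n less_exp[of \<Delta>] by linarith
    then have Nx: "N \<ge> x" unfolding N_def x_def by simp
    then have N0: "N > 0" "n > 0" using x3 unfolding N_def by auto

    define y where "y = x powr (2 / 3)"
    have y1: "y \<ge> 1" using x3 unfolding y_def by (simp add: ge_one_powr_ge_zero)
    define s where "s = nat \<lceil>y\<rceil>"
    have s: "y \<le> real s" "real s \<le> 2 * y"
    proof -
      show "y \<le> real s" unfolding s_def by linarith
      have "real s \<le> y + 1" using y1 unfolding s_def by linarith
      then show "real s \<le> 2 * y" using y1 by linarith
    qed
    have s1: "real s \<ge> 1" using s y1 by linarith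
    have "s \<ge> 3"
    proof -
      have "y * y = x powr (4 / 3)" unfolding y_def by (simp flip: powr_add)
      then have "y * y > 108 * (1 + x)" using e3 by simp
      moreover have "9 < 108 * (1 + x)" using x3 by simp
      ultimately have y9: "y * y > 9" by (rule less_trans[rotated])
      have "y > 3"
      proof (rule ccontr)
        assume "\<not> y > 3"
        then have "y * y \<le> 3 * 3" using y1 by (intro mult_mono) auto
        then show False using y9 by simp
      qed
      then show ?thesis using s(1) by linarith
    qed
    then have choose: "(real s / 3) ^ 3 \<le> real (s choose 3)"
      using binomial_ge_n_over_k_pow_k[of 3 s, where 'a = real] by simp

    define m1 where "m1 = nat \<lfloor>c1 * x\<rfloor>"
    have c1x: "c1 * x \<ge> 0" using c1 x3 by simp
    have m1: "real m1 \<le> c1 * x" "c1 * x - 1 \<le> real m1" using c1x unfolding m1_def by linarith+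
    define M where "M = (2::nat) ^ m1"
    have "2 * real M ^ s < 2 powr (real (s choose 3) / 4)"
    proof -
      have "2 * real M ^ s = 2 powr (1 + real m1 * real s)"
        unfolding M_def by (simp add: powr_add powr_realpow flip: power_mult of_nat_mult)
      also have "\<dots> < 2 powr (real (s choose 3) / 4)"
      proof (intro powr_less_mono)
        have "c1 * x \<le> 1 * x" using c1 x3 by (intro mult_right_mono) auto
        then have "real m1 \<le> x" using m1 by linarith
        then have "real m1 * real s \<le> x * real s" by (intro mult_right_mono) auto
        then have "1 + real m1 * real s \<le> (1 + x) * real s"
          using s1 unfolding distrib_right mult_1_left by linarith
        also have "\<dots> < x powr (4 / 3) / 108 * real s" using e3 s1 by (intro mult_strict_right_mono) auto
        also have "x powr (4 / 3) = y * y" unfolding y_def by (simp flip: powr_add)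
        also have "y * y / 108 * real s \<le> real s * real s / 108 * real s"
          using s(1) y1 by (intro mult_right_mono divide_right_mono mult_mono) auto
        also have "\<dots> = (real s / 3) ^ 3 / 4" by (simp add: power3_eq_cube)
        finally show "1 + real m1 * real s < real (s choose 3) / 4" using choose by linarith
      qed simp
      finally show ?thesis .
    qed
    from balanced_triple_colouring[OF this] obtain C :: "nat list \<Rightarrow> bool" where
      "\<forall>S c. S \<subseteq> {..<M} \<longrightarrow> card S = s \<longrightarrow> s choose 3 \<le> 8 * card {T \<in> [S]\<^bsup>3\<^esup>. C (sorted_list_of_set T) = c}" ..
    then have C: "\<And>S c. S \<subseteq> {..<M} \<Longrightarrow> card S = s \<Longrightarrow>
       s choose 3 \<le> 8 * card {T \<in> [S]\<^bsup>3\<^esup>. C (sorted_list_of_set T) = c}" by simp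

    define V where "V = {..<n}"
    have V: "finite V" "V \<noteq> {}" and cV: "real (card V) = N" "card V = n"
      using N0 unfolding V_def N_def by auto
    \<comment> \<open>Each of the two edge sets may use half of the degree.\<close>
    define D where "D = \<Delta> div 2"
    have D: "D > 0" "real D \<ge> x / 3" "2 * D \<le> \<Delta>"
    proof -
      show "D > 0" "2 * D \<le> \<Delta>" using \<Delta>3 unfolding D_def by auto
      have "3 * D \<ge> \<Delta>" using \<Delta>3 unfolding D_def by presburger
      then show "real D \<ge> x / 3" unfolding x_def by linarith
    qed
    define m where "m = nat \<lfloor>t * N * real D / K\<rfloor>"
    have "t * N * real D / K \<ge> 0" using t N0 K by simp
    then have m: "real m \<le> t * N * real D / K" "t * N * real D / K - 1 \<le> real m"
      unfolding m_def by linarith+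
    have Km: "real k * real m \<le> t * real (card V) * real D"
      using m(1) K unfolding cV(1) K_def[symmetric] by (simp add: field_simps)
    have c4x: "c4 * x > 2"
    proof -
      have "c1 * x > 1" using e1 K ln_ge_zero[of "2 * K"] by linarith
      then have "p0 * (c4 * x) > 2" unfolding c1_def by (simp add: field_simps)
      moreover have "p0 * (c4 * x) \<le> 1 * (c4 * x)" using p0 c4 x3 by (intro mult_right_mono) auto
      ultimately show ?thesis by simp
    qed
    have mge: "real n * (c4 * x) \<le> real m"
    proof -
      have "1 * 2 \<le> N * (c4 * x)" using N0 c4x x3 Nx by (intro mult_mono) auto
      then have "N * (c4 * x) \<le> 2 * (N * (c4 * x)) - 1" by linarith
      also have "2 * (N * (c4 * x)) = t * N * (x / 3) / K" unfolding c4_def using K by (simp add: field_simps)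
      also have "t * N * (x / 3) / K - 1 \<le> t * N * real D / K - 1"
        using D(2) t N0 K by (intro diff_right_mono divide_right_mono mult_left_mono) auto
      finally show ?thesis using m(2) unfolding N_def by linarith
    qed

    \<comment> \<open>As r \<le> \<beta> n, a row with its fibre loss costs at most 2 \<beta> n, and
      s of them fill exactly a slot of size g below.\<close>
    define \<beta> where "\<beta> = \<epsilon> / (8 * K * real s)"
    have \<beta>: "\<beta> > 0" using \<epsilon> K s1 unfolding \<beta>_def by simp
    have \<beta>s: "\<beta> * real s = \<epsilon> / (8 * K)" using s1 unfolding \<beta>_def by simp
    have \<beta>\<epsilon>: "\<beta> \<le> \<epsilon> / (8 * K)" using \<beta> \<beta>s s1 mult_left_mono[of 1 "real s" \<beta>] by simp
    have "\<epsilon> / (8 * K) \<le> \<epsilon> / 1" using \<epsilon> K by (intro divide_left_mono) auto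
    then have \<beta>\<epsilon>': "\<beta> \<le> \<epsilon>" using \<beta>\<epsilon> by simp
    have \<beta>x: "2 / x \<le> \<beta> / 4 ^ k"
    proof -
      have "\<epsilon> / (8 * K * 4 ^ k) / (2 * y) \<le> \<epsilon> / (8 * K * 4 ^ k) / real s"
        using s s1 y1 \<epsilon> K by (intro divide_left_mono) auto
      also have "\<dots> = \<beta> / 4 ^ k" unfolding \<beta>_def by (simp add: mult_ac)
      finally show ?thesis using e5 unfolding y_def by linarith
    qed
    have "\<beta> / 4 ^ k \<le> \<beta> / 1" using \<beta> by (intro divide_left_mono) auto
    then have \<beta>x': "2 / x \<le> \<beta>" using \<beta>x by simp
    have \<beta>N: "\<beta> * N \<ge> 2"
    proof -
      have "2 = 2 / x * x" using x3 by simp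
      also have "\<dots> \<le> \<beta> * N" using \<beta>x' Nx x3 \<beta> by (intro mult_mono) auto
      finally show ?thesis .
    qed
    define r where "r = nat \<lfloor>\<beta> * N\<rfloor>"
    have r: "real r \<le> \<beta> * N" "\<beta> * N / 2 \<le> real r" "r > 0"
      using \<beta>N unfolding r_def by linarith+
    define g where "g = \<epsilon> / (4 * K) * N"

    have "\<exists>E. E \<subseteq> [V]\<^bsup>k\<^esup> \<and> (\<forall>v. hdegree E v \<le> D) \<and> unavoidable_colours k V E 3 M C \<epsilon> \<beta>"
    proof (rule ex_triple_unavoidable[OF V D(1) C _ _ r(3) _ p0 _ _ Km])
      show "real k * (g + \<beta> * real (card V)) \<le> (\<epsilon> - t) * real (card V)"
      proof -
        have "K * (g + \<beta> * N) = (K * (\<epsilon> / (4 * K)) + K * \<beta>) * N" unfolding g_def by (simp add: algebra_simps)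
        also have "\<dots> \<le> (\<epsilon> - t) * N"
        proof (intro mult_right_mono)
          have "K * \<beta> \<le> K * (\<epsilon> / (8 * K))" using \<beta>\<epsilon> K by (intro mult_left_mono) auto
          then show "K * (\<epsilon> / (4 * K)) + K * \<beta> \<le> \<epsilon> - t" using K \<epsilon> unfolding t_def by simp
        qed (use N0 in simp)
        finally show ?thesis unfolding cV(1) K_def .
      qed
      show "0 \<le> g" using \<epsilon> K N0 unfolding g_def by simp
      show "real s * (real r + \<beta> * real (card V)) \<le> g"
      proof -
        have "real s * (real r + \<beta> * N) \<le> real s * (2 * (\<beta> * N))"
          using r(1) by (intro mult_left_mono) linarith+
        also have "\<dots> = 2 * (\<beta> * real s) * N" by simp
        also have "\<dots> = g" unfolding \<beta>s g_def by simp
        finally show ?thesis unfolding cV(1) .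
      qed
      show "p0 * real (card V) ^ k \<le> g ^ (k - 3) * (real (r ^ 3 * (s choose 3)) / 8)"
      proof -
        have "(\<beta> * N / 2) ^ 3 \<le> real r ^ 3" using r(2) \<beta>N by (intro power_mono) auto
        then have "(\<beta> * N / 2) ^ 3 * (real s / 3) ^ 3 \<le> real r ^ 3 * real (s choose 3)"
          using choose \<beta>N by (intro mult_mono) auto
        moreover have "(\<beta> * N / 2) ^ 3 * (real s / 3) ^ 3 = (\<beta> * real s) ^ 3 * N ^ 3 / 216"
          by (simp add: power3_eq_cube)
        ultimately have "(\<epsilon> / (8 * K)) ^ 3 / 1728 * N ^ 3 \<le> real (r ^ 3 * (s choose 3)) / 8"
          unfolding \<beta>s by (simp add: mult.commute)
        then have le: "g ^ (k - 3) * ((\<epsilon> / (8 * K)) ^ 3 / 1728 * N ^ 3) \<le> g ^ (k - 3) * (real (r ^ 3 * (s choose 3)) / 8)"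
          using \<epsilon> K N0 unfolding g_def by (intro mult_left_mono) auto
        have eq: "g ^ (k - 3) * ((\<epsilon> / (8 * K)) ^ 3 / 1728 * N ^ 3) = p0 * (N ^ (k - 3) * N ^ 3)"
          unfolding g_def p0_def power_mult_distrib by simp
        have Nk: "N ^ (k - 3) * N ^ 3 = N ^ k" using assms by (simp flip: power_add)
        show ?thesis using le unfolding eq Nk cV(1) .
      qed
      show "2 * real k * real (M + 1) ^ card V * (1 - p0) ^ m < 1"
        unfolding cV(2) K_def[symmetric]
      proof (rule union_bound_less_1[OF p0 _ _ _ _ mge])
        have "real (M + 1) \<le> 2 ^ (m1 + 1)" unfolding M_def by simp
        then have "ln (real (M + 1)) \<le> ln (2 ^ (m1 + 1))" by (intro ln_mono) auto
        also have "\<dots> = (real m1 + 1) * ln 2" by (subst ln_realpow) auto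
        also have "\<dots> \<le> (real m1 + 1) * 1" using ln_2_less_1 by (intro mult_left_mono) auto
        also have "\<dots> \<le> c1 * x + 1" using m1 by simp
        finally have "ln (2 * K) + ln (real (M + 1)) < 2 * (c1 * x)" using e1 by linarith
        then show "ln (2 * K) + ln (real (M + 1)) < p0 * (c4 * x)" unfolding c1_def by simp
      qed (use K N0 in auto)
    qed (use \<beta> in auto)
    then obtain E1 where E1: "E1 \<subseteq> [V]\<^bsup>k\<^esup>" "\<And>v. hdegree E1 v \<le> D" "unavoidable_colours k V E1 3 M C \<epsilon> \<beta>"
      by blast

    define \<theta> where "\<theta> = \<beta> / 4 ^ (k + 1)"
    define R where "R = nat \<lceil>4 ^ k / \<beta>\<rceil>"
    define q where "q = k + 2 * R"
    have "4 ^ k / \<beta> \<ge> 0" using \<beta> by simp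
    then have R: "4 ^ k / \<beta> \<le> real R" "real R \<le> 4 ^ k / \<beta> + 1" unfolding R_def by linarith+
    have "\<exists>E. E \<subseteq> [V]\<^bsup>k\<^esup> \<and> (\<forall>v. hdegree E v \<le> D) \<and> pair_hitting k V E \<epsilon> \<theta> q"
    proof (rule ex_pair_hitting[OF V D(1) _ _ _ _ _ _ Km])
      show "c5 / real s = (\<epsilon> / 2) ^ (k - 1) * (\<theta> / 2)"
        unfolding c5_def \<theta>_def \<beta>_def using s1 by simp
      show p: "0 < c5 / real s" "c5 / real s < 1" using c5 s1 by (auto simp: divide_less_eq)
      show "real k * real q ^ card V * (1 - c5 / real s) ^ m < 1"
        unfolding cV(2) K_def[symmetric]
      proof (rule union_bound_less_1[OF p _ _ _ _ mge])
        have "4 ^ k / \<beta> = 4 ^ k * (8 * K) / \<epsilon> * real s" unfolding \<beta>_def by simp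
        then have "real q \<le> K + 2 * (4 ^ k * (8 * K) / \<epsilon> * real s + 1)"
          using R(2) unfolding q_def K_def by simp
        also have "\<dots> \<le> (K + 2) * real s + 2 * (4 ^ k * (8 * K) / \<epsilon> * real s)"
          using s1 K mult_left_mono[of 1 "real s" "K + 2"] by simp
        also have "\<dots> = C6 * real s" unfolding C6_def by (simp add: algebra_simps)
        also have "\<dots> \<le> C6 * (2 * y)" using s(2) C6 by (intro mult_left_mono) auto
        finally have "real q \<le> C6 * (2 * y)" .
        moreover have q1: "real q \<ge> 1" using assms unfolding q_def by simp
        ultimately have "ln (real q) \<le> ln (C6 * (2 * y))" by (intro ln_mono) auto
        then have "ln K + ln (real q) < c5 * c4 / 2 * x powr (1 / 3)" using e2 unfolding y_def by linarith
        also have "x powr (1 / 3) = x / y"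
        proof -
          have "x powr (1 / 3) * y = x" using x3 unfolding y_def by (simp flip: powr_add)
          then show ?thesis using y1 by (simp add: field_simps)
        qed
        also have "c5 * c4 / 2 * (x / y) = c5 * (c4 * x) / (2 * y)" by simp
        also have "\<dots> \<le> c5 * (c4 * x) / real s"
          using s y1 s1 c5 c4x by (intro divide_left_mono) auto
        finally show "ln K + ln (real q) < c5 / real s * (c4 * x)" by simp
        show "1 \<le> real q" by (rule q1)
      qed (use K N0 in auto)
    qed (use \<epsilon> \<beta> in \<open>auto simp: \<theta>_def t_def\<close>)
    then obtain E2 where E2: "E2 \<subseteq> [V]\<^bsup>k\<^esup>" "\<And>v. hdegree E2 v \<le> D" "pair_hitting k V E2 \<epsilon> \<theta> q"
      by blast

    define E where "E = E1 \<union> E2"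
    have EV: "E \<subseteq> [V]\<^bsup>k\<^esup>" using E1(1) E2(1) unfolding E_def by blast
    have "finite ([V]\<^bsup>k\<^esup>)" using V(1) by (rule finite_imp_finite_nsets)
    then have fin: "finite E1" "finite E2" using E1(1) E2(1) finite_subset by blast+
    have deg: "hdegree E v \<le> \<Delta>" for v
      using hdegree_Un_le[OF fin, of v] E1(2)[of v] E2(2)[of v] D(3) unfolding E_def by linarith
    have uni: "uniform_hypergraph k V E" using V(1) EV unfolding uniform_hypergraph_def by blast
    define M' where "M' = iter_exp (k - 3) M"
    have "unavoidable_colours k V E (3 + (k - 3)) M' (stepped_up C (k - 3)) (\<epsilon> * \<Lambda> ^ (k - 3)) (\<beta> / 4 ^ (k - 3))"
      unfolding M'_def
    proof (rule unavoidable_colours_iterate[OF V _ _ \<Lambda>_def \<epsilon>(1) \<beta>])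
      show "unavoidable_colours k V E 3 M C \<epsilon> \<beta>"
        using E1(3) unfolding E_def by (rule unavoidable_colours_mono_edges) blast
      show "pair_hitting k V E \<epsilon> \<theta> q"
        using E2(3) unfolding E_def by (rule pair_hitting_mono_edges) blast
      have "1 = \<beta> / 4 ^ k * (4 ^ k / \<beta>)" using \<beta> by simp
      also have "\<dots> \<le> \<beta> / 4 ^ k * real R" using R(1) \<beta> by (intro mult_left_mono) auto
      finally show "1 \<le> \<beta> / 4 ^ k * real R" .
    qed (use \<beta>\<epsilon>' in \<open>auto simp: \<theta>_def q_def\<close>)
    then have un: "unavoidable_colours k V E k M' (stepped_up C (k - 3)) 1 (\<beta> / 4 ^ (k - 3))"
      using assms \<epsilon>(3) by simp
    \<comment> \<open>The largest block size that the fibre bound after k - 3 steps permits. It is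
      at least n / \<Delta> because \<beta> decays only like \<Delta> powr (- 2 / 3).\<close>
    define f where "f = nat \<lfloor>\<beta> / 4 ^ (k - 3) * N\<rfloor>"
    have f: "real f \<le> \<beta> / 4 ^ (k - 3) * N" "N / x \<le> real f"
    proof -
      show "real f \<le> \<beta> / 4 ^ (k - 3) * N" using \<beta> N0 unfolding f_def by simp
      have "(4 :: real) ^ (k - 3) \<le> 4 ^ k" by (intro power_increasing) auto
      then have "\<beta> / 4 ^ k \<le> \<beta> / 4 ^ (k - 3)" using \<beta> by (intro divide_left_mono) auto
      then have "2 / x * N \<le> \<beta> / 4 ^ (k - 3) * N" using \<beta>x N0 by (intro mult_right_mono) auto
      moreover have "N / x \<ge> 1" using Nx x3 by simp
      moreover have "2 / x * N = 2 * (N / x)" by simp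
      ultimately show "N / x \<le> real f" unfolding f_def by linarith
    qed
    have f0: "f > 0"
    proof -
      have "N / x > 0" using N0 x3 by simp
      then show ?thesis using f(2) by linarith
    qed
    have "M' * f \<le> ramsey_number k V E"
    proof (rule ramsey_number_ge[OF uni])
      show "\<not> hypergraph_arrows k N' V E" if "N' < M' * f" for N'
        using not_arrows_if_unavoidable[OF _ V(1) un f0 _ _ EV, of N'] f(1) that assms unfolding cV(1) by simp
    qed
    then have ram: "real M' * real f \<le> real (ramsey_number k V E)"
      by (metis of_nat_le_iff of_nat_mult)
    have "real \<Delta> * tw ((k - 3) + 2) (c * x) \<le> real M'"
      unfolding M'_def
    proof (rule iter_exp_ge_tw[OF cx(1)])
      show "1 \<le> \<Delta>" using \<Delta>3 by simp
      have "x * 2 powr (c * x) \<le> x * 2 powr (c1 * x / 2)" using cx x3 by (intro mult_left_mono powr_mono) auto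
      also have "\<dots> \<le> 2 powr (c1 * x / 2) / 2 * 2 powr (c1 * x / 2)" using e4 by (intro mult_right_mono) auto
      also have "\<dots> = 2 powr (c1 * x - 1)" by (simp add: powr_diff flip: powr_add)
      also have "\<dots> \<le> 2 powr real m1" using m1 by (intro powr_mono) auto
      also have "\<dots> = real M" unfolding M_def by (simp add: powr_realpow)
      finally show "real \<Delta> * 2 powr (c * x) \<le> real M" unfolding x_def .
    qed
    moreover have "(k - 3) + 2 = k - 1" using assms by simp
    ultimately have "x * tw (k - 1) (c * x) \<le> real M'" unfolding x_def by metis
    then have "x * tw (k - 1) (c * x) * (N / x) \<le> real M' * real f"
      using f(2) N0 x3 by (intro mult_mono) auto
    then have "tw (k - 1) (c * x) * N \<le> real (ramsey_number k V E)" using ram x3 by simp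
    moreover have "max_hdegree V E \<le> \<Delta>" unfolding max_hdegree_def using V deg by (intro Max.boundedI) auto
    ultimately show ?thesis using uni cV(2) unfolding x_def N_def by blast
  qed
  then show ?thesis using c by blast
qed

end
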